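(* Let $\lambda_L = M(L)\approx 1.17628$ be the Mahler measure of $L(t)=t^{10}+t^9-t^7-t^6-t^5-t^4-t^3+t+1$. For each integer $i\ge 1$, let $R_i$ be the smallest Mahler measure larger than $1$ among monic integer reciprocal polynomials of degree $2^i$, and let $S_i$ be the smallest Mahler measure larger than $1$ among monic integer skew-reciprocal polynomials of degree $2^i$. Then: (1) $\lambda_L$ is the smallest Mahler measure larger than $1$ among all monic integer polynomials if and only if $R_i=S_i$ for all $i\ge 5$. (2) The set of Mahler measures of monic integer polynomials accumulates at $1$ if and only if $\prod_{i=5}^{N}\frac{R_i}{S_i}$ converges to $\lambda_L^{-1}$ as $N\to\infty$.
   Context: For a monic polynomial $f\in\mathbf{Z}[t]$, its Mahler measure is $M(f)=\prod_{f(\alpha)=0}\max(1,|\alpha|)$, the product over all complex zeroes counted with multiplicity. A polynomial $f\in\mathbf{Z}[t]$ of degree $d$ is reciprocal if $f(t)=t^d f(t^{-1})$. A polynomial $f\in\mathbf{Z}[t]$ of even degree $2d$ is skew-reciprocal if $f(t)=(-1)^d t^{2d} f(-t^{-1})$. *)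

theory Defs
  imports
    "HOL-Analysis.Analysis"
    "Berlekamp_Zassenhaus.Mahler_Measure"
begin

text \<open>\<open>reflect_poly f\<close> is the polynomial \<open>t ^ degree f * f(1/t)\<close>, also when \<open>f(0) = 0\<close>.\<close>

definition reciprocal_poly :: "int poly \<Rightarrow> bool" where
  "reciprocal_poly f \<longleftrightarrow> f = reflect_poly f"

text \<open>
  \<open>pcompose f [:0, -1:]\<close> is \<open>f(-t)\<close>, so its reflection is \<open>t ^ degree f * f(-1/t)\<close>.
\<close>

definition skew_reciprocal_poly :: "int poly \<Rightarrow> bool" where
  "skew_reciprocal_poly f \<longleftrightarrow> even (degree f) \<and>
     f = Polynomial.smult ((-1) ^ (degree f div 2)) (reflect_poly (pcompose f [:0, -1:]))"

lemma poly_eqI_nz: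
  fixes p q :: "complex poly"
  assumes "\<And>t. t \<noteq> 0 \<Longrightarrow> poly p t = poly q t"
  shows "p = q"
proof -
  have "\<not> finite (UNIV - {0::complex})" using infinite_UNIV_char_0 by simp
  moreover have "UNIV - {0} \<subseteq> {t. poly (p - q) t = 0}" using assms by auto
  ultimately have "p - q = 0" using poly_roots_finite[of "p-q"] finite_subset by blast
  thus ?thesis by simp
qed

lemma reciprocal_poly_functional_equation:
  "reciprocal_poly f \<longleftrightarrow>
     (\<forall>t::complex. t \<noteq> 0 \<longrightarrow>
        poly (of_int_poly f) t = t ^ degree f * poly (of_int_poly f) (1 / t))"
proof -
  let ?F = "of_int_poly f :: complex poly"
  have d: "degree ?F = degree f" by simp
  have r: "of_int_poly (reflect_poly f) = reflect_poly ?F"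
    by (intro poly_eqI) (simp add: coeff_reflect_poly)
  have "reciprocal_poly f \<longleftrightarrow> ?F = reflect_poly ?F"
    unfolding reciprocal_poly_def by (metis r of_int_poly_hom.eq_iff)
  also have "\<dots> \<longleftrightarrow> (\<forall>t. t \<noteq> 0 \<longrightarrow> poly ?F t = poly (reflect_poly ?F) t)"
    using poly_eqI_nz by metis
  finally show ?thesis by (simp add: poly_reflect_poly_nz d inverse_eq_divide)
qed

lemma skew_reciprocal_poly_functional_equation:
  assumes "degree f = 2 * d"
  shows "skew_reciprocal_poly f \<longleftrightarrow>
     (\<forall>t::complex. t \<noteq> 0 \<longrightarrow>
        poly (of_int_poly f) t = (-1) ^ d * t ^ (2 * d) * poly (of_int_poly f) (- (1 / t)))"
proof -
  let ?F = "of_int_poly f :: complex poly"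
  let ?G = "pcompose f [:0, -1:]"
  have g: "of_int_poly ?G = pcompose ?F [:0, -1:]"
    by (simp add: of_int_hom.map_poly_pcompose)
  have d: "degree (of_int_poly ?G :: complex poly) = 2 * d"
    using assms by (simp add: degree_pcompose)
  have r: "of_int_poly (Polynomial.smult ((-1) ^ d) (reflect_poly ?G)) =
      Polynomial.smult ((-1) ^ d) (reflect_poly (of_int_poly ?G :: complex poly))" (is "_ = ?H")
    by (intro poly_eqI) (simp add: coeff_reflect_poly)
  have H: "poly ?H t = (-1) ^ d * t ^ (2 * d) * poly ?F (- (1 / t))" if "t \<noteq> 0" for t
    using that assms
    by (simp add: poly_reflect_poly_nz d) (simp add: g poly_pcompose inverse_eq_divide)
  have "skew_reciprocal_poly f \<longleftrightarrow> ?F = ?H"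
    unfolding skew_reciprocal_poly_def using assms
    by (simp flip: r)
  also have "\<dots> \<longleftrightarrow> (\<forall>t. t \<noteq> 0 \<longrightarrow> poly ?F t = poly ?H t)"
    using poly_eqI_nz by metis
  finally show ?thesis using H by metis
qed

text \<open>
  The library's \<open>mahler_measure\<close> carries an extra factor \<open>\<bar>lead_coeff f\<bar>\<close>, which is 1 for the
  monic polynomials considered here.
\<close>

lemma mahler_measure_monic_eq:
  assumes "monic f"
  shows "mahler_measure f = (\<Prod>\<alpha>\<leftarrow>complex_roots_int f. max 1 (cmod \<alpha>))"
  using assms
  by (simp add: mahler_measure_def mahler_measure_poly_def complex_roots_int_def)

definition is_smallest :: "real \<Rightarrow> real set \<Rightarrow> bool" where
  "is_smallest x A \<longleftrightarrow> x \<in> A \<and> (\<forall>y\<in>A. x \<le> y)"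

definition lehmer_poly :: "int poly" where
  "lehmer_poly = [:1, 1, 0, -1, -1, -1, -1, -1, 0, 1, 1:]"

lemma poly_lehmer_poly:
  "poly lehmer_poly t = t^10 + t^9 - t^7 - t^6 - t^5 - t^4 - t^3 + t + 1"
  by (simp add: lehmer_poly_def algebra_simps eval_nat_numeral)

definition lehmer_number :: real where
  "lehmer_number = mahler_measure lehmer_poly"

definition smallest_reciprocal_measure :: "nat \<Rightarrow> real" where
  "smallest_reciprocal_measure i = (THE x. is_smallest x
     {mahler_measure f |f. monic f \<and> reciprocal_poly f \<and> degree f = 2 ^ i \<and> mahler_measure f > 1})"

definition smallest_skew_reciprocal_measure :: "nat \<Rightarrow> real" where
  "smallest_skew_reciprocal_measure i = (THE x. is_smallest x
     {mahler_measure f |f. monic f \<and> skew_reciprocal_poly f \<and> degree f = 2 ^ i \<and> mahler_measure f > 1})"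

end

theory Submission
  imports Defs "Berlekamp_Zassenhaus.Factor_Bound"
begin

text \<open>
  Write \<open>R\<^sub>i\<close> and \<open>S\<^sub>i\<close> for the two minima. A skew-reciprocal polynomial \<open>f\<close> of degree \<open>2\<^sup>i\<close> that is
  also reciprocal up to sign satisfies \<open>f(t) = f(-t)\<close>, hence \<open>f(t) = g(t\<^sup>2)\<close> with \<open>g\<close> reciprocal of
  degree \<open>2\<^sup>i\<^sup>-\<^sup>1\<close>, and polynomials that are not reciprocal up to sign have Mahler measure at least
  \<open>5/4\<close> (a weak form of Smyth's theorem). So \<open>S\<^sub>i = R\<^sub>i\<^sub>-\<^sub>1\<close>, the product telescopes to \<open>R\<^sub>N / R\<^sub>4\<close>, and
  every Mahler measure in \<open>(1, 5/4)\<close> is attained by a reciprocal polynomial of degree \<open>2\<^sup>i\<close> for all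
  large \<open>i\<close>.

  What remains is \<open>R\<^sub>4 = \<lambda>\<^sub>L\<close>. A counterexample \<open>q\<close> of minimal degree \<open>2d \<le> 16\<close> is reciprocal and no
  zero of it is a root of unity, so the nonzero integers \<open>\<Prod>(1 \<mp> \<alpha>\<^sup>k)\<close> and \<open>\<Prod>(\<alpha>\<^sup>2\<^sup>k \<mp> \<alpha>\<^sup>k + 1)\<close> have
  absolute value at least 1. Through an auxiliary function this bounds every power sum of \<open>q\<close>, and
  Newton's identities leave a search tree small enough to be evaluated in the logic; its leaves are
  refuted by further power sums, by exact division and by Graeffe iteration.
\<close>

text \<open>The obstacle is degree 16. For a reciprocal polynomial of degree \<open>2d\<close> the
  triangle inequality bounds the \<open>k\<close>-th power sum only by
  \<open>2d + M^k + M^(-k) - 2\<close>, which confines the coefficients poorly. The auxiliary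
  inequality trades \<open>Re z + Re (1/z)\<close> against the logarithms of \<open>|1 - z|\<close>
  and \<open>|z^2 - z + 1|\<close>, whose sums over the zeros are nonnegative; this lowers
  \<open>2d\<close> to \<open>0.543 d\<close>, at the price of larger penalties for zeros off the
  unit circle. The penalties are expressed through \<open>r + 1/r - 2\<close> with
  \<open>r = |z|\<close> and its square root, because both are superadditive in
  \<open>r \<ge> 1\<close> and therefore add up to an expression in \<open>M\<close> alone.

  The bound 5/4 for nonreciprocal polynomials has to exceed \<open>\<lambda>_L = 1.176...\<close>,
  and for that a single coefficient estimate for bounded analytic functions is enough.

  A factor dividing \<open>t^n - 1\<close> can be split off without changing \<open>M\<close>, so
  minimality of the degree is what makes the integer products nonzero. It also makes the search run
  through every even degree up to 16. The index 5 in the statement comes from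
  \<open>16 = 2^4\<close>, the first power of two that leaves room for Lehmer's polynomial of degree
  10.\<close>

no_notation vec_index (infixl "$" 100)
unbundle no vec_syntax
unbundle fps_syntax
hide_const (open) up_ring.coeff up_ring.monom Module.smult

section \<open>Nonreciprocal polynomials\<close>

text \<open>Schur's description of the functions bounded by 1 on the unit disc, through truncated
  coefficient vectors. With partial sums everything stays inside formal power series: no convergence
  and no boundary values enter.\<close>

definition contractive :: "complex fps \<Rightarrow> bool" where
  "contractive F \<longleftrightarrow> (\<forall>h N. (\<Sum>n\<le>N. (cmod ((F * h) $ n))\<^sup>2) \<le> (\<Sum>n\<le>N. (cmod (h $ n))\<^sup>2))"

lemma contractive_1: "contractive 1"
  by (simp add: contractive_def)

lemma contractive_mult:
  assumes "contractive F" "contractive G"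
  shows "contractive (F * G)"
  using assms unfolding contractive_def mult.assoc by (meson order_trans)

lemma contractive_const:
  assumes "cmod c = 1"
  shows "contractive (fps_const c)"
  using assms by (simp add: contractive_def norm_mult)

lemma blaschke_norm_identity:
  fixes a b \<alpha> :: complex
  shows "(cmod (a + cnj \<alpha> * b))\<^sup>2 - (cmod (b + \<alpha> * a))\<^sup>2 = (1 - (cmod \<alpha>)\<^sup>2) * ((cmod a)\<^sup>2 - (cmod b)\<^sup>2)"
  unfolding cmod_power2 by (simp add: power2_eq_square algebra_simps)

text \<open>In coefficients the equation reads
  \<open>w (n+1) + \<alpha> h (n+1) = h n + cnj \<alpha> w n\<close>, so
  \<open>blaschke_norm_identity\<close> telescopes. The sign of \<open>1 - |\<alpha>|^2\<close> then
  decides which of \<open>w\<close> and \<open>h\<close> dominates, which serves zeros on either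
  side of the unit circle.\<close>

lemma blaschke_energy:
  fixes w h :: "complex fps"
  assumes eq: "(1 - fps_const (cnj \<alpha>) * fps_X) * w = (fps_X - fps_const \<alpha>) * h"
  shows "(1 - (cmod \<alpha>)\<^sup>2) * ((\<Sum>n\<le>N. (cmod (h $ n))\<^sup>2) - (\<Sum>n\<le>N. (cmod (w $ n))\<^sup>2))
           = (cmod (h $ N + cnj \<alpha> * w $ N))\<^sup>2"
proof (induction N)
  case 0
  have "w $ 0 = - \<alpha> * h $ 0"
    using arg_cong[OF eq, of "\<lambda>F. F $ 0"] by simp
  then have w0: "w $ 0 + \<alpha> * h $ 0 = 0" by simp
  show ?case using blaschke_norm_identity[of "h $ 0" \<alpha> "w $ 0"] by (simp add: w0)
next
  case (Suc N)
  have "w $ Suc N - cnj \<alpha> * w $ N = h $ N - \<alpha> * h $ Suc N"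
    using arg_cong[OF eq, of "\<lambda>F. F $ Suc N"]
    by (simp add: left_diff_distrib mult.assoc)
  then have w: "w $ Suc N + \<alpha> * h $ Suc N = h $ N + cnj \<alpha> * w $ N"
    by (simp add: algebra_simps)
  show ?case
    using blaschke_norm_identity[of "h $ Suc N" \<alpha> "w $ Suc N"] Suc.IH
    unfolding w by (simp add: algebra_simps)
qed

lemma contractive_blaschke_inside:
  assumes "cmod \<alpha> < 1" and F: "F * (1 - fps_const (cnj \<alpha>) * fps_X) = fps_X - fps_const \<alpha>"
  shows "contractive F"
  unfolding contractive_def
proof (intro allI)
  fix h :: "complex fps" and N
  have "(1 - fps_const (cnj \<alpha>) * fps_X) * (F * h) = (fps_X - fps_const \<alpha>) * h"
    by (simp flip: F)
  from blaschke_energy[OF this, of N]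
  have "(1 - (cmod \<alpha>)\<^sup>2) * ((\<Sum>n\<le>N. (cmod (h $ n))\<^sup>2) - (\<Sum>n\<le>N. (cmod ((F * h) $ n))\<^sup>2)) \<ge> 0"
    by simp
  moreover have "1 - (cmod \<alpha>)\<^sup>2 > 0" using assms(1) by (simp add: power_less_one_iff)
  ultimately show "(\<Sum>n\<le>N. (cmod ((F * h) $ n))\<^sup>2) \<le> (\<Sum>n\<le>N. (cmod (h $ n))\<^sup>2)"
    by (simp add: zero_le_mult_iff)
qed

lemma contractive_blaschke_outside:
  assumes "cmod \<alpha> > 1" and F: "F * (fps_X - fps_const \<alpha>) = 1 - fps_const (cnj \<alpha>) * fps_X"
  shows "contractive F"
  unfolding contractive_def
proof (intro allI)
  fix h :: "complex fps" and N
  have "(1 - fps_const (cnj \<alpha>) * fps_X) * h = (fps_X - fps_const \<alpha>) * (F * h)"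
    by (simp flip: F)
  from blaschke_energy[OF this, of N]
  have "(1 - (cmod \<alpha>)\<^sup>2) * ((\<Sum>n\<le>N. (cmod ((F * h) $ n))\<^sup>2) - (\<Sum>n\<le>N. (cmod (h $ n))\<^sup>2)) \<ge> 0"
    by simp
  moreover have "1 - (cmod \<alpha>)\<^sup>2 < 0" using assms(1) by simp
  ultimately show "(\<Sum>n\<le>N. (cmod ((F * h) $ n))\<^sup>2) \<le> (\<Sum>n\<le>N. (cmod (h $ n))\<^sup>2)"
    by (simp add: zero_le_mult_iff)
qed

text \<open>Testing contractivity on \<open>1 + y X\<^sup>k\<close> with the optimal \<open>y\<close>.\<close>

lemma contractive_coeff_bound:
  assumes "contractive F" and k: "k \<ge> 1"
  shows "cmod (F $ k) \<le> 1 - (cmod (F $ 0))\<^sup>2"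
proof -
  define c s where "c = cmod (F $ 0)" and "s = cmod (F $ k)"
  have key: "c\<^sup>2 + (cmod (F $ k + y * F $ 0))\<^sup>2 \<le> 1 + (cmod y)\<^sup>2" for y
  proof -
    define h where "h = 1 + fps_const y * fps_X ^ k"
    have h: "h $ n = (if n = 0 then 1 else if n = k then y else 0)" for n
      using k by (auto simp: h_def)
    have Fh: "F * h = F + fps_const y * (F * fps_X ^ k)"
      by (simp add: h_def algebra_simps)
    have "{0, k} \<subseteq> {..k}" by auto
    then have "(\<Sum>n\<in>{0,k}. (cmod ((F * h) $ n))\<^sup>2) \<le> (\<Sum>n\<le>k. (cmod ((F * h) $ n))\<^sup>2)"
      by (intro sum_mono2) auto
    also have "\<dots> \<le> (\<Sum>n\<le>k. (cmod (h $ n))\<^sup>2)"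
      using assms(1) by (simp add: contractive_def)
    also have "\<dots> = (\<Sum>n\<in>{0,k}. (cmod (h $ n))\<^sup>2)"
      by (rule sum.mono_neutral_right) (auto simp: h)
    finally show ?thesis
      using k by (simp add: Fh h c_def fps_X_power_mult_right_nth)
  qed
  have 1: "c\<^sup>2 + s\<^sup>2 \<le> 1" using key[of 0] by (simp add: s_def)
  show ?thesis
  proof (cases "c\<^sup>2 = 1")
    case True
    with 1 have "s\<^sup>2 \<le> 0" by simp
    then have "s = 0" by simp
    then show ?thesis using True by (simp add: s_def c_def)
  next
    case False
    with 1 have c: "c\<^sup>2 < 1" by (smt (verit) zero_le_power2)
    define \<tau> where "\<tau> = 1 / (1 - c\<^sup>2)"
    have \<tau>: "\<tau> > 0" "1 + c\<^sup>2 * \<tau> = \<tau>" using c by (auto simp: \<tau>_def field_simps)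
    define y where "y = of_real \<tau> * F $ k * cnj (F $ 0)"
    have "F $ k + y * F $ 0 = of_real (1 + c\<^sup>2 * \<tau>) * F $ k"
      unfolding y_def c_def of_real_add of_real_mult complex_norm_square by (simp add: algebra_simps)
    then have "cmod (F $ k + y * F $ 0) = \<tau> * s"
      using \<tau> by (simp add: norm_mult s_def)
    moreover have "cmod y = \<tau> * s * c"
      using \<tau> by (simp add: y_def norm_mult s_def c_def)
    ultimately have "(\<tau> * s)\<^sup>2 * (1 - c\<^sup>2) \<le> 1 * (1 - c\<^sup>2)"
      using key[of y] by (simp add: algebra_simps power2_eq_square)
    then have "(\<tau> * s)\<^sup>2 \<le> 1\<^sup>2" using c by simp
    then have "\<tau> * s \<le> 1" by (rule power2_le_imp_le) simp
    then show ?thesis using c unfolding \<tau>_def s_def[symmetric] c_def[symmetric]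
      by (simp add: field_simps)
  qed
qed

text \<open>The functions \<open>g\<close> and \<open>F\<close> with \<open>F / g = (\<Prod>\<alpha>. (X - \<alpha>) / (1 - cnj \<alpha> X))\<close> collect the
  Blaschke factors of the zeros outside, respectively inside, the unit circle.\<close>

lemma blaschke_quotient:
  fixes as :: "complex list"
  obtains F g where "contractive F" "contractive g"
    "(\<Prod>\<alpha>\<leftarrow>as. fps_X - fps_const \<alpha>) * g = F * (\<Prod>\<alpha>\<leftarrow>as. 1 - fps_const (cnj \<alpha>) * fps_X)"
    "cmod (g $ 0) * (\<Prod>\<alpha>\<leftarrow>as. max 1 (cmod \<alpha>)) = 1"
proof -
  have "\<exists>F g. contractive F \<and> contractive g \<and>
    (\<Prod>\<alpha>\<leftarrow>as. fps_X - fps_const \<alpha>) * g = F * (\<Prod>\<alpha>\<leftarrow>as. 1 - fps_const (cnj \<alpha>) * fps_X) \<and>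
    cmod (g $ 0) * (\<Prod>\<alpha>\<leftarrow>as. max 1 (cmod \<alpha>)) = 1"
  proof (induction as)
    case Nil
    show ?case by (intro exI[of _ 1]) (simp add: contractive_1)
  next
    case (Cons \<alpha> as)
    then obtain F g where IH: "contractive F" "contractive g"
      "(\<Prod>\<alpha>\<leftarrow>as. fps_X - fps_const \<alpha>) * g = F * (\<Prod>\<alpha>\<leftarrow>as. 1 - fps_const (cnj \<alpha>) * fps_X)"
      "cmod (g $ 0) * (\<Prod>\<alpha>\<leftarrow>as. max 1 (cmod \<alpha>)) = 1"
      by blast
    have "\<exists>F1 g1. contractive F1 \<and> contractive g1 \<and>
      (fps_X - fps_const \<alpha>) * g1 = F1 * (1 - fps_const (cnj \<alpha>) * fps_X) \<and>
      cmod (g1 $ 0) * max 1 (cmod \<alpha>) = 1"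
    proof -
      consider "cmod \<alpha> < 1" | "cmod \<alpha> = 1" | "cmod \<alpha> > 1" by linarith
      then show ?thesis
      proof cases
        case 1
        define F1 where "F1 = (fps_X - fps_const \<alpha>) * inverse (1 - fps_const (cnj \<alpha>) * fps_X)"
        have F1: "F1 * (1 - fps_const (cnj \<alpha>) * fps_X) = fps_X - fps_const \<alpha>"
          by (simp add: F1_def mult.assoc inverse_mult_eq_1)
        show ?thesis using contractive_blaschke_inside[OF 1 F1] 1
          by (intro exI[of _ F1] exI[of _ 1]) (simp add: F1 contractive_1)
      next
        case 2
        have "\<alpha> * cnj \<alpha> = 1" using 2 by (simp flip: complex_norm_square)
        then have "fps_X - fps_const \<alpha> = fps_const (- \<alpha>) * (1 - fps_const (cnj \<alpha>) * fps_X)"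
          by (simp add: right_diff_distrib flip: mult.assoc fps_const_neg)
        then show ?thesis using 2
          by (intro exI[of _ "fps_const (- \<alpha>)"] exI[of _ 1])
             (simp add: contractive_1 contractive_const)
      next
        case 3
        then have "\<alpha> \<noteq> 0" by auto
        define g1 where "g1 = (1 - fps_const (cnj \<alpha>) * fps_X) * inverse (fps_X - fps_const \<alpha>)"
        have g1: "g1 * (fps_X - fps_const \<alpha>) = 1 - fps_const (cnj \<alpha>) * fps_X"
          using \<open>\<alpha> \<noteq> 0\<close> by (simp add: g1_def mult.assoc inverse_mult_eq_1)
        have "g1 $ 0 = - inverse \<alpha>" by (simp add: g1_def)
        then show ?thesis using contractive_blaschke_outside[OF 3 g1] 3 \<open>\<alpha> \<noteq> 0\<close> g1
          by (intro exI[of _ 1] exI[of _ g1]) (simp add: contractive_1 norm_inverse mult.commute)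
      qed
    qed
    then obtain F1 g1 where 1: "contractive F1" "contractive g1"
      "(fps_X - fps_const \<alpha>) * g1 = F1 * (1 - fps_const (cnj \<alpha>) * fps_X)"
      "cmod (g1 $ 0) * max 1 (cmod \<alpha>) = 1" by blast
    show ?case
    proof (rule exI[of _ "F1 * F"], rule exI[of _ "g1 * g"], intro conjI)
      have "(\<Prod>\<alpha>\<leftarrow>\<alpha> # as. fps_X - fps_const \<alpha>) * (g1 * g)
          = ((fps_X - fps_const \<alpha>) * g1) * ((\<Prod>\<alpha>\<leftarrow>as. fps_X - fps_const \<alpha>) * g)"
        by (simp add: mult_ac)
      also have "\<dots> = (F1 * F) * (\<Prod>\<alpha>\<leftarrow>\<alpha> # as. 1 - fps_const (cnj \<alpha>) * fps_X)"
        unfolding 1(3) IH(3) by (simp add: mult_ac)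
      finally show "(\<Prod>\<alpha>\<leftarrow>\<alpha> # as. fps_X - fps_const \<alpha>) * (g1 * g)
        = (F1 * F) * (\<Prod>\<alpha>\<leftarrow>\<alpha> # as. 1 - fps_const (cnj \<alpha>) * fps_X)" .
      have "cmod ((g1 * g) $ 0) * (\<Prod>\<alpha>\<leftarrow>\<alpha> # as. max 1 (cmod \<alpha>))
          = (cmod (g1 $ 0) * max 1 (cmod \<alpha>)) * (cmod (g $ 0) * (\<Prod>\<alpha>\<leftarrow>as. max 1 (cmod \<alpha>)))"
        by (simp add: norm_mult)
      then show "cmod ((g1 * g) $ 0) * (\<Prod>\<alpha>\<leftarrow>\<alpha> # as. max 1 (cmod \<alpha>)) = 1"
        using 1(4) IH(4) by simp
    qed (use 1 IH in \<open>auto intro: contractive_mult\<close>)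
  qed
  then show ?thesis using that by blast
qed

lemma map_poly_cnj_prod_linear:
  "map_poly cnj (\<Prod>\<alpha>\<leftarrow>as. [:1, - \<alpha>:]) = (\<Prod>\<alpha>\<leftarrow>as. [:1, - cnj \<alpha>:])"
proof -
  interpret cnj: comm_ring_hom cnj by unfold_locales auto
  interpret map_cnj: map_poly_comm_ring_hom cnj ..
  show ?thesis
  proof (induction as)
    case (Cons \<alpha> as)
    have "map_poly cnj [:1, - \<alpha>:] = [:1, - cnj \<alpha>:]"
      by (intro poly_eqI) (simp add: coeff_map_poly coeff_pCons split: nat.splits)
    with Cons show ?case by (simp only: list.map prod_list.Cons map_cnj.hom_mult)
  qed simp
qed

lemma reflect_poly_prod_linear:
  "reflect_poly (\<Prod>\<alpha>\<leftarrow>as. [:- \<alpha>, 1:]) = (\<Prod>\<alpha>\<leftarrow>as. [:1, - \<alpha> :: 'a :: idom:])"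
proof (induction as)
  case (Cons \<alpha> as)
  have "reflect_poly [:- \<alpha>, 1:] = [:1, - \<alpha>:]"
    by (intro poly_eqI) (auto simp: coeff_reflect_poly coeff_pCons split: nat.splits)
  with Cons show ?case by (simp only: list.map prod_list.Cons reflect_poly_mult)
qed simp

lemma of_int_poly_monic_roots:
  assumes "monic f"
  shows "of_int_poly f = (\<Prod>\<alpha>\<leftarrow>complex_roots_int f. [:- \<alpha>, 1:])"
  using complex_roots_int(1)[of f] assms by simp

lemma reflect_of_int_poly:
  "reflect_poly (of_int_poly f :: complex poly) = of_int_poly (reflect_poly f)"
  by (intro poly_eqI) (simp add: coeff_reflect_poly)

text \<open>Up to the sign \<open>f(0)\<close>, the quotient of \<open>f\<close> by its reflection
  equals \<open>F / g\<close> with \<open>F\<close>, \<open>g\<close> contractive and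
  \<open>|F 0| = |g 0| = 1/M\<close>. If \<open>f\<close> is not its reflection up to sign, the
  first coefficient where the two differ does so by a nonzero integer, so
  \<open>|F k - g k| \<ge> 1/M\<close>, while \<open>contractive_coeff_bound\<close> allows at most
  \<open>2 (1 - 1/M^2)\<close>. For \<open>c = 1/M\<close> the inequality
  \<open>c \<le> 2 (1 - c^2)\<close> already fails at \<open>c = 4/5\<close>.\<close>

lemma nonreciprocal_mahler_measure_ge:
  fixes f :: "int poly"
  assumes monic: "monic f" and f0: "\<bar>coeff f 0\<bar> = 1"
    and nonrec: "f \<noteq> reflect_poly f" "f \<noteq> - reflect_poly f"
  shows "mahler_measure f \<ge> 5/4"
proof (rule ccontr)
  define as where "as = complex_roots_int f"
  define M where "M = mahler_measure f"
  assume "\<not> mahler_measure f \<ge> 5/4"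
  then have M: "M < 5/4" by (simp add: M_def)
  obtain F0 g where Fg: "contractive F0" "contractive g"
    "(\<Prod>\<alpha>\<leftarrow>as. fps_X - fps_const \<alpha>) * g = F0 * (\<Prod>\<alpha>\<leftarrow>as. 1 - fps_const (cnj \<alpha>) * fps_X)"
    "cmod (g $ 0) * (\<Prod>\<alpha>\<leftarrow>as. max 1 (cmod \<alpha>)) = 1"
    using blaschke_quotient .
  define P Q where "P = fps_of_poly (of_int_poly f :: complex poly)"
    and "Q = fps_of_poly (of_int_poly (reflect_poly f) :: complex poly)"
  have P: "P = (\<Prod>\<alpha>\<leftarrow>as. fps_X - fps_const \<alpha>)"
    unfolding P_def of_int_poly_monic_roots[OF monic] as_def
    by (simp add: fps_of_poly_prod_list o_def fps_of_poly_pCons algebra_simps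
        flip: fps_const_neg)
  \<comment> \<open>The Blaschke denominators contain the conjugate zeros; as the coefficients are
    real, conjugation leaves the reflected polynomial fixed.\<close>
  have "(of_int_poly (reflect_poly f) :: complex poly) = map_poly cnj (of_int_poly (reflect_poly f))"
    by (intro poly_eqI) (simp add: coeff_map_poly)
  also have "\<dots> = (\<Prod>\<alpha>\<leftarrow>as. [:1, - cnj \<alpha>:])"
    unfolding reflect_of_int_poly[symmetric] of_int_poly_monic_roots[OF monic] as_def
      reflect_poly_prod_linear map_poly_cnj_prod_linear ..
  finally have Q: "Q = (\<Prod>\<alpha>\<leftarrow>as. 1 - fps_const (cnj \<alpha>) * fps_X)"
    unfolding Q_def
    by (simp add: fps_of_poly_prod_list o_def fps_of_poly_pCons algebra_simps flip: fps_const_neg)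
  have c: "cmod (g $ 0) * M = 1"
    using Fg(4) mahler_measure_monic_eq[OF monic] by (simp add: M_def as_def)
  have Q0: "Q $ 0 = 1" using monic by (simp add: Q_def)
  \<comment> \<open>Multiplying by this sign makes the constant terms of \<open>f\<close> and its
    reflection agree, so the first difference has index at least 1.\<close>
  define e where "e = coeff f 0"
  have e: "e * e = 1" using f0 by (auto simp: e_def abs_if split: if_splits)
  have e1: "cmod (of_int e) = 1" using f0 by (simp add: e_def flip: of_int_abs)
  define F where "F = fps_const (of_int e) * F0"
  have F: "contractive F" unfolding F_def by (intro contractive_mult contractive_const e1 Fg)
  define D where "D = Polynomial.smult e f - reflect_poly f"
  have "D \<noteq> 0"
  proof
    assume "D = 0"
    then have "Polynomial.smult e f = reflect_poly f" by (simp add: D_def)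
    moreover have "e = 1 \<or> e = -1" using f0 by (auto simp: e_def)
    ultimately show False using nonrec by (metis smult_1_left smult_minus_left minus_minus)
  qed
  define G where "G = fps_of_poly (of_int_poly D :: complex poly)"
  have G: "G = fps_const (of_int e) * P - Q"
    unfolding G_def D_def P_def Q_def
    by (simp add: of_int_poly_hom.hom_minus fps_of_poly_diff fps_of_poly_smult of_int_hom.map_poly_hom_smult)
  have "G \<noteq> 0" using \<open>D \<noteq> 0\<close> by (simp add: G_def)
  define k where "k = subdegree G"
  have "G $ 0 = 0" using e monic by (simp add: G_def D_def e_def)
  then have k: "k \<ge> 1" using \<open>G \<noteq> 0\<close> unfolding k_def
    by (metis One_nat_def Suc_leI nth_subdegree_nonzero gr0I)
  have Gk: "cmod (G $ k) \<ge> 1"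
  proof -
    have "G $ k \<noteq> 0" using \<open>G \<noteq> 0\<close> by (simp add: k_def)
    then have "coeff D k \<noteq> 0" by (simp add: G_def)
    then show ?thesis by (simp add: G_def flip: of_int_abs)
  qed
  have "(F - g) * Q = G * g"
    using Fg(3) unfolding F_def G P[symmetric] Q[symmetric] by (simp add: algebra_simps)
  then have "F - g = G * (g * inverse Q)"
    using Q0 by (metis inverse_mult_eq_1' mult.assoc mult.right_neutral zero_neq_one)
  also have "G = fps_shift k G * fps_X ^ k"
    unfolding k_def using subdegree_decompose by blast
  finally have "F - g = fps_shift k G * (g * inverse Q) * fps_X ^ k"
    by (simp add: mult_ac)
  then have Fg': "(F - g) $ n = (if n < k then 0 else (fps_shift k G * (g * inverse Q)) $ (n - k))" for n
    by (simp only: fps_X_power_mult_right_nth)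
  from Fg'[of 0] k have F0: "F $ 0 = g $ 0" by simp
  from Fg'[of k] have Fk: "F $ k - g $ k = G $ k * g $ 0" using Q0 by simp
  have "cmod (g $ 0) \<le> cmod (F $ k - g $ k)"
    unfolding Fk norm_mult using Gk mult_right_mono[of 1 "cmod (G $ k)" "cmod (g $ 0)"] by simp
  also have "\<dots> \<le> cmod (F $ k) + cmod (g $ k)" by (rule norm_triangle_ineq4)
  also have "\<dots> \<le> 2 * (1 - (cmod (g $ 0))\<^sup>2)"
    using contractive_coeff_bound[OF F k] contractive_coeff_bound[OF Fg(2) k] F0 by simp
  finally have le: "cmod (g $ 0) \<le> 2 * (1 - (cmod (g $ 0))\<^sup>2)" .
  have "cmod (g $ 0) > 4/5"
  proof (rule ccontr)
    assume "\<not> cmod (g $ 0) > 4/5"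
    moreover have "M \<ge> 1" unfolding M_def using monic by (intro mahler_measure_poly_ge_1) auto
    ultimately have "cmod (g $ 0) * M \<le> 4/5 * M" by (intro mult_right_mono) auto
    then show False using c M by simp
  qed
  then have "(cmod (g $ 0))\<^sup>2 > (4/5)\<^sup>2" by (intro power_strict_mono) auto
  with le \<open>cmod (g $ 0) > 4/5\<close> show False by (simp add: power2_eq_square)
qed

section \<open>Power sums of the zeros\<close>

definition power_sum :: "complex list \<Rightarrow> nat \<Rightarrow> complex" where
  "power_sum ys n = (\<Sum>y\<leftarrow>ys. y ^ n)"

definition reversed_char :: "complex list \<Rightarrow> complex fps" where
  "reversed_char ys = (\<Prod>y\<leftarrow>ys. 1 - fps_const y * fps_X)"

text \<open>This is the logarithmic derivative
  \<open>X E' / E = - (\<Sum>y. y X / (1 - y X))\<close> of \<open>E = (\<Prod>y. 1 - y X)\<close>,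
  cleared of denominators.\<close>

lemma newton_fps:
  "fps_X * fps_deriv (reversed_char ys)
     = - (reversed_char ys * Abs_fps (\<lambda>n. if n = 0 then 0 else power_sum ys n))"
proof (induction ys)
  case Nil
  show ?case by (rule fps_ext) (simp add: reversed_char_def power_sum_def fps_mult_nth)
next
  case (Cons y ys)
  define E S where "E = reversed_char ys" and "S = Abs_fps (\<lambda>n. if n = 0 then 0 else power_sum ys n)"
  define G where "G = Abs_fps (\<lambda>n. if n = 0 then 0 else y ^ n)"
  have G: "(1 - fps_const y * fps_X) * G = fps_const y * fps_X"
  proof (rule fps_ext)
    fix n
    show "((1 - fps_const y * fps_X) * G) $ n = (fps_const y * fps_X) $ n"
      by (cases n) (auto simp: G_def left_diff_distrib mult.assoc fps_X_nth)
  qed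
  have S: "Abs_fps (\<lambda>n. if n = 0 then 0 else power_sum (y # ys) n) = G + S"
    by (rule fps_ext) (simp add: G_def S_def power_sum_def)
  have E: "reversed_char (y # ys) = (1 - fps_const y * fps_X) * E"
    by (simp add: reversed_char_def E_def)
  have "fps_X * fps_deriv ((1 - fps_const y * fps_X) * E)
      = (1 - fps_const y * fps_X) * (fps_X * fps_deriv E) - (fps_const y * fps_X) * E"
    by (simp add: algebra_simps)
  also have "\<dots> = - ((1 - fps_const y * fps_X) * (E * S) + ((1 - fps_const y * fps_X) * G) * E)"
    unfolding Cons.IH[folded E_def S_def] G by simp
  also have "\<dots> = - ((1 - fps_const y * fps_X) * E * (G + S))"
    by (simp add: algebra_simps)
  finally show ?case unfolding S E .
qed

lemma newton_identity:
  "of_nat n * reversed_char ys $ n = - (\<Sum>i<n. reversed_char ys $ i * power_sum ys (n - i))"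
proof -
  have "of_nat n * reversed_char ys $ n = (fps_X * fps_deriv (reversed_char ys)) $ n"
    by (cases n) auto
  also have "\<dots> = - (\<Sum>i=0..n. reversed_char ys $ i * (if n - i = 0 then 0 else power_sum ys (n - i)))"
    by (simp add: newton_fps fps_mult_nth)
  also have "(\<Sum>i=0..n. reversed_char ys $ i * (if n - i = 0 then 0 else power_sum ys (n - i)))
      = (\<Sum>i<n. reversed_char ys $ i * power_sum ys (n - i))"
    by (rule sum.mono_neutral_cong_right) auto
  finally show ?thesis .
qed

text \<open>Newton's recursion divides by \<open>n\<close> once at index \<open>n\<close>, so the
  denominators that accumulate divide \<open>n!\<close>.\<close>

lemma fact_mult_reversed_char_Ints:
  assumes "\<And>n. power_sum ys n \<in> \<int>"
  shows "fact n * reversed_char ys $ n \<in> \<int>"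
proof (induction n rule: less_induct)
  case (less n)
  show ?case
  proof (cases n)
    case 0
    have "reversed_char ys $ 0 = 1" unfolding reversed_char_def by (induction ys) auto
    then show ?thesis using 0 by simp
  next
    case (Suc m)
    have "fact n * reversed_char ys $ n = fact m * (of_nat n * reversed_char ys $ n)"
      by (simp add: Suc)
    also have "\<dots> = - (\<Sum>i<n. (fact m * reversed_char ys $ i) * power_sum ys (n - i))"
      by (simp add: newton_identity sum_distrib_left mult.assoc)
    also have "\<dots> \<in> \<int>"
    proof (intro Ints_minus Ints_sum)
      fix i assume "i \<in> {..<n}"
      then have i: "i \<le> m" "i < n" using Suc by auto
      then have "(fact i :: nat) dvd fact m" by (intro fact_dvd)
      then obtain k where "(fact m :: nat) = fact i * k" by (elim dvdE)
      then have "(fact m :: complex) = fact i * of_nat k"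
        by (metis of_nat_fact of_nat_mult)
      then have "fact m * reversed_char ys $ i = of_nat k * (fact i * reversed_char ys $ i)"
        by (simp only: mult_ac)
      then have "fact m * reversed_char ys $ i \<in> \<int>"
        using less.IH[OF i(2)] by (simp only: Ints_mult Ints_of_nat)
      then show "fact m * reversed_char ys $ i * power_sum ys (n - i) \<in> \<int>"
        using assms by (rule Ints_mult)
    qed
    finally show ?thesis .
  qed
qed

lemma reversed_char_nth_length: "reversed_char ys $ length ys = (\<Prod>y\<leftarrow>ys. - y)"
proof -
  have 0: "reversed_char ys $ n = 0" if "n > length ys" for n and ys
    using that
  proof (induction ys arbitrary: n)
    case (Cons y ys)
    then show ?case
      by (cases n) (auto simp: reversed_char_def left_diff_distrib mult.assoc)
  qed (simp add: reversed_char_def)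
  have Cons: "reversed_char (y # ys) = reversed_char ys - fps_const y * (fps_X * reversed_char ys)"
    for y ys
    by (simp add: reversed_char_def left_diff_distrib mult.assoc)
  show ?thesis
    by (induction ys) (simp_all add: Cons 0, simp add: reversed_char_def)
qed

lemma reversed_char_roots:
  assumes "monic q"
  shows "reversed_char (complex_roots_int q) $ n = of_int (coeff (reflect_poly q) n)"
proof -
  have "of_int_poly (reflect_poly q) = (\<Prod>\<alpha>\<leftarrow>complex_roots_int q. [:1, - \<alpha>:])"
    unfolding reflect_of_int_poly[symmetric] of_int_poly_monic_roots[OF assms]
      reflect_poly_prod_linear ..
  then have "fps_of_poly (of_int_poly (reflect_poly q)) = reversed_char (complex_roots_int q)"
    unfolding reversed_char_def
    by (simp add: fps_of_poly_prod_list o_def fps_of_poly_pCons algebra_simps flip: fps_const_neg)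
  then show ?thesis by (metis fps_of_poly_nth of_int_hom.coeff_map_poly_hom)
qed

lemma power_sum_roots_recursion:
  assumes "monic q" "n \<ge> 1"
  shows "power_sum (complex_roots_int q) n
    = - (of_int (int n * coeff (reflect_poly q) n)
         + (\<Sum>i=1..<n. of_int (coeff (reflect_poly q) i) * power_sum (complex_roots_int q) (n - i)))"
proof -
  have "{..<n} = insert 0 {1..<n}" using assms(2) by auto
  then show ?thesis
    using newton_identity[of n "complex_roots_int q"] assms
    by (simp add: reversed_char_roots algebra_simps)
qed

lemma power_sum_roots_Ints:
  assumes "monic q"
  shows "power_sum (complex_roots_int q) n \<in> \<int>"
proof (induction n rule: less_induct)
  case (less n)
  show ?case
  proof (cases "n = 0")
    case True
    then show ?thesis by (simp add: power_sum_def sum_list_triv)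
  next
    case False
    then show ?thesis
      using less by (subst power_sum_roots_recursion[OF assms])
        (auto intro!: Ints_minus Ints_add Ints_mult Ints_sum simp del: of_int_mult)
  qed
qed

lemma sum_poly_roots_Ints:
  assumes "monic q"
  shows "(\<Sum>\<alpha>\<leftarrow>complex_roots_int q. poly (of_int_poly P) \<alpha>) \<in> \<int>"
proof -
  have "(\<Sum>\<alpha>\<leftarrow>xs. poly (of_int_poly P) \<alpha>)
      = (\<Sum>i\<le>degree P. of_int (coeff P i) * power_sum xs i)" for xs
    by (induction xs)
       (simp_all add: power_sum_def poly_altdef sum.distrib distrib_left)
  then show ?thesis using power_sum_roots_Ints[OF assms]
    by (auto intro!: Ints_sum Ints_mult)
qed

text \<open>Newton's identities only give \<open>n! \<Prod> P(\<alpha>) \<in> \<int>\<close>; applied to all powers of \<open>P\<close> this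
  still excludes \<open>\<bar>\<Prod> P(\<alpha>)\<bar> < 1\<close>.\<close>

lemma prod_poly_roots_ge_1:
  assumes "monic q" and nz: "\<And>\<alpha>. \<alpha> \<in> set (complex_roots_int q) \<Longrightarrow> poly (of_int_poly P) \<alpha> \<noteq> 0"
  shows "(\<Prod>\<alpha>\<leftarrow>complex_roots_int q. cmod (poly (of_int_poly P) \<alpha>)) \<ge> 1"
proof (rule ccontr)
  define as where "as = complex_roots_int q"
  define x where "x = (\<Prod>\<alpha>\<leftarrow>as. poly (of_int_poly P) \<alpha>)"
  define D where "D = length as"
  assume "\<not> (\<Prod>\<alpha>\<leftarrow>complex_roots_int q. cmod (poly (of_int_poly P) \<alpha>)) \<ge> 1"
  then have x1: "cmod x < 1" by (simp add: x_def as_def)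
  have x0: "x \<noteq> 0" using nz by (auto simp: x_def as_def prod_list_zero_iff)
  have int: "fact D * x ^ m \<in> \<int>" for m
  proof -
    define ys where "ys = map (\<lambda>\<alpha>. poly (of_int_poly (P ^ m)) \<alpha>) as"
    have "power_sum ys n = (\<Sum>\<alpha>\<leftarrow>as. poly (of_int_poly (P ^ (m * n))) \<alpha>)" for n
      by (simp add: power_sum_def ys_def o_def of_int_poly_hom.hom_power poly_power power_mult)
    then have "power_sum ys n \<in> \<int>" for n
      using sum_poly_roots_Ints[OF assms(1)] by (simp add: as_def)
    from fact_mult_reversed_char_Ints[OF this, of "length ys"]
    have "fact D * (\<Prod>y\<leftarrow>ys. - y) \<in> \<int>"
      unfolding reversed_char_nth_length by (simp add: D_def ys_def)
    moreover have "(\<Prod>y\<leftarrow>ys. - y) = (-1) ^ D * x ^ m"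
      unfolding ys_def x_def D_def
      by (induction as) (simp_all add: of_int_poly_hom.hom_power poly_power power_mult_distrib)
    ultimately have "fact D * ((-1) ^ D * x ^ m) \<in> \<int>" by simp
    then have "(-1) ^ D * (fact D * ((-1) ^ D * x ^ m)) \<in> \<int>"
      by (rule Ints_mult[rotated]) simp
    also have "(-1) ^ D * (fact D * ((-1) ^ D * x ^ m)) = ((-1) ^ D * (-1) ^ D) * (fact D * x ^ m)"
      by (simp only: mult_ac)
    also have "\<dots> = fact D * x ^ m"
      by (simp flip: power_mult_distrib)
    finally show ?thesis .
  qed
  have ge: "cmod (fact D * x ^ m) \<ge> 1" for m
  proof -
    obtain k where k: "fact D * x ^ m = of_int k" using int[of m] by (auto simp: Ints_def)
    have "fact D * x ^ m \<noteq> 0" using x0 by simp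
    then have "k \<noteq> 0" using k by auto
    then show ?thesis unfolding k by (simp flip: of_int_abs)
  qed
  have "(\<lambda>m. fact D * cmod x ^ m) \<longlonglongrightarrow> fact D * 0"
    by (intro tendsto_intros LIMSEQ_power_zero) (use x1 in auto)
  then have "(\<lambda>m. fact D * cmod x ^ m) \<longlonglongrightarrow> 0" by simp
  then have "eventually (\<lambda>m. fact D * cmod x ^ m < 1) sequentially"
    by (rule order_tendstoD) simp
  then obtain m where "fact D * cmod x ^ m < 1" by (auto simp: eventually_sequentially)
  with ge[of m] show False by (simp add: norm_mult norm_power norm_fact)
qed

section \<open>The auxiliary function\<close>

lemma quadratic_le_on_interval:
  fixes p r s x x0 x1 A :: real
  assumes "p \<ge> 0" "x0 \<le> x" "x \<le> x1"
    and "p * x0\<^sup>2 + r * x0 + s \<le> A" "p * x1\<^sup>2 + r * x1 + s \<le> A"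
  shows "p * x\<^sup>2 + r * x + s \<le> A"
proof (cases "x0 = x1")
  case False
  then have pos: "x1 - x0 > 0" using assms by simp
  have "p * ((x - x0) * (x1 - x)) * (x1 - x0) \<ge> 0"
    using assms pos by (intro mult_nonneg_nonneg) auto
  moreover have "(x1 - x) * (p * x0\<^sup>2 + r * x0 + s) \<le> (x1 - x) * A"
    using assms by (intro mult_left_mono) auto
  moreover have "(x - x0) * (p * x1\<^sup>2 + r * x1 + s) \<le> (x - x0) * A"
    using assms by (intro mult_left_mono) auto
  ultimately have "(x1 - x0) * (p * x\<^sup>2 + r * x + s) \<le> (x1 - x0) * A"
    by (simp add: algebra_simps power2_eq_square)
  then show ?thesis using pos by simp
qed (use assms in auto)

text \<open>As a function of \<open>y\<^sup>2\<close> the expression is convex, although in \<open>y\<close> it need not be.\<close>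

lemma quartic_le_on_interval:
  fixes p r s e y y0 y1 A :: real
  assumes "p \<ge> 0" "e \<ge> 0" "0 \<le> y0" "y0 \<le> y" "y \<le> y1"
    and "p * (y0\<^sup>2)\<^sup>2 + r * y0\<^sup>2 - e * y0 + s \<le> A" "p * (y1\<^sup>2)\<^sup>2 + r * y1\<^sup>2 - e * y1 + s \<le> A"
  shows "p * (y\<^sup>2)\<^sup>2 + r * y\<^sup>2 - e * y + s \<le> A"
proof (cases "y1 = 0")
  case True
  then have "y = y1" using assms by linarith
  then show ?thesis using assms by simp
next
  case False
  then have pos: "y0 + y1 > 0" using assms by linarith
  \<comment> \<open>The curve \<open>- e' * (y^2 + y0 * y1)\<close> meets the line
    \<open>- e * y\<close> at \<open>y0\<close> and \<open>y1\<close> and lies above it between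
    them; it is affine in \<open>y^2\<close>, so the convex case applies.\<close>
  define e' where "e' = e / (y0 + y1)"
  have e': "e' \<ge> 0" "e = e' * (y0 + y1)" using assms pos by (auto simp: e'_def)
  have "p * (y\<^sup>2)\<^sup>2 + (r - e') * y\<^sup>2 + (s - e' * y0 * y1) \<le> A"
  proof (rule quadratic_le_on_interval)
    show "p * (y0\<^sup>2)\<^sup>2 + (r - e') * y0\<^sup>2 + (s - e' * y0 * y1) \<le> A"
      using assms(6) e'(2) by (simp add: algebra_simps power2_eq_square)
    show "p * (y1\<^sup>2)\<^sup>2 + (r - e') * y1\<^sup>2 + (s - e' * y0 * y1) \<le> A"
      using assms(7) e'(2) by (simp add: algebra_simps power2_eq_square)
  qed (use assms in \<open>auto intro: power_mono\<close>)
  moreover have "e' * ((y - y0) * (y1 - y)) \<ge> 0"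
    using e'(1) assms by (intro mult_nonneg_nonneg) auto
  ultimately show ?thesis using e'(2) by (simp add: algebra_simps power2_eq_square)
qed

lemma ln_11_10_bounds: "ln (11/10 :: real) \<ge> 953/10000" "ln (11/10 :: real) \<le> 9532/100000"
  using ln_approx_bounds[of "11/10" 2] by (simp_all add: lessThan_Suc numeral_2_eq_2)

text \<open>Powers of \<open>11/10\<close> serve as the points of tangency \<open>t\<close> in \<open>ln u \<le> u / t - 1 + ln t\<close>;
  \<open>ln_base_power\<close> is a rational upper bound for their logarithms.\<close>

definition base_power :: "int \<Rightarrow> real" where
  "base_power n = (if n \<ge> 0 then (11/10) ^ nat n else (10/11) ^ nat (- n))"

definition ln_base_power :: "int \<Rightarrow> real" where
  "ln_base_power n = of_int n * (if n \<ge> 0 then 9532/100000 else 953/10000)"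

lemma ln_base_power: "base_power n > 0" "ln (base_power n) \<le> ln_base_power n"
proof -
  show "base_power n > 0" by (simp add: base_power_def)
  have inv: "ln (10/11 :: real) = - ln (11/10)" by (simp add: ln_div)
  show "ln (base_power n) \<le> ln_base_power n"
  proof (cases "n \<ge> 0")
    case True
    then show ?thesis
      using mult_left_mono[OF ln_11_10_bounds(2), of "of_int n"]
      by (simp add: base_power_def ln_base_power_def ln_realpow)
  next
    case False
    then show ?thesis
      using mult_left_mono[OF ln_11_10_bounds(1), of "of_int (- n)"]
      by (simp add: base_power_def ln_base_power_def ln_realpow inv)
  qed
qed

lemma ln_le_tangent:
  fixes t u :: real
  assumes "t > 0" "u > 0"
  shows "ln u \<le> u / t - 1 + ln t"
proof -
  have "ln (u / t) \<le> u / t - 1" using assms by (intro ln_le_minus_one) auto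
  then show ?thesis using assms by (simp add: ln_div)
qed

text \<open>Both logarithms of the auxiliary function are replaced by tangents, with \<open>\<delta> = y\<^sup>2\<close>. The weights
  \<open>37/50\<close> and \<open>2/5\<close> were found numerically; they nearly minimise the constant \<open>543/1000\<close> below.\<close>

definition majorant :: "int \<Rightarrow> int \<Rightarrow> real \<Rightarrow> real \<Rightarrow> real" where
  "majorant m n x y = (2 + y\<^sup>2) * x / 2
     + 37/50 * ((2 + y\<^sup>2 - x) / base_power m - 1 + ln_base_power m)
     + 2/5 * (((x - 1)\<^sup>2 + y\<^sup>2 * (4 - x + y\<^sup>2)) / base_power n - 1 + ln_base_power n)
     - 5/2 * y\<^sup>2 - 4/5 * y"

text \<open>For fixed \<open>y\<close> the majorant is convex in \<open>x\<close>, for fixed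
  \<open>x\<close> the preceding lemma applies in \<open>y\<close>; hence the four corners control
  the whole box.\<close>

lemma majorant_le_on_box:
  assumes "x0 \<le> x" "x \<le> x1" "0 \<le> y0" "y0 \<le> y" "y \<le> y1"
    and "majorant m n x0 y0 \<le> A" "majorant m n x1 y0 \<le> A"
    and "majorant m n x0 y1 \<le> A" "majorant m n x1 y1 \<le> A"
  shows "majorant m n x y \<le> A"
proof -
  define u v where "u = 1 / base_power m" and "v = 1 / base_power n"
  define a b where "a = 37/50 * u" and "b = 2/5 * v"
  define c where "c = 37/50 * (ln_base_power m - 1) + 2/5 * (ln_base_power n - 1)"
  have b: "b \<ge> 0" using ln_base_power(1)[of n] by (simp add: b_def v_def)
  have maj: "majorant m n x y = (2 + y\<^sup>2) * x / 2 + 37/50 * ((2 + y\<^sup>2 - x) * u - 1 + ln_base_power m)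
     + 2/5 * (((x - 1)\<^sup>2 + y\<^sup>2 * (4 - x + y\<^sup>2)) * v - 1 + ln_base_power n) - 5/2 * y\<^sup>2 - 4/5 * y" for x y
    by (simp add: majorant_def u_def v_def)
  have eqx: "majorant m n x y = b * x\<^sup>2 + ((2 + y\<^sup>2) / 2 - a - b * (2 + y\<^sup>2)) * x
      + (a * (2 + y\<^sup>2) + b * (1 + y\<^sup>2 * (4 + y\<^sup>2)) + c - 5/2 * y\<^sup>2 - 4/5 * y)" for x y
    unfolding maj a_def b_def c_def
    by (simp add: algebra_simps power2_eq_square add_divide_distrib diff_divide_distrib)
  have eqy: "majorant m n x y = b * (y\<^sup>2)\<^sup>2 + (x / 2 + a + b * (4 - x) - 5/2) * y\<^sup>2 - 4/5 * y
      + (x + a * (2 - x) + b * (x - 1)\<^sup>2 + c)" for x y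
    unfolding maj a_def b_def c_def
    by (simp add: algebra_simps power2_eq_square add_divide_distrib diff_divide_distrib)
  have x: "majorant m n x y' \<le> A" if "majorant m n x0 y' \<le> A" "majorant m n x1 y' \<le> A" for y'
    using that unfolding eqx by (rule quadratic_le_on_interval[OF b assms(1,2)])
  have e: "(0 :: real) \<le> 4/5" by simp
  show ?thesis
    using x[OF assms(6,7)] x[OF assms(8,9)]
    unfolding eqy by (rule quartic_le_on_interval[OF b e assms(3-5)])
qed

text \<open>A subdivision certificate. A leaf carries the exponents of the two points of tangency,
  an inner node the place of the cut; the box itself is passed down during the check.\<close>

datatype box_tree = Leaf int int | SplitX real box_tree box_tree | SplitY real box_tree box_tree

fun box_tree_ok :: "real \<Rightarrow> box_tree \<Rightarrow> real \<Rightarrow> real \<Rightarrow> real \<Rightarrow> real \<Rightarrow> bool" where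
  "box_tree_ok A (Leaf m n) x0 x1 y0 y1 \<longleftrightarrow>
     majorant m n x0 y0 \<le> A \<and> majorant m n x1 y0 \<le> A \<and>
     majorant m n x0 y1 \<le> A \<and> majorant m n x1 y1 \<le> A"
| "box_tree_ok A (SplitX x s t) x0 x1 y0 y1 \<longleftrightarrow> box_tree_ok A s x0 x y0 y1 \<and> box_tree_ok A t x x1 y0 y1"
| "box_tree_ok A (SplitY y s t) x0 x1 y0 y1 \<longleftrightarrow> 0 \<le> y \<and> box_tree_ok A s x0 x1 y0 y \<and> box_tree_ok A t x0 x1 y y1"

lemma box_tree_ok_majorant:
  assumes "box_tree_ok A t x0 x1 y0 y1" "x0 \<le> x" "x \<le> x1" "0 \<le> y0" "y0 \<le> y" "y \<le> y1"
  shows "\<exists>m n. majorant m n x y \<le> A"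
  using assms
proof (induction t arbitrary: x0 x1 y0 y1)
  case (Leaf m n)
  then show ?case using majorant_le_on_box[of x0 x x1 y0 y y1 m n A] by auto
next
  case (SplitX c s t)
  show ?case
    using SplitX.IH(1)[of x0 c y0 y1] SplitX.IH(2)[of c x1 y0 y1] SplitX.prems
    by (cases "x \<le> c") auto
next
  case (SplitY c s t)
  show ?case
    using SplitY.IH(1)[of x0 x1 y0 c] SplitY.IH(2)[of x0 x1 c y1] SplitY.prems
    by (cases "y \<le> c") auto
qed

text \<open>Only rational arithmetic is involved. The boxes are smallest near
  \<open>x = 13/8\<close> and small \<open>y\<close>, close to one of the two maxima that the
  auxiliary function has on the unit circle, the other being near \<open>x = -1/5\<close>.\<close>

lemma box_tree_certificate:
  "box_tree_ok (543/1000) (SplitY 1 (SplitX 0 (SplitX (-1) (Leaf 12 15) (SplitX (-1/2) (Leaf 10 10) (SplitY (1/2) (SplitX (-1/4) (Leaf 9 5) (Leaf 8 3)) (Leaf 9 8)))) (SplitX 1 (SplitY (1/2) (SplitX (1/2) (Leaf 7 (-1)) (Leaf 3 (-8))) (Leaf 2 3)) (SplitY (1/2) (SplitX (3/2) (Leaf (-5) (-7)) (SplitY (1/4) (SplitX (7/4) (SplitX (13/8) (Leaf (-10) (-10)) (Leaf (-12) (-9))) (Leaf (-15) (-6))) (SplitX (7/4) (Leaf (-8) (-1)) (Leaf (-9) 1)))) (SplitY (3/4) (SplitX (3/2) (Leaf (-3) 0) (Leaf (-7) 5)) (Leaf (-3) 9))))) (SplitY (3/2) (Leaf 8 16) (Leaf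 11 25))) (-2) 2 0 2"
  by (simp add: majorant_def base_power_def ln_base_power_def power_divide)

text \<open>Here \<open>x\<close> stands for \<open>2 cos (arg z)\<close> and
  \<open>\<delta>\<close> for \<open>r + 1/r - 2\<close> with \<open>r = |z|\<close>. The terms in
  \<open>\<delta>\<close> on the right vanish on the unit circle.\<close>

lemma auxiliary_inequality:
  fixes x \<delta> :: real
  assumes x: "\<bar>x\<bar> \<le> 2" and \<delta>: "\<delta> \<ge> 0"
    and pos: "2 + \<delta> - x > 0" "(x - 1)\<^sup>2 + \<delta> * (4 - x + \<delta>) > 0"
  shows "(2 + \<delta>) * x / 2 + 37/50 * ln (2 + \<delta> - x) + 2/5 * ln ((x - 1)\<^sup>2 + \<delta> * (4 - x + \<delta>))
           \<le> 543/1000 + 5/2 * \<delta> + 4/5 * sqrt \<delta>"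
proof (cases "sqrt \<delta> \<le> 2")
  case True
  define y where "y = sqrt \<delta>"
  have y: "y\<^sup>2 = \<delta>" "0 \<le> y" using \<delta> by (auto simp: y_def)
  obtain m n where mn: "majorant m n x y \<le> 543/1000"
    using box_tree_ok_majorant[OF box_tree_certificate, of x y] x y True by (auto simp: y_def abs_le_iff)
  define U V where "U = (2 + \<delta> - x) / base_power m - 1 + ln_base_power m"
    and "V = ((x - 1)\<^sup>2 + \<delta> * (4 - x + \<delta>)) / base_power n - 1 + ln_base_power n"
  have "ln (2 + \<delta> - x) \<le> U" unfolding U_def
    using ln_le_tangent[OF ln_base_power(1) pos(1), of m] ln_base_power(2)[of m] by linarith
  moreover have "ln ((x - 1)\<^sup>2 + \<delta> * (4 - x + \<delta>)) \<le> V" unfolding V_def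
    using ln_le_tangent[OF ln_base_power(1) pos(2), of n] ln_base_power(2)[of n] by linarith
  moreover have "(2 + \<delta>) * x / 2 + 37/50 * U + 2/5 * V - 5/2 * \<delta> - 4/5 * sqrt \<delta> \<le> 543/1000"
    using mn unfolding majorant_def y(1) unfolding y_def U_def V_def .
  ultimately show ?thesis by linarith
next
  case False
  \<comment> \<open>Far from the circle crude estimates suffice: with tangents at 2 the left side
    grows like \<open>177/100 * \<delta>\<close>, against \<open>5/2 * \<delta>\<close> on the
    right.\<close>
  then have s: "sqrt \<delta> \<ge> 2" by simp
  have "(sqrt \<delta>)\<^sup>2 \<ge> 2\<^sup>2" using s by (intro power_mono) auto
  then have \<delta>4: "\<delta> \<ge> 4" using \<delta> by simp
  have ln2: "ln (2 :: real) \<le> 7/10" using ln2_le_25_over_36 by simp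
  have 1: "(2 + \<delta>) * x / 2 \<le> 2 + \<delta>"
    using mult_left_mono[of x 2 "2 + \<delta>"] x \<delta> by (simp add: abs_le_iff)
  have "ln (2 + \<delta> - x) \<le> (2 + \<delta> - x) / 2 - 1 + ln 2" using pos by (intro ln_le_tangent) auto
  then have 2: "ln (2 + \<delta> - x) \<le> (4 + \<delta>) / 2 - 3/10" using ln2 x by (simp add: abs_le_iff field_simps)
  have "(x - 1)\<^sup>2 \<le> 3\<^sup>2" using x by (intro abs_le_square_iff[THEN iffD1]) (auto simp: abs_le_iff)
  moreover have "\<delta> * (4 - x + \<delta>) \<le> \<delta> * (6 + \<delta>)" using x \<delta> by (intro mult_left_mono) auto
  ultimately have "(x - 1)\<^sup>2 + \<delta> * (4 - x + \<delta>) \<le> (3 + \<delta>)\<^sup>2"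
    by (simp add: power2_eq_square algebra_simps)
  then have "ln ((x - 1)\<^sup>2 + \<delta> * (4 - x + \<delta>)) \<le> ln ((3 + \<delta>)\<^sup>2)"
    using pos \<delta> by (subst ln_le_cancel_iff) auto
  also have "\<dots> = 2 * ln (3 + \<delta>)" using \<delta> by (simp add: ln_realpow)
  also have "ln (3 + \<delta>) \<le> (3 + \<delta>) / 2 - 1 + ln 2" using \<delta> by (intro ln_le_tangent) auto
  finally have 3: "ln ((x - 1)\<^sup>2 + \<delta> * (4 - x + \<delta>)) \<le> (3 + \<delta>) - 6/10" using ln2 by simp
  have "p + 37/50 * q + 2/5 * w \<le> 543/1000 + 5/2 * \<delta> + 4/5 * sqrt \<delta>"
    if "p \<le> 2 + \<delta>" "q \<le> (4 + \<delta>) / 2 - 3/10" "w \<le> (3 + \<delta>) - 6/10" for p q w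
    using that s \<delta>4 by argo
  from this[OF 1 2 3] show ?thesis .
qed

section \<open>Superadditivity of the distance from the unit circle\<close>

definition excess :: "real \<Rightarrow> real" where
  "excess r = r + 1 / r - 2"

lemma excess_1: "excess 1 = 0"
  by (simp add: excess_def)

lemma excess_inverse: "excess (1 / r) = excess r"
  by (simp add: excess_def)

lemma excess_eq:
  assumes "r > 0"
  shows "excess r = (sqrt r - 1 / sqrt r)\<^sup>2"
  using assms by (simp add: excess_def power2_diff power_divide)

lemma excess_nonneg:
  assumes "r > 0"
  shows "excess r \<ge> 0"
  using excess_eq[OF assms] by simp

lemma sqrt_excess:
  assumes "r \<ge> 1"
  shows "sqrt (excess r) = sqrt r - 1 / sqrt r"
proof -
  have "1 / sqrt r \<le> 1" "1 \<le> sqrt r" using assms by auto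
  then have "sqrt r - 1 / sqrt r \<ge> 0" by linarith
  then show ?thesis using assms by (simp add: excess_eq)
qed

text \<open>For \<open>r = exp (2 u)\<close> the excess is \<open>4 (sinh u)^2\<close> and its root
  is \<open>2 sinh u\<close>, both convex in \<open>u \<ge> 0\<close> and zero at
  \<open>u = 0\<close>; convexity of this kind yields superadditivity. The proof is the
  corresponding polynomial identity.\<close>

lemma excess_superadditive:
  assumes "r \<ge> 1" "s \<ge> 1"
  shows "excess r + excess s \<le> excess (r * s)"
proof -
  have "(r - 1) * (s - 1) + (1 - 1 / r) * (1 - 1 / s) \<ge> 0"
    using assms by (intro add_nonneg_nonneg mult_nonneg_nonneg) auto
  then show ?thesis using assms by (simp add: excess_def algebra_simps)
qed

lemma sqrt_excess_superadditive:
  assumes "r \<ge> 1" "s \<ge> 1"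
  shows "sqrt (excess r) + sqrt (excess s) \<le> sqrt (excess (r * s))"
proof -
  define u v where "u = sqrt r" and "v = sqrt s"
  have u: "u \<ge> 1" and v: "v \<ge> 1" using assms by (auto simp: u_def v_def)
  have "r * s \<ge> 1" using assms mult_mono[of 1 r 1 s] by simp
  have *: "1 - 1 / w \<le> w - 1" if "w \<ge> 1" for w :: real
  proof -
    have "(w - 1) * (w - 1) / w \<ge> 0" using that by simp
    also have "(w - 1) * (w - 1) / w = (w - 1) - (1 - 1 / w)"
      using that by (simp add: field_simps)
    finally show ?thesis by simp
  qed
  have "(1 - 1 / u) * (1 - 1 / v) \<le> (u - 1) * (v - 1)"
    using u v by (intro mult_mono *) auto
  then have "(u - 1 / u) + (v - 1 / v) \<le> u * v - 1 / (u * v)"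
    using u v by (simp add: algebra_simps)
  then show ?thesis
    using assms \<open>r * s \<ge> 1\<close> by (simp add: sqrt_excess u_def v_def real_sqrt_mult)
qed

lemma sum_superadditive_le:
  fixes g :: "real \<Rightarrow> real"
  assumes "g 1 = 0" and "\<And>r s. r \<ge> 1 \<Longrightarrow> s \<ge> 1 \<Longrightarrow> g r + g s \<le> g (r * s)"
    and "\<And>x. x \<in> set xs \<Longrightarrow> h x \<ge> 1"
  shows "(\<Sum>x\<leftarrow>xs. g (h x)) \<le> g (\<Prod>x\<leftarrow>xs. h x)"
  using assms(3)
proof (induction xs)
  case Nil
  then show ?case by (simp add: assms(1))
next
  case (Cons x xs)
  have "(\<Prod>x\<leftarrow>xs. h x) \<ge> 1" using Cons.prems by (intro prod_list_ge1) auto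
  then have "g (h x) + g (\<Prod>x\<leftarrow>xs. h x) \<le> g (h x * (\<Prod>x\<leftarrow>xs. h x))"
    using Cons.prems by (intro assms(2)) auto
  moreover have "(\<Sum>x\<leftarrow>xs. g (h x)) \<le> g (\<Prod>x\<leftarrow>xs. h x)" using Cons by auto
  ultimately show ?case by simp
qed

text \<open>Since the product of all moduli is 1, the moduli above 1 and the inverses of those below
  1 have the same product. Superadditivity applies to each group, which accounts for the factor
  2.\<close>

lemma sum_excess_le:
  fixes g :: "real \<Rightarrow> real"
  assumes g: "g 1 = 0" "\<And>r s. r \<ge> 1 \<Longrightarrow> s \<ge> 1 \<Longrightarrow> g r + g s \<le> g (r * s)" "\<And>r. g (1 / r) = g r"
    and h: "\<And>x. x \<in> set xs \<Longrightarrow> h x > 0" and prod: "(\<Prod>x\<leftarrow>xs. h x) = 1"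
  shows "(\<Sum>x\<leftarrow>xs. g (h x)) \<le> 2 * g (\<Prod>x\<leftarrow>xs. max 1 (h x))"
proof -
  have split: "g r = g (max 1 r) + g (max 1 (1 / r))" if "r > 0" for r
    using that g(1,3) by (cases "r \<ge> 1") (auto simp: max_def)
  have "(\<Sum>x\<leftarrow>xs. g (h x)) = (\<Sum>x\<leftarrow>xs. g (max 1 (h x)) + g (max 1 (1 / h x)))"
    by (intro arg_cong[where f = sum_list] map_cong[OF refl] split h)
  also have "\<dots> = (\<Sum>x\<leftarrow>xs. g (max 1 (h x))) + (\<Sum>x\<leftarrow>xs. g (max 1 (1 / h x)))"
    by (rule sum_list_addf)
  also have "\<dots> \<le> g (\<Prod>x\<leftarrow>xs. max 1 (h x)) + g (\<Prod>x\<leftarrow>xs. max 1 (1 / h x))"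
    using sum_superadditive_le[of g xs "\<lambda>x. max 1 (h x)", OF g(1,2)]
      sum_superadditive_le[of g xs "\<lambda>x. max 1 (1 / h x)", OF g(1,2)] by (intro add_mono) auto
  finally have le: "(\<Sum>x\<leftarrow>xs. g (h x))
      \<le> g (\<Prod>x\<leftarrow>xs. max 1 (h x)) + g (\<Prod>x\<leftarrow>xs. max 1 (1 / h x))" .
  have "(\<Prod>x\<leftarrow>xs. max 1 (1 / h x)) * (\<Prod>x\<leftarrow>xs. h x) = (\<Prod>x\<leftarrow>xs. max 1 (h x))"
    using h
  proof (induction xs)
    case (Cons x xs)
    have "max 1 (1 / h x) * h x = max 1 (h x)"
      using Cons.prems[of x] by (auto simp: max_def field_simps)
    then have "(max 1 (1 / h x) * h x) * ((\<Prod>x\<leftarrow>xs. max 1 (1 / h x)) * (\<Prod>x\<leftarrow>xs. h x))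
        = max 1 (h x) * (\<Prod>x\<leftarrow>xs. max 1 (h x))" using Cons by simp
    then show ?case by (simp only: list.map prod_list.Cons mult_ac)
  qed simp
  then have "(\<Prod>x\<leftarrow>xs. max 1 (1 / h x)) = (\<Prod>x\<leftarrow>xs. max 1 (h x))" using prod by simp
  with le show ?thesis by simp
qed

text \<open>Polar coordinates turn the terms into those of \<open>auxiliary_inequality\<close>.
  Dividing by \<open>r\<close> and \<open>r^2\<close> makes the two norms invariant under
  \<open>z \<mapsto> 1/z\<close>.\<close>

lemma auxiliary_inequality_complex:
  fixes z :: complex
  assumes "z \<noteq> 0" "z \<noteq> 1" "z\<^sup>2 - z + 1 \<noteq> 0"
  defines "r \<equiv> cmod z"
  shows "Re z + Re (1 / z) + 37/50 * ln ((cmod (1 - z))\<^sup>2 / r) + 2/5 * ln ((cmod (z\<^sup>2 - z + 1))\<^sup>2 / r\<^sup>2)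
    \<le> 543/1000 + 5/2 * excess r + 4/5 * sqrt (excess r)"
proof -
  define c s i where "c = Re z / r" and "s = Im z / r" and "i = 1 / r"
  have r: "r > 0" using assms by simp
  have z: "Re z = r * c" "Im z = r * s" using r by (auto simp: c_def s_def)
  have ri: "r * i = 1" using r by (simp add: i_def)
  have "r\<^sup>2 = (r * c)\<^sup>2 + (r * s)\<^sup>2" unfolding r_def cmod_power2 using z by (simp add: r_def)
  then have "r\<^sup>2 * (c\<^sup>2 + s\<^sup>2) = r\<^sup>2 * 1" by (simp add: algebra_simps power_mult_distrib)
  then have cs: "c\<^sup>2 + s\<^sup>2 = 1" using r by simp
  define \<delta> where "\<delta> = excess r"
  have \<delta>: "\<delta> = r + i - 2" by (simp add: \<delta>_def excess_def i_def)
  have "c\<^sup>2 \<le> 1" using cs zero_le_power2[of s] by linarith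
  then have c1: "\<bar>2 * c\<bar> \<le> 2" using abs_le_square_iff[of c 1] by simp
  have E1: "(cmod (1 - z))\<^sup>2 / r = 2 + \<delta> - 2 * c"
  proof -
    have "(cmod (1 - z))\<^sup>2 = (1 - r * c)\<^sup>2 + (r * s)\<^sup>2" unfolding cmod_power2 by (simp add: z)
    also have "\<dots> = 1 - 2 * r * c + r\<^sup>2 * (c\<^sup>2 + s\<^sup>2)"
      by (simp add: algebra_simps power2_eq_square)
    also have "\<dots> = r * (2 + \<delta> - 2 * c)"
      unfolding \<delta> cs using ri by (simp add: algebra_simps power2_eq_square)
    finally show ?thesis using r by simp
  qed
  have E6: "(cmod (z\<^sup>2 - z + 1))\<^sup>2 / r\<^sup>2 = (2 * c - 1)\<^sup>2 + \<delta> * (4 - 2 * c + \<delta>)"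
  proof -
    have "(cmod (z\<^sup>2 - z + 1))\<^sup>2 = ((r * c)\<^sup>2 - (r * s)\<^sup>2 - r * c + 1)\<^sup>2 + (2 * (r * c) * (r * s) - r * s)\<^sup>2"
      unfolding cmod_power2 by (simp add: z power2_eq_square algebra_simps)
    also have "\<dots> = ((r * c)\<^sup>2 - (r * s)\<^sup>2 - r * c + 1)\<^sup>2 + (r * s)\<^sup>2 * (2 * (r * c) - 1)\<^sup>2"
      by (simp add: power2_eq_square algebra_simps)
    also have "(r * s)\<^sup>2 = r\<^sup>2 * (c\<^sup>2 + s\<^sup>2) - (r * c)\<^sup>2" by (simp add: power2_eq_square algebra_simps)
    also have "\<dots> = r\<^sup>2 - (r * c)\<^sup>2" by (simp add: cs)
    also have "((r * c)\<^sup>2 - (r\<^sup>2 - (r * c)\<^sup>2) - r * c + 1)\<^sup>2 + (r\<^sup>2 - (r * c)\<^sup>2) * (2 * (r * c) - 1)\<^sup>2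
        = (r * r + 1)\<^sup>2 + 4 * (r * c)\<^sup>2 - 2 * (r * c) * (r * r + 1) - 3 * r\<^sup>2"
      by (simp add: power2_eq_square algebra_simps)
    also have "\<dots> = (r * (r + i))\<^sup>2 + 4 * (r * c)\<^sup>2 - 2 * (r * c) * (r * (r + i)) - 3 * r\<^sup>2"
      by (simp only: distrib_left ri)
    also have "\<dots> = r\<^sup>2 * ((2 * c - 1)\<^sup>2 + \<delta> * (4 - 2 * c + \<delta>))"
      unfolding \<delta> by (simp add: power2_eq_square algebra_simps)
    finally show ?thesis using r by simp
  qed
  have "Re z + Re (1 / z) = r * c + i * c"
  proof -
    have "Re (1 / z) = Re z / r\<^sup>2" by (simp add: Re_divide cmod_power2 r_def)
    also have "\<dots> = r * c / r\<^sup>2" by (simp only: z)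
    also have "\<dots> = i * c" using r by (simp add: i_def power2_eq_square)
    finally show ?thesis by (simp add: z)
  qed
  also have "\<dots> = (2 + \<delta>) * (2 * c) / 2" by (simp add: \<delta> algebra_simps)
  finally have S: "Re z + Re (1 / z) = (2 + \<delta>) * (2 * c) / 2" .
  have "(cmod (1 - z))\<^sup>2 / r > 0" "(cmod (z\<^sup>2 - z + 1))\<^sup>2 / r\<^sup>2 > 0"
    using r assms(2,3) by auto
  then have "2 + \<delta> - 2 * c > 0" "(2 * c - 1)\<^sup>2 + \<delta> * (4 - 2 * c + \<delta>) > 0"
    unfolding E1 E6 .
  from auxiliary_inequality[OF c1 _ this] excess_nonneg[OF r]
  show ?thesis unfolding S E1 E6 by (simp add: \<delta>_def)
qed

lemma sum_list_ln:
  fixes h :: "'a \<Rightarrow> real"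
  assumes "\<And>x. x \<in> set xs \<Longrightarrow> h x > 0"
  shows "(\<Sum>x\<leftarrow>xs. ln (h x)) = ln (\<Prod>x\<leftarrow>xs. h x)"
  using assms
proof (induction xs)
  case (Cons x xs)
  have "\<forall>x\<in>set xs. h x > 0" using Cons.prems by simp
  then have "(\<Prod>x\<leftarrow>xs. h x) > 0" by (induction xs) auto
  moreover have "h x > 0" using Cons.prems by simp
  ultimately show ?case using Cons by (simp add: ln_mult_pos)
qed simp

lemma prod_list_power:
  fixes h :: "'a \<Rightarrow> 'b :: comm_monoid_mult"
  shows "(\<Prod>x\<leftarrow>xs. h x ^ n) = (\<Prod>x\<leftarrow>xs. h x) ^ n"
  by (induction xs) (auto simp: power_mult_distrib)

lemma mset_inverse_roots:
  assumes "monic q" "reflect_poly q = q"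
  shows "mset (map inverse (complex_roots_int q)) = mset (complex_roots_int q)"
    and "0 \<notin> set (complex_roots_int q)" and "(\<Prod>\<alpha>\<leftarrow>complex_roots_int q. cmod \<alpha>) = 1"
proof -
  define as where "as = complex_roots_int q"
  have q: "of_int_poly q = (\<Prod>\<alpha>\<leftarrow>as. [:- \<alpha>, 1:])"
    using of_int_poly_monic_roots[OF assms(1)] by (simp add: as_def)
  have c0: "coeff q 0 = 1" using assms by (metis coeff_0_reflect_poly)
  have prod: "(\<Prod>\<alpha>\<leftarrow>as. - \<alpha>) = 1"
  proof -
    have "poly (of_int_poly q) 0 = (\<Prod>\<alpha>\<leftarrow>as. - \<alpha>)" unfolding q by (simp add: poly_prod_list o_def)
    then show ?thesis using c0 by (simp add: poly_0_coeff_0)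
  qed
  then have nz: "0 \<notin> set as" by (metis prod_list_zero_iff image_eqI list.set_map minus_zero zero_neq_one)
  have "(\<Prod>\<alpha>\<leftarrow>as. cmod \<alpha>) = cmod (\<Prod>\<alpha>\<leftarrow>as. - \<alpha>)" by simp
  then have n1: "(\<Prod>\<alpha>\<leftarrow>as. cmod \<alpha>) = 1" using prod by simp
  have "of_int_poly q = reflect_poly (of_int_poly q :: complex poly)"
    using assms(2) by (simp add: reflect_of_int_poly)
  also have "\<dots> = (\<Prod>\<alpha>\<leftarrow>as. [:1, - \<alpha>:])" unfolding q by (rule reflect_poly_prod_linear)
  also have "\<dots> = Polynomial.smult (\<Prod>\<alpha>\<leftarrow>as. - \<alpha>) (\<Prod>\<alpha>\<leftarrow>as. [:- inverse \<alpha>, 1:])"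
    using nz
  proof (induction as)
    case (Cons \<alpha> as)
    then have \<alpha>: "[:1, - \<alpha>:] = Polynomial.smult (- \<alpha>) [:- inverse \<alpha>, 1:]" by simp
    have IH: "(\<Prod>\<alpha>\<leftarrow>as. [:1, - \<alpha>:])
        = Polynomial.smult (\<Prod>\<alpha>\<leftarrow>as. - \<alpha>) (\<Prod>\<alpha>\<leftarrow>as. [:- inverse \<alpha>, 1:])" using Cons by simp
    show ?case
      by (simp only: list.map prod_list.Cons \<alpha> IH mult_smult_left mult_smult_right smult_smult
          mult.commute[of _ "- \<alpha>"])
  qed simp
  finally have "(\<Prod>\<alpha>\<leftarrow>as. [:- \<alpha>, 1:]) = (\<Prod>\<alpha>\<leftarrow>map inverse as. [:- \<alpha>, 1:])"
    unfolding prod q by (simp add: o_def)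
  from reconstruct_poly_monic_defines_mset[OF this] n1 nz
  show "mset (map inverse (complex_roots_int q)) = mset (complex_roots_int q)"
    and "0 \<notin> set (complex_roots_int q)" and "(\<Prod>\<alpha>\<leftarrow>complex_roots_int q. cmod \<alpha>) = 1"
    by (simp_all add: as_def)
qed

text \<open>Sum the auxiliary inequality over \<open>z = \<sigma> \<alpha>^k\<close>. Both
  logarithmic sums are nonnegative by \<open>prod_poly_roots_ge_1\<close>, the divisors
  \<open>r\<close> and \<open>r^2\<close> cancel because the zeros have product of modulus 1, and
  reciprocity makes the sums of \<open>z\<close> and \<open>1/z\<close> equal, so that every
  constant is halved. The sign \<open>\<sigma>\<close> turns the upper bound into one for the
  absolute value.\<close>

lemma power_sum_bound_signed:
  fixes \<sigma> :: int
  assumes q: "monic q" "reflect_poly q = q" and k: "k \<ge> 1" and \<sigma>: "\<sigma> = 1 \<or> \<sigma> = -1"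
    and nru: "\<And>\<alpha> n. \<alpha> \<in> set (complex_roots_int q) \<Longrightarrow> n \<ge> 1 \<Longrightarrow> \<alpha> ^ n \<noteq> 1"
  shows "of_int \<sigma> * Re (power_sum (complex_roots_int q) k)
    \<le> 543/2000 * degree q + 5/2 * excess (mahler_measure q ^ k) + 4/5 * sqrt (excess (mahler_measure q ^ k))"
proof -
  define as where "as = complex_roots_int q"
  define M where "M = mahler_measure q"
  define z where "z \<alpha> = of_int \<sigma> * \<alpha> ^ k" for \<alpha> :: complex
  note inv = mset_inverse_roots[OF q, folded as_def]
  have \<sigma>2: "of_int \<sigma> * of_int \<sigma> = (1 :: complex)" "cmod (of_int \<sigma>) = 1" using \<sigma> by auto
  have nz: "z \<alpha> \<noteq> 0" if "\<alpha> \<in> set as" for \<alpha>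
    using that inv(2) \<sigma> by (auto simp: z_def)
  \<comment> \<open>The zeros of \<open>1 - z\<close> and \<open>z^2 - z + 1\<close> are sixth roots
    of unity, and the sixth power also removes \<open>\<sigma>\<close>.\<close>
  have nru': "z \<alpha> ^ 6 \<noteq> 1" if "\<alpha> \<in> set as" for \<alpha>
  proof -
    have "z \<alpha> ^ 6 = \<alpha> ^ (6 * k)" using \<sigma> by (auto simp: z_def power_mult_distrib mult.commute simp flip: power_mult)
    then show ?thesis using nru[of \<alpha> "6 * k"] that k by (simp add: as_def)
  qed
  have nz1: "z \<alpha> \<noteq> 1" if "\<alpha> \<in> set as" for \<alpha> using nru'[OF that] by auto
  have nz6: "(z \<alpha>)\<^sup>2 - z \<alpha> + 1 \<noteq> 0" if "\<alpha> \<in> set as" for \<alpha>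
  proof
    assume 0: "(z \<alpha>)\<^sup>2 - z \<alpha> + 1 = 0"
    have "z \<alpha> ^ 6 - 1 = ((z \<alpha>)\<^sup>2 - z \<alpha> + 1) * ((z \<alpha> + 1) * (z \<alpha> ^ 3 - 1))"
      by (simp add: algebra_simps eval_nat_numeral)
    then show False using nru'[OF that] 0 by simp
  qed
  have nr: "cmod (z \<alpha>) = cmod \<alpha> ^ k" for \<alpha> using \<sigma>2 by (simp add: z_def norm_mult norm_power)
  have pr: "(\<Prod>\<alpha>\<leftarrow>as. cmod (z \<alpha>)) = 1" unfolding nr prod_list_power inv(3) by simp
  have pM: "(\<Prod>\<alpha>\<leftarrow>as. max 1 (cmod (z \<alpha>))) = M ^ k"
  proof -
    have "max 1 (cmod \<alpha> ^ k) = max 1 (cmod \<alpha>) ^ k" for \<alpha>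
      using k power_le_one[of "cmod \<alpha>" k] one_le_power[of "cmod \<alpha>" k]
      by (cases "cmod \<alpha> \<le> 1") (auto simp: max_def)
    then show ?thesis unfolding nr M_def mahler_measure_monic_eq[OF q(1)] as_def[symmetric]
      by (simp add: prod_list_power)
  qed
  have "(\<Sum>\<alpha>\<leftarrow>as. Re (z \<alpha>) + Re (1 / z \<alpha>) + 37/50 * ln ((cmod (1 - z \<alpha>))\<^sup>2 / cmod (z \<alpha>))
          + 2/5 * ln ((cmod ((z \<alpha>)\<^sup>2 - z \<alpha> + 1))\<^sup>2 / (cmod (z \<alpha>))\<^sup>2))
      \<le> (\<Sum>\<alpha>\<leftarrow>as. 543/1000 + 5/2 * excess (cmod (z \<alpha>)) + 4/5 * sqrt (excess (cmod (z \<alpha>))))"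
    by (intro sum_list_mono auxiliary_inequality_complex nz nz1 nz6)
  then have "(\<Sum>\<alpha>\<leftarrow>as. Re (z \<alpha>)) + (\<Sum>\<alpha>\<leftarrow>as. Re (1 / z \<alpha>))
      + 37/50 * (\<Sum>\<alpha>\<leftarrow>as. ln ((cmod (1 - z \<alpha>))\<^sup>2 / cmod (z \<alpha>)))
      + 2/5 * (\<Sum>\<alpha>\<leftarrow>as. ln ((cmod ((z \<alpha>)\<^sup>2 - z \<alpha> + 1))\<^sup>2 / (cmod (z \<alpha>))\<^sup>2))
      \<le> length as * (543/1000) + 5/2 * (\<Sum>\<alpha>\<leftarrow>as. excess (cmod (z \<alpha>)))
        + 4/5 * (\<Sum>\<alpha>\<leftarrow>as. sqrt (excess (cmod (z \<alpha>))))"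
    by (simp only: sum_list_addf sum_list_const_mult sum_list_triv)
  moreover have "(\<Sum>\<alpha>\<leftarrow>as. Re (z \<alpha>)) = of_int \<sigma> * Re (power_sum as k)"
  proof -
    have "(\<Sum>\<alpha>\<leftarrow>xs. Re (z \<alpha>)) = of_int \<sigma> * Re (power_sum xs k)" for xs
      using \<sigma> by (induction xs) (auto simp: power_sum_def z_def)
    then show ?thesis .
  qed
  moreover have "(\<Sum>\<alpha>\<leftarrow>as. Re (1 / z \<alpha>)) = (\<Sum>\<alpha>\<leftarrow>as. Re (z \<alpha>))"
  proof -
    have "1 / z \<alpha> = z (inverse \<alpha>)" for \<alpha> using \<sigma> by (auto simp: z_def power_inverse field_simps)
    then have "(\<Sum>\<alpha>\<leftarrow>as. Re (1 / z \<alpha>)) = sum_mset (image_mset (\<lambda>\<alpha>. Re (z \<alpha>)) (mset (map inverse as)))"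
      by (simp add: sum_mset_sum_list[symmetric] multiset.map_comp o_def)
    also have "\<dots> = (\<Sum>\<alpha>\<leftarrow>as. Re (z \<alpha>))"
      unfolding inv(1) by (metis mset_map sum_mset_sum_list)
    finally show ?thesis .
  qed
  moreover have "(\<Sum>\<alpha>\<leftarrow>as. ln ((cmod (1 - z \<alpha>))\<^sup>2 / cmod (z \<alpha>))) \<ge> 0"
  proof -
    have "(\<Prod>\<alpha>\<leftarrow>as. cmod (poly (of_int_poly (1 - monom \<sigma> k)) \<alpha>)) \<ge> 1"
      unfolding as_def by (rule prod_poly_roots_ge_1[OF q(1)])
        (use nz1 in \<open>auto simp: poly_monom of_int_poly_hom.hom_minus of_int_hom.map_poly_hom_monom as_def z_def\<close>)
    then have ge: "(\<Prod>\<alpha>\<leftarrow>as. cmod (1 - z \<alpha>)) \<ge> 1"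
      by (simp add: poly_monom of_int_poly_hom.hom_minus of_int_hom.map_poly_hom_monom z_def)
    have "(\<Prod>\<alpha>\<leftarrow>as. (cmod (1 - z \<alpha>))\<^sup>2 / cmod (z \<alpha>)) * (\<Prod>\<alpha>\<leftarrow>as. cmod (z \<alpha>)) = (\<Prod>\<alpha>\<leftarrow>as. cmod (1 - z \<alpha>))\<^sup>2"
      using nz by (induction as) (auto simp: power_mult_distrib)
    then have "(\<Prod>\<alpha>\<leftarrow>as. (cmod (1 - z \<alpha>))\<^sup>2 / cmod (z \<alpha>)) \<ge> 1"
      using ge by (simp only: pr mult_1_right one_le_power)
    then show ?thesis by (subst sum_list_ln) (use nz nz1 in \<open>auto simp: ln_ge_zero\<close>)
  qed
  moreover have "(\<Sum>\<alpha>\<leftarrow>as. ln ((cmod ((z \<alpha>)\<^sup>2 - z \<alpha> + 1))\<^sup>2 / (cmod (z \<alpha>))\<^sup>2)) \<ge> 0"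
  proof -
    have P: "poly (of_int_poly (monom 1 (2 * k) - monom \<sigma> k + 1)) \<alpha> = (z \<alpha>)\<^sup>2 - z \<alpha> + 1" for \<alpha>
      using \<sigma> by (auto simp: poly_monom of_int_poly_hom.hom_minus of_int_poly_hom.hom_add
          of_int_hom.map_poly_hom_monom z_def power_mult mult.commute[of 2])
    have "(\<Prod>\<alpha>\<leftarrow>as. cmod (poly (of_int_poly (monom 1 (2 * k) - monom \<sigma> k + 1)) \<alpha>)) \<ge> 1"
      unfolding as_def by (rule prod_poly_roots_ge_1[OF q(1)]) (use nz6 in \<open>simp add: P as_def\<close>)
    then have ge: "(\<Prod>\<alpha>\<leftarrow>as. cmod ((z \<alpha>)\<^sup>2 - z \<alpha> + 1)) \<ge> 1" by (simp only: P)
    have "(\<Prod>\<alpha>\<leftarrow>as. (cmod ((z \<alpha>)\<^sup>2 - z \<alpha> + 1))\<^sup>2 / (cmod (z \<alpha>))\<^sup>2) * (\<Prod>\<alpha>\<leftarrow>as. cmod (z \<alpha>))\<^sup>2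
        = (\<Prod>\<alpha>\<leftarrow>as. cmod ((z \<alpha>)\<^sup>2 - z \<alpha> + 1))\<^sup>2"
      using nz by (induction as) (auto simp: power_mult_distrib)
    then have "(\<Prod>\<alpha>\<leftarrow>as. (cmod ((z \<alpha>)\<^sup>2 - z \<alpha> + 1))\<^sup>2 / (cmod (z \<alpha>))\<^sup>2) \<ge> 1"
      using ge by (simp only: pr mult_1_right one_le_power power_one)
    then show ?thesis by (subst sum_list_ln) (use nz nz6 in \<open>auto simp: ln_ge_zero\<close>)
  qed
  moreover have "(\<Sum>\<alpha>\<leftarrow>as. excess (cmod (z \<alpha>))) \<le> 2 * excess (M ^ k)"
    unfolding pM[symmetric] using nz pr
    by (intro sum_excess_le excess_1 excess_superadditive excess_inverse) auto
  moreover have "(\<Sum>\<alpha>\<leftarrow>as. sqrt (excess (cmod (z \<alpha>)))) \<le> 2 * sqrt (excess (M ^ k))"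
    unfolding pM[symmetric] using nz pr
    by (intro sum_excess_le[of "\<lambda>r. sqrt (excess r)"] sqrt_excess_superadditive)
       (auto simp: excess_1 excess_inverse)
  moreover have "real (length as) = real (degree q)" by (simp add: as_def complex_roots_int(2))
  moreover have "t \<le> 543/2000 * d + 5/2 * e + 4/5 * w"
    if "s + s' + 37/50 * l + 2/5 * l' \<le> n * (543/1000) + 5/2 * e' + 4/5 * w'" "s = t" "s' = s"
      "0 \<le> l" "0 \<le> l'" "e' \<le> 2 * e" "w' \<le> 2 * w" "n = d" for s s' t l l' n d e e' w w' :: real
    using that by argo
  ultimately show ?thesis unfolding as_def[symmetric] M_def[symmetric] by blast
qed

section \<open>The search\<close>

text \<open>With coefficients \<open>c 1, c 2, ...\<close> and power sums
  \<open>s (n-1), s (n-2), ...\<close> this is the convolution in Newton's identity. Stopping at the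
  shorter list covers indices below and above the degree alike.\<close>

fun dot :: "int list \<Rightarrow> int list \<Rightarrow> int" where
  "dot (x # xs) (y # ys) = x * y + dot xs ys"
| "dot xs ys = 0"

text \<open>Division by the monic polynomial with coefficient list \<open>1 # p\<close>; lists start with the
  leading coefficient. The argument \<open>fs\<close> of \<open>list_divides\<close> only bounds the number of steps.\<close>

fun subtract_multiple :: "int list \<Rightarrow> int \<Rightarrow> int list \<Rightarrow> int list option" where
  "subtract_multiple xs c [] = Some xs"
| "subtract_multiple [] c (p # ps) = None"
| "subtract_multiple (x # xs) c (p # ps) = map_option ((#) (x - c * p)) (subtract_multiple xs c ps)"

fun all_zero :: "int list \<Rightarrow> bool" where
  "all_zero [] = True"
| "all_zero (x # xs) = (if x = 0 then all_zero xs else False)"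

fun list_divides :: "int list \<Rightarrow> int list \<Rightarrow> int list \<Rightarrow> bool"
  and list_divides_next :: "int list \<Rightarrow> int list \<Rightarrow> int list \<Rightarrow> int list option \<Rightarrow> bool" where
  "list_divides p [] q = False"
| "list_divides p (f # fs) [] = True"
| "list_divides p (f # fs) (x # xs) = list_divides_next p fs (x # xs) (subtract_multiple xs x p)"
| "list_divides_next p fs xs None = all_zero xs"
| "list_divides_next p fs xs (Some ys) = list_divides p fs ys"

fun has_divisor :: "int list list \<Rightarrow> int list \<Rightarrow> bool" where
  "has_divisor [] q = False"
| "has_divisor (p # ps) q = (if list_divides p q q then True else has_divisor ps q)"

fun list_add :: "int list \<Rightarrow> int list \<Rightarrow> int list" where
  "list_add [] ys = ys"
| "list_add xs [] = xs"
| "list_add (x # xs) (y # ys) = (x + y) # list_add xs ys"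

fun list_scale :: "int \<Rightarrow> int list \<Rightarrow> int list" where
  "list_scale c [] = []"
| "list_scale c (x # xs) = c * x # list_scale c xs"

fun list_mult :: "int list \<Rightarrow> int list \<Rightarrow> int list" where
  "list_mult [] ys = []"
| "list_mult (x # xs) ys = list_add (list_scale x ys) (0 # list_mult xs ys)"

fun evens :: "int list \<Rightarrow> int list" and odds :: "int list \<Rightarrow> int list" where
  "evens [] = []"
| "evens (x # xs) = x # odds xs"
| "odds [] = []"
| "odds (x # xs) = evens xs"

text \<open>For \<open>f(t) = g(t^2) + t h(t^2)\<close> the product \<open>f(t) f(-t)\<close> is
  \<open>g(t^2)^2 - t^2 h(t^2)^2\<close>; replacing \<open>t^2\<close> by \<open>t\<close> gives a
  polynomial whose zeros are the squares of those of \<open>f\<close>.\<close>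

definition graeffe_step :: "int list \<Rightarrow> int list \<Rightarrow> int list" where
  "graeffe_step g h = list_add (list_mult g g) (0 # list_scale (-1) (list_mult h h))"

fun exceeds :: "int \<Rightarrow> int list \<Rightarrow> int list \<Rightarrow> bool" where
  "exceeds N (b # bs) (y # ys) = (if \<bar>y\<bar> > b * N then True else exceeds N bs ys)"
| "exceeds N bs ys = False"

fun graeffe_exceeds :: "int list \<Rightarrow> int list \<Rightarrow> int list \<Rightarrow> bool"
  and graeffe_next :: "int list \<Rightarrow> int \<Rightarrow> int list \<Rightarrow> int list \<Rightarrow> bool" where
  "graeffe_exceeds [] bin xs = False"
| "graeffe_exceeds (N # Ns) bin xs = graeffe_next Ns N bin (graeffe_step (evens xs) (odds xs))"
| "graeffe_next Ns N bin xs = (if exceeds N bin xs then True else graeffe_exceeds Ns bin xs)"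

text \<open>A candidate polynomial is given by \<open>cs\<close>, its coefficients after the leading one, and
  \<open>ss\<close>, its power sums so far in reversed order.\<close>

fun extend_sums :: "(int \<times> int) list \<Rightarrow> (int list \<Rightarrow> bool) \<Rightarrow> int list \<Rightarrow> int list \<Rightarrow> int list \<Rightarrow> bool"
  and extend_next :: "(int \<times> int) list \<Rightarrow> (int list \<Rightarrow> bool) \<Rightarrow> int list \<Rightarrow> int list \<Rightarrow> int list \<Rightarrow> int \<Rightarrow> int \<Rightarrow> bool" where
  "extend_sums [] test cs rest ss = test cs"
| "extend_sums ((n, B) # ps) test cs [] ss = extend_next ps test cs [] ss B (- dot cs ss)"
| "extend_sums ((n, B) # ps) test cs (c # rest) ss = extend_next ps test cs rest ss B (- (dot cs ss + n * c))"
| "extend_next ps test cs rest ss B s = (if \<bar>s\<bar> > B then True else extend_sums ps test cs rest (s # ss))"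

definition complete_coeffs :: "(int \<times> int) list \<Rightarrow> (int list \<Rightarrow> bool) \<Rightarrow> int list \<Rightarrow> int list \<Rightarrow> int list \<Rightarrow> bool" where
  "complete_coeffs ps test cs rest ss = extend_sums ps test (cs @ rest) rest ss"

text \<open>Newton's identity reads \<open>s n = b - n * c n\<close> with \<open>b\<close> known, so
  \<open>|s n| \<le> B\<close> leaves an interval for \<open>c n\<close>; its lower end is a
  ceiling, written as a negated floor. Once the first half of the coefficients is fixed the rest is
  its mirror image: \<open>tl\<close> omits the middle coefficient, and the final 1 mirrors the
  leading one.\<close>

function search :: "(int \<times> int) list \<Rightarrow> (int list \<Rightarrow> bool) \<Rightarrow> (int \<times> int) list \<Rightarrow> int list \<Rightarrow> int list \<Rightarrow> bool"
  and search_from :: "(int \<times> int) list \<Rightarrow> (int list \<Rightarrow> bool) \<Rightarrow> (int \<times> int) list \<Rightarrow> int list \<Rightarrow> int list \<Rightarrow> int \<Rightarrow> int \<Rightarrow> int \<Rightarrow> bool"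
  and search_over :: "(int \<times> int) list \<Rightarrow> (int list \<Rightarrow> bool) \<Rightarrow> (int \<times> int) list \<Rightarrow> int list \<Rightarrow> int list \<Rightarrow> int \<Rightarrow> int \<Rightarrow> int list \<Rightarrow> bool" where
  "search ps test [] cs ss = complete_coeffs ps test cs (tl (rev cs) @ [1]) ss"
| "search ps test ((n, B) # bs) cs ss = search_from ps test bs cs ss n B (- dot cs ss)"
| "search_from ps test bs cs ss n B b = search_over ps test bs cs ss n b [- ((B - b) div n)..(b + B) div n]"
| "search_over ps test bs cs ss n b [] = True"
| "search_over ps test bs cs ss n b (c # xs) =
     (if search ps test bs (cs @ [c]) ((b - n * c) # ss) then search_over ps test bs cs ss n b xs else False)"
  by pat_completeness auto
termination
  by (relation "measures [\<lambda>x. case x of Inl (_, _, bs, _) \<Rightarrow> length bs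
        | Inr (Inl (_, _, bs, _)) \<Rightarrow> length bs | Inr (Inr (_, _, bs, _)) \<Rightarrow> length bs,
      \<lambda>x. case x of Inl _ \<Rightarrow> 0 | Inr (Inl _) \<Rightarrow> 2 | Inr (Inr _) \<Rightarrow> 1,
      \<lambda>x. case x of Inr (Inr (_, _, _, _, _, _, _, xs)) \<Rightarrow> length xs | _ \<Rightarrow> 0]") auto

text \<open>An entry \<open>(n, p)\<close> stands for the \<open>n\<close>-th cyclotomic polynomial, with coefficients \<open>1 # p\<close>. The two
  lists together contain those that occur among the leaves of the search.\<close>

definition cyclotomics :: "(nat \<times> int list) list" where
  "cyclotomics =
  [(1, [-1]),
   (4, [0, 1]),
   (6, [-1, 1]),
   (3, [1, 1]),
   (2, [1]),
   (10, [-1, 1, -1, 1]),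
   (5, [1, 1, 1, 1]),
   (8, [0, 0, 0, 1]),
   (12, [0, -1, 0, 1]),
   (14, [-1, 1, -1, 1, -1, 1]),
   (7, [1, 1, 1, 1, 1, 1]),
   (9, [0, 0, 1, 0, 0, 1]),
   (18, [0, 0, -1, 0, 0, 1])]"

definition more_cyclotomics :: "(nat \<times> int list) list" where
  "more_cyclotomics =
  [(15, [-1, 0, 1, -1, 1, 0, -1, 1]),
   (16, [0, 0, 0, 0, 0, 0, 0, 1]),
   (20, [0, -1, 0, 1, 0, -1, 0, 1]),
   (30, [1, 0, -1, -1, -1, 0, 1, 1]),
   (11, [1, 1, 1, 1, 1, 1, 1, 1, 1, 1]),
   (22, [-1, 1, -1, 1, -1, 1, -1, 1, -1, 1]),
   (13, [1, 1, 1, 1, 1, 1, 1, 1, 1, 1, 1, 1]),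
   (26, [-1, 1, -1, 1, -1, 1, -1, 1, -1, 1, -1, 1]),
   (21, [-1, 0, 1, -1, 0, 1, 0, -1, 1, 0, -1, 1]),
   (42, [1, 0, -1, -1, 0, 1, 0, -1, -1, 0, 1, 1]),
   (28, [0, -1, 0, 1, 0, -1, 0, 1, 0, -1, 0, 1]),
   (36, [0, 0, 0, 0, 0, -1, 0, 0, 0, 0, 0, 1]),
   (17, [1, 1, 1, 1, 1, 1, 1, 1, 1, 1, 1, 1, 1, 1, 1, 1]),
   (34, [-1, 1, -1, 1, -1, 1, -1, 1, -1, 1, -1, 1, -1, 1, -1, 1]),
   (24, [0, 0, 0, -1, 0, 0, 0, 1]),
   (32, [0, 0, 0, 0, 0, 0, 0, 0, 0, 0, 0, 0, 0, 0, 0, 1]),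
   (40, [0, 0, 0, -1, 0, 0, 0, 1, 0, 0, 0, -1, 0, 0, 0, 1]),
   (48, [0, 0, 0, 0, 0, 0, 0, -1, 0, 0, 0, 0, 0, 0, 0, 1]),
   (60, [0, 1, 0, 0, 0, -1, 0, -1, 0, -1, 0, 0, 0, 1, 0, 1])]"

text \<open>These are \<open>L(t)\<close> and \<open>L(-t)\<close>. Their measure lies just below
  the threshold 1.1763, so no bound can eliminate them.\<close>

definition lehmer_lists :: "int list list" where
  "lehmer_lists = [[1, 0, -1, -1, -1, -1, -1, 0, 1, 1],
     [-1, 0, 1, -1, 1, -1, 1, 0, -1, 1]]"

text \<open>An entry \<open>(k, c)\<close> satisfies \<open>1000 (5/2 g + 4/5 \<surd>g) \<le> c\<close> for \<open>g = \<Lambda>\<^sup>k + \<Lambda>\<^sup>-\<^sup>k - 2\<close> and \<open>\<Lambda> = 1.1763\<close>,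
  and the \<open>m\<close>-th entry of \<open>graeffe_bounds\<close> is an upper bound for \<open>\<Lambda>\<close> to the power \<open>2\<^sup>m\<close>.\<close>

definition sum_corrections :: "(int \<times> int) list" where
  "sum_corrections = [(1, 197), (2, 527), (3, 999), (4, 1622), (5, 2408), (6, 3378), (7, 4552),
     (8, 5960), (9, 7636), (10, 9620), (11, 11962), (12, 14719)]"

definition graeffe_bounds :: "int list" where
  "graeffe_bounds = [2, 2, 4, 14, 181, 32600, 1062800000, 1129600000000000000]"

text \<open>The cyclotomic polynomials of degree at most 6 come first; those of degree 8 to 16 and
  Lehmer's are tried only on candidates that pass the Graeffe bounds.\<close>

definition reject :: "int list \<Rightarrow> int list \<Rightarrow> bool" where
  "reject bin cs = (if has_divisor (map snd cyclotomics) (1 # cs) then True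
     else if graeffe_exceeds graeffe_bounds bin (1 # cs) then True
     else has_divisor (map snd more_cyclotomics @ lehmer_lists) (1 # cs))"

definition sum_bounds :: "nat \<Rightarrow> (int \<times> int) list" where
  "sum_bounds d = map (\<lambda>(k, c). (k, (543 * int d + c) div 1000)) sum_corrections"

text \<open>The list stops at the middle index because the Graeffe iterates of a reciprocal
  polynomial of even degree are again reciprocal.\<close>

definition binomials :: "nat \<Rightarrow> int list" where
  "binomials d = map (\<lambda>j. int (2 * d choose j)) [0..<d + 1]"

definition search_degree :: "nat \<Rightarrow> bool" where
  "search_degree d = search (drop d (sum_bounds d)) (reject (binomials d)) (take d (sum_bounds d)) [] []"

section \<open>Meaning of the list operations\<close>

definition high_poly :: "int list \<Rightarrow> int poly" where
  "high_poly xs = Poly (rev xs)"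

lemma high_poly_Nil: "high_poly [] = 0"
  by (simp add: high_poly_def)

lemma high_poly_Cons: "high_poly (x # xs) = monom x (length xs) + high_poly xs"
  by (simp add: high_poly_def Poly_snoc add.commute)

lemma subtract_multiple_Some:
  assumes "subtract_multiple xs c ps = Some ys"
  shows "length ys = length xs" "length ps \<le> length xs"
    "high_poly ys = high_poly xs - monom c (length xs - length ps) * high_poly ps"
proof -
  have "length ys = length xs \<and> length ps \<le> length xs \<and>
    high_poly ys = high_poly xs - monom c (length xs - length ps) * high_poly ps"
    using assms
  proof (induction xs c ps arbitrary: ys rule: subtract_multiple.induct)
    case (1 xs c)
    then show ?case by (simp add: high_poly_Nil)
  next
    case (3 x xs c p ps)
    from "3.prems" obtain zs where zs: "subtract_multiple xs c ps = Some zs" "ys = (x - c * p) # zs"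
      by auto
    note IH = "3.IH"[OF zs(1)]
    have "monom c (length xs - length ps) * monom p (length ps) = monom (c * p) (length xs)"
      using IH by (simp add: mult_monom)
    then show ?case using IH zs(2)
      by (simp add: high_poly_Cons diff_monom[symmetric] algebra_simps)
  qed simp
  then show "length ys = length xs" "length ps \<le> length xs"
    "high_poly ys = high_poly xs - monom c (length xs - length ps) * high_poly ps" by auto
qed

lemma all_zero_high_poly: "all_zero xs \<Longrightarrow> high_poly xs = 0"
  by (induction xs) (auto simp: high_poly_Nil high_poly_Cons split: if_splits)

lemma list_divides_sound:
  "list_divides p fs q \<Longrightarrow> high_poly (1 # p) dvd high_poly q"
  "list_divides_next p fs xs r \<Longrightarrow>
     (case r of None \<Rightarrow> high_poly xs = 0 | Some ys \<Rightarrow> high_poly (1 # p) dvd high_poly ys)"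
proof (induction p fs q and p fs xs r rule: list_divides_list_divides_next.induct)
  case (3 p f fs x xs)
  show ?case
  proof (cases "subtract_multiple xs x p")
    case None
    then show ?thesis using 3 by simp
  next
    case (Some ys)
    note sub = subtract_multiple_Some[OF Some]
    have "monom x (length xs - length p) * monom 1 (length p) = monom x (length xs)"
      using sub(2) by (simp add: mult_monom)
    then have "high_poly (x # xs) = high_poly ys + monom x (length xs - length p) * high_poly (1 # p)"
      using sub(3) by (simp add: high_poly_Cons algebra_simps)
    moreover have "high_poly (1 # p) dvd high_poly ys" using 3 Some by simp
    ultimately show ?thesis by simp
  qed
qed (auto simp: high_poly_Nil all_zero_high_poly)

lemma has_divisor_sound:
  "has_divisor ps q \<Longrightarrow> \<exists>p\<in>set ps. high_poly (1 # p) dvd high_poly q"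
  by (induction ps) (auto split: if_splits dest: list_divides_sound(1))

lemma Poly_list_add: "Poly (list_add xs ys) = Poly xs + Poly ys"
  by (induction xs ys rule: list_add.induct) auto

lemma Poly_list_scale: "Poly (list_scale c xs) = Polynomial.smult c (Poly xs)"
  by (induction xs) auto

lemma Poly_list_mult: "Poly (list_mult xs ys) = Poly xs * Poly ys"
  by (induction xs) (auto simp: Poly_list_add Poly_list_scale)

lemma nth_default_evens_odds:
  "nth_default 0 (evens xs) i = nth_default 0 xs (2 * i)"
  "nth_default 0 (odds xs) i = nth_default 0 xs (2 * i + 1)"
proof (induction xs arbitrary: i)
  case (Cons x xs)
  {
    case 1
    show ?case by (cases i) (simp_all add: Cons)
  next
    case 2
    show ?case by (simp add: Cons)
  }
qed simp_all

lemma Poly_graeffe_step: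
  "Poly (graeffe_step (evens xs) (odds xs)) = graeffe_one_step 1 (Poly xs)"
proof -
  obtain g h where gh: "poly_even_odd (Poly xs) = (g, h)" by force
  have "g = Poly (evens xs)" "h = Poly (odds xs)"
    using poly_even_odd_coeff[OF gh] by (auto intro!: poly_eqI simp: coeff_Poly_eq nth_default_evens_odds)
  then show ?thesis
    unfolding graeffe_one_step_code gh graeffe_step_def
    by (simp add: Poly_list_add Poly_list_mult Poly_list_scale monom_Suc mult.assoc
        del: Poly_eq_0)
qed

lemma degree_graeffe_poly_impl:
  "degree (graeffe_poly_impl f m) = degree (f :: int poly)"
proof (cases "f = 0")
  case True
  have "graeffe_poly_impl (0 :: int poly) m = 0" unfolding graeffe_poly_impl_def
    by (induction m) (simp_all add: graeffe_one_step_def poly_square_subst_def)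
  then show ?thesis using True by simp
next
  case False
  have "of_int_poly (graeffe_poly_impl f m)
      = graeffe_poly (lead_coeff (of_int_poly f)) (complex_roots_int f) m"
    using graeffe_poly_impl[OF complex_roots_int(1)[symmetric], of f m]
    by (simp add: of_int_hom.graeffe_poly_impl_hom)
  then have "degree (of_int_poly (graeffe_poly_impl f m) :: complex poly) = length (complex_roots_int f)"
    using False by (simp only: graeffe_poly_def degree_smult_eq degree_linear_factors)
      (simp add: complex_roots_int(2))
  then show ?thesis by (simp add: complex_roots_int(2))
qed

text \<open>Each Graeffe step squares the Mahler measure and keeps the degree, so Mignotte's bound
  limits coefficient \<open>j\<close> of the \<open>m\<close>-th iterate by
  \<open>(degree f choose j) * \<Lambda>^(2^m)\<close>.\<close>

lemma graeffe_exceeds_sound: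
  assumes even: "even (degree f)" and M: "mahler_measure f \<le> \<Lambda>"
    and bin: "\<And>j. j < length bin \<Longrightarrow> bin ! j = int (degree f choose j)"
    and Ns: "\<And>i. i < length Ns \<Longrightarrow> \<Lambda> ^ 2 ^ (m + Suc i) \<le> of_int (Ns ! i)"
    and xs: "Poly xs = graeffe_poly_impl f m"
  shows "\<not> graeffe_exceeds Ns bin xs"
  using Ns xs
proof (induction Ns arbitrary: m xs)
  case (Cons N Ns)
  define ys where "ys = graeffe_step (evens xs) (odds xs)"
  \<comment> \<open>In even degree the sign \<open>(-1) ^ degree f\<close> carried by
    \<open>graeffe_poly_impl\<close> is 1.\<close>
  have ys: "Poly ys = graeffe_poly_impl f (Suc m)"
    unfolding ys_def Poly_graeffe_step Cons.prems(2) using even by (simp add: graeffe_poly_impl_def)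
  have "mahler_measure f ^ 2 ^ Suc m \<le> \<Lambda> ^ 2 ^ Suc m"
    using M mahler_measure_ge_0 by (intro power_mono) auto
  also have "\<dots> \<le> of_int N" using Cons.prems(1)[of 0] by simp
  finally have MN: "mahler_measure (graeffe_poly_impl f (Suc m)) \<le> of_int N"
    by (simp only: graeffe_poly_impl_mahler)
  have "\<bar>coeff (Poly ys) j\<bar> \<le> int (degree f choose j) * N" for j
  proof -
    have "real_of_int \<bar>coeff (Poly ys) j\<bar> \<le> real (degree f choose j) * mahler_measure (Poly ys)"
      using Mignotte_bound[of "Poly ys" j] by (simp only: ys degree_graeffe_poly_impl)
    also have "\<dots> \<le> real (degree f choose j) * of_int N" using MN unfolding ys by (intro mult_left_mono) auto
    finally have "real_of_int \<bar>coeff (Poly ys) j\<bar> \<le> of_int (int (degree f choose j) * N)" by simp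
    then show ?thesis by (simp only: of_int_le_iff)
  qed
  then have "\<bar>ys ! j\<bar> \<le> bin ! j * N" if "j < length ys" "j < length bin" for j
    using that bin[OF that(2)] by (metis coeff_Poly_eq nth_default_nth)
  moreover have "\<not> exceeds N bs zs" if "\<And>j. j < length zs \<Longrightarrow> j < length bs \<Longrightarrow> \<bar>zs ! j\<bar> \<le> bs ! j * N" for bs zs
    using that
  proof (induction N bs zs rule: exceeds.induct)
    case (1 N b bs y ys)
    have "\<bar>y\<bar> \<le> b * N" using "1.prems"[of 0] by simp
    moreover have "\<bar>ys ! j\<bar> \<le> bs ! j * N" if "j < length ys" "j < length bs" for j
      using "1.prems"[of "Suc j"] that by simp
    ultimately show ?case using "1.IH" by simp
  qed simp_all
  ultimately have "\<not> exceeds N bin ys" by blast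
  moreover have "\<not> graeffe_exceeds Ns bin ys"
    using Cons.prems(1)[of "Suc _"] ys by (intro Cons.IH[of "Suc m"]) auto
  ultimately show ?case by (simp add: ys_def)
qed simp

section \<open>Soundness of the search\<close>

lemma dot_eq_sum: "dot xs ys = (\<Sum>i<min (length xs) (length ys). xs ! i * ys ! i)"
  by (induction xs ys rule: dot.induct) (simp_all add: sum.lessThan_Suc_shift del: sum.lessThan_Suc)

lemma search_over_member:
  assumes "search_over ps test bs cs ss n b xs" "c \<in> set xs"
  shows "search ps test bs (cs @ [c]) ((b - n * c) # ss)"
  using assms by (induction xs) (auto split: if_splits)

context
  fixes c s :: "nat \<Rightarrow> int" and B :: "nat \<Rightarrow> int" and D d :: nat
  assumes newton: "\<And>n. n \<ge> 1 \<Longrightarrow> s n = - (int n * c n + (\<Sum>i=1..<n. c i * s (n - i)))"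
    and c0: "\<And>n. n > D \<Longrightarrow> c n = 0"
begin

text \<open>Either the known prefix of coefficients reaches index \<open>n - 1\<close>, or all of
  them are known and the later ones vanish.\<close>

lemma dot_power_sums:
  assumes "n \<ge> 1" "m = D \<or> n \<le> Suc m" "m \<le> D"
  shows "dot (map c [1..<Suc m]) (rev (map s [1..<n])) = (\<Sum>i=1..<n. c i * s (n - i))"
proof -
  have "dot (map c [1..<Suc m]) (rev (map s [1..<n]))
      = (\<Sum>i<min m (n - 1). c (Suc i) * s (n - Suc i))"
    unfolding dot_eq_sum by (intro sum.cong) (auto simp: rev_nth Suc_diff_Suc simp del: upt_Suc)
  also have "\<dots> = (\<Sum>i\<in>{1..<n} \<inter> {..m}. c i * s (n - i))"
    by (rule sum.reindex_bij_witness[of _ "\<lambda>i. i - 1" Suc]) auto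
  also have "\<dots> = (\<Sum>i=1..<n. c i * s (n - i))"
    using assms by (intro sum.mono_neutral_left) (auto intro!: c0)
  finally show ?thesis .
qed

text \<open>The induction follows the one branch taken by an actual polynomial: at every level its
  coefficient lies in the enumerated interval, so a successful search has also succeeded at its
  leaf.\<close>

lemma search_sound:
  assumes bd: "\<And>n. 1 \<le> n \<Longrightarrow> n \<le> d \<Longrightarrow> \<bar>s n\<bar> \<le> B n" and "d \<le> D" "1 \<le> n" "n \<le> Suc d"
    and "search ps test (map (\<lambda>k. (int k, B k)) [n..<Suc d]) (map c [1..<n]) (rev (map s [1..<n]))"
  shows "search ps test [] (map c [1..<Suc d]) (rev (map s [1..<Suc d]))"
  using assms(3-5)
proof (induction "Suc d - n" arbitrary: n)
  case 0
  then have "n = Suc d" by simp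
  then show ?case using 0 by simp
next
  case (Suc x)
  then have n: "n \<le> d" by simp
  define b where "b = - (\<Sum>i=1..<n. c i * s (n - i))"
  have dot: "- dot (map c [1..<n]) (rev (map s [1..<n])) = b"
    using dot_power_sums[of n "n - 1"] Suc.prems n \<open>d \<le> D\<close> by (simp add: b_def)
  have upt: "[n..<Suc d] = n # [Suc n..<Suc d]" using n by (simp add: upt_conv_Cons)
  have over: "search_over ps test (map (\<lambda>k. (int k, B k)) [Suc n..<Suc d]) (map c [1..<n])
      (rev (map s [1..<n])) (int n) b [- ((B n - b) div int n)..(b + B n) div int n]"
    using Suc.prems(3) unfolding upt list.map search.simps dot search_from.simps .
  have s: "s n = b - int n * c n" using newton[of n] Suc.prems by (simp add: b_def)
  have "\<bar>b - int n * c n\<bar> \<le> B n" using bd[of n] Suc.prems n s by simp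
  then have "int n * (- c n) \<le> B n - b" "int n * c n \<le> b + B n" by (simp_all add: abs_le_iff)
  then have "(int n * (- c n)) div int n \<le> (B n - b) div int n"
      "(int n * c n) div int n \<le> (b + B n) div int n"
    using Suc.prems(1) by (intro zdiv_mono1; simp)+
  then have "c n \<in> set [- ((B n - b) div int n)..(b + B n) div int n]"
    using Suc.prems(1) by (simp only: nonzero_mult_div_cancel_left of_nat_eq_0_iff set_upto atLeastAtMost_iff) simp
  from search_over_member[OF over this]
  have "search ps test (map (\<lambda>k. (int k, B k)) [Suc n..<Suc d]) (map c [1..<Suc n]) (rev (map s [1..<Suc n]))"
    using Suc.prems(1) s by simp
  with Suc.hyps(2) n show ?case by (intro Suc.hyps(1)[of "Suc n"]) (simp_all del: upt_Suc search.simps)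
qed

lemma extend_sums_sound:
  assumes bd: "\<And>n. 1 \<le> n \<Longrightarrow> n \<le> K \<Longrightarrow> \<bar>s n\<bar> \<le> B n" and "1 \<le> n" "n \<le> Suc K"
    and "extend_sums (map (\<lambda>k. (int k, B k)) [n..<Suc K]) test (map c [1..<Suc D])
      (map c [n..<Suc D]) (rev (map s [1..<n]))"
  shows "test (map c [1..<Suc D])"
  using assms(2-4)
proof (induction "Suc K - n" arbitrary: n)
  case 0
  then have "n = Suc K" by simp
  then show ?case using 0 by simp
next
  case (Suc x)
  then have n: "n \<le> K" by simp
  have dot: "dot (map c [1..<Suc D]) (rev (map s [1..<n])) = (\<Sum>i=1..<n. c i * s (n - i))"
    using dot_power_sums[of n D] Suc.prems by simp
  have upt: "[n..<Suc K] = n # [Suc n..<Suc K]" using n by (simp add: upt_conv_Cons)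
  have s: "s n = - ((\<Sum>i=1..<n. c i * s (n - i)) + int n * c n)"
    using newton[of n] Suc.prems(1) by simp
  have sn: "\<not> \<bar>s n\<bar> > B n" using bd[of n] Suc.prems n by simp
  have ext: "rev (map s [1..<Suc n]) = s n # rev (map s [1..<n])" using Suc.prems by simp
  have "extend_sums (map (\<lambda>k. (int k, B k)) [Suc n..<Suc K]) test (map c [1..<Suc D])
      (map c [Suc n..<Suc D]) (rev (map s [1..<Suc n]))"
  proof (cases "n \<le> D")
    case True
    then have "[n..<Suc D] = n # [Suc n..<Suc D]" by (simp add: upt_conv_Cons)
    from Suc.prems(3)[unfolded upt this list.map extend_sums.simps dot s[symmetric] extend_next.simps]
    show ?thesis unfolding ext by (simp only: sn if_False)
  next
    case False
    then have "[n..<Suc D] = []" "[Suc n..<Suc D] = []" by simp_all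
    moreover have "s n = - (\<Sum>i=1..<n. c i * s (n - i))" using s c0[of n] False by simp
    ultimately show ?thesis
      using Suc.prems(3) sn unfolding upt ext by (simp only: list.map extend_sums.simps dot extend_next.simps if_False)
  qed
  with Suc.hyps(2) n show ?case by (intro Suc.hyps(1)[of "Suc n"]) (simp_all del: upt_Suc extend_sums.simps)
qed

end

section \<open>Numerical bounds for Mahler measure at most 1.1763\<close>

lemma excess_mono:
  assumes "1 \<le> r" "r \<le> s"
  shows "excess r \<le> excess s"
proof -
  have "s / r \<ge> 1" using assms by simp
  then have "excess r + excess (s / r) \<le> excess (r * (s / r))"
    using assms by (intro excess_superadditive) auto
  moreover have "excess (s / r) \<ge> 0" using assms by (intro excess_nonneg) auto
  ultimately show ?thesis using assms by simp
qed

lemma excess_power_bound: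
  fixes \<Lambda> y t :: real
  assumes "1 \<le> M" "M \<le> \<Lambda>" "excess (\<Lambda> ^ k) \<le> y\<^sup>2" "0 \<le> y" "5/2 * excess (\<Lambda> ^ k) + 4/5 * y \<le> t"
  shows "5/2 * excess (M ^ k) + 4/5 * sqrt (excess (M ^ k)) \<le> t"
proof -
  have "1 \<le> M ^ k" "M ^ k \<le> \<Lambda> ^ k" using assms by (auto intro: power_mono)
  then have le: "excess (M ^ k) \<le> excess (\<Lambda> ^ k)" by (rule excess_mono)
  then have "sqrt (excess (M ^ k)) \<le> y" using assms by (intro real_le_lsqrt) auto
  then show ?thesis using le assms(5) by argo
qed

lemma sum_corrections_bound:
  assumes "1 \<le> M" "M \<le> 11763/10000" "k < 12"
  shows "5/2 * excess (M ^ Suc k) + 4/5 * sqrt (excess (M ^ Suc k)) \<le> of_int (snd (sum_corrections ! k)) / 1000"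
proof -
  have "k \<in> {0,1,2,3,4,5,6,7,8,9,10,11}" unfolding insert_iff empty_iff using assms(3) by presburger
  moreover note b = excess_power_bound[OF assms(1,2)]
  \<comment> \<open>Each rational witness is an upper approximation to the square root of
    \<open>excess (\<Lambda>^k)\<close> with \<open>\<Lambda> = 11763/10000\<close>, which leaves
    comparisons between rationals.\<close>
  have "5/2 * excess (M ^ 1) + 4/5 * sqrt (excess (M ^ 1)) \<le> 197/1000"
    by (rule b[of _ "813/5000"]) (simp_all add: excess_def power_divide)
  moreover have "5/2 * excess (M ^ 2) + 4/5 * sqrt (excess (M ^ 2)) \<le> 527/1000"
    by (rule b[of _ "1631/5000"]) (simp_all add: excess_def power_divide)
  moreover have "5/2 * excess (M ^ 3) + 4/5 * sqrt (excess (M ^ 3)) \<le> 999/1000"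
    by (rule b[of _ "123/250"]) (simp_all add: excess_def power_divide)
  moreover have "5/2 * excess (M ^ 4) + 4/5 * sqrt (excess (M ^ 4)) \<le> 1622/1000"
    by (rule b[of _ "661/1000"]) (simp_all add: excess_def power_divide)
  moreover have "5/2 * excess (M ^ 5) + 4/5 * sqrt (excess (M ^ 5)) \<le> 2408/1000"
    by (rule b[of _ "1043/1250"]) (simp_all add: excess_def power_divide)
  moreover have "5/2 * excess (M ^ 6) + 4/5 * sqrt (excess (M ^ 6)) \<le> 3378/1000"
    by (rule b[of _ "10133/10000"]) (simp_all add: excess_def power_divide)
  moreover have "5/2 * excess (M ^ 7) + 4/5 * sqrt (excess (M ^ 7)) \<le> 4552/1000"
    by (rule b[of _ "2997/2500"]) (simp_all add: excess_def power_divide)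
  moreover have "5/2 * excess (M ^ 8) + 4/5 * sqrt (excess (M ^ 8)) \<le> 5960/1000"
    by (rule b[of _ "13923/10000"]) (simp_all add: excess_def power_divide)
  moreover have "5/2 * excess (M ^ 9) + 4/5 * sqrt (excess (M ^ 9)) \<le> 7636/1000"
    by (rule b[of _ "319/200"]) (simp_all add: excess_def power_divide)
  moreover have "5/2 * excess (M ^ 10) + 4/5 * sqrt (excess (M ^ 10)) \<le> 9620/1000"
    by (rule b[of _ "18081/10000"]) (simp_all add: excess_def power_divide)
  moreover have "5/2 * excess (M ^ 11) + 4/5 * sqrt (excess (M ^ 11)) \<le> 11962/1000"
    by (rule b[of _ "5083/2500"]) (simp_all add: excess_def power_divide)
  moreover have "5/2 * excess (M ^ 12) + 4/5 * sqrt (excess (M ^ 12)) \<le> 14719/1000"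
    by (rule b[of _ "22717/10000"]) (simp_all add: excess_def power_divide)
  ultimately show ?thesis
    by (elim insertE emptyE; hypsubst) (simp_all only: sum_corrections_def Suc_eq_plus1
      nth_Cons_0 nth_Cons_numeral snd_conv of_int_numeral, simp_all add: power2_eq_square)
qed

lemma search_degree_sound:
  assumes q: "monic q" "reflect_poly q = q" "degree q = 2 * d" and d: "1 \<le> d" "d \<le> 12"
    and M: "mahler_measure q \<le> 11763/10000"
    and nru: "\<And>\<alpha> n. \<alpha> \<in> set (complex_roots_int q) \<Longrightarrow> n \<ge> 1 \<Longrightarrow> \<alpha> ^ n \<noteq> 1"
    and search: "search_degree d"
  shows "\<exists>p\<in>set (map snd cyclotomics @ map snd more_cyclotomics @ lehmer_lists). high_poly (1 # p) dvd q"
proof -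
  define as where "as = complex_roots_int q"
  define c where "c n = coeff (reflect_poly q) n" for n
  define B where "B k = (543 * int d + snd (sum_corrections ! (k - 1))) div 1000" for k
  have "\<exists>i::int. power_sum as k = of_int i" for k
    using power_sum_roots_Ints[OF q(1), of k] by (auto simp: as_def Ints_def)
  then obtain s :: "nat \<Rightarrow> int" where s: "\<And>k. power_sum as k = of_int (s k)" by metis
  have newton: "s n = - (int n * c n + (\<Sum>i=1..<n. c i * s (n - i)))" if "n \<ge> 1" for n
  proof -
    have "complex_of_int (s n) = of_int (- (int n * c n + (\<Sum>i=1..<n. c i * s (n - i))))"
      using power_sum_roots_recursion[OF q(1) that] by (simp add: s[symmetric] c_def as_def)
    then show ?thesis by (simp only: of_int_eq_iff)
  qed
  have c0: "c n = 0" if "n > 2 * d" for n using that q(3) by (simp add: c_def coeff_reflect_poly)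
  have bd: "\<bar>s n\<bar> \<le> B n" if n: "1 \<le> n" "n \<le> 12" for n
  proof -
    define t where "t = snd (sum_corrections ! (n - 1))"
    have "5/2 * excess (mahler_measure q ^ n) + 4/5 * sqrt (excess (mahler_measure q ^ n)) \<le> of_int t / 1000"
      using sum_corrections_bound[OF _ M, of "n - 1"] mahler_measure_poly_ge_1[of q] q(1) n
      by (fastforce simp: t_def)
    moreover have "real_of_int (s n) \<le> 543/2000 * degree q + 5/2 * excess (mahler_measure q ^ n)
        + 4/5 * sqrt (excess (mahler_measure q ^ n))"
      using power_sum_bound_signed[OF q(1,2) n(1), of 1] nru by (simp add: s[unfolded as_def])
    moreover have "- real_of_int (s n) \<le> 543/2000 * degree q + 5/2 * excess (mahler_measure q ^ n)
        + 4/5 * sqrt (excess (mahler_measure q ^ n))"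
      using power_sum_bound_signed[OF q(1,2) n(1), of "-1"] nru by (simp add: s[unfolded as_def])
    moreover have "real (degree q) = 2 * real d" by (simp add: q(3))
    ultimately have "1000 * real_of_int (s n) \<le> 543 * real d + of_int t"
      "- (1000 * real_of_int (s n)) \<le> 543 * real d + of_int t" by argo+
    then have "real_of_int (1000 * s n) \<le> of_int (543 * int d + t)"
      "real_of_int (- (1000 * s n)) \<le> of_int (543 * int d + t)" by simp_all
    then have "1000 * s n \<le> 543 * int d + t" "- (1000 * s n) \<le> 543 * int d + t"
      unfolding of_int_le_iff by auto
    then have "1000 * \<bar>s n\<bar> \<le> 543 * int d + t" by simp
    then have "(1000 * \<bar>s n\<bar>) div 1000 \<le> (543 * int d + t) div 1000" by (intro zdiv_mono1) auto
    then show ?thesis by (simp add: B_def t_def)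
  qed
  have bounds: "sum_bounds d = map (\<lambda>k. (int k, B k)) [1..<Suc 12]"
    by (simp add: sum_bounds_def sum_corrections_def B_def upt_rec)
  define test where "test = reject (binomials d)"
  have upt: "take d [1..<Suc 12] = [1..<Suc d]" "drop d [1..<Suc 12] = [Suc d..<Suc 12]"
    using d by (simp_all del: upt_Suc)
  have "search (map (\<lambda>k. (int k, B k)) [Suc d..<Suc 12]) test
      (map (\<lambda>k. (int k, B k)) [1..<Suc d]) (map c [1..<1]) (rev (map s [1..<1]))"
    using search unfolding search_degree_def bounds take_map drop_map upt test_def by simp
  from search_sound[where c = c and s = s and D = "2 * d", OF newton c0 bd _ _ _ this]
  have "search (map (\<lambda>k. (int k, B k)) [Suc d..<Suc 12]) test [] (map c [1..<Suc d]) (rev (map s [1..<Suc d]))"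
    using d by simp
  \<comment> \<open>Palindromy: \<open>c (2 * d - k) = c k\<close>, with the middle index
    \<open>d\<close> already used.\<close>
  moreover have rest: "tl (rev (map c [1..<Suc d])) @ [1] = map c [Suc d..<Suc (2 * d)]"
  proof (rule nth_equalityI)
    fix i assume "i < length (tl (rev (map c [1..<Suc d])) @ [1])"
    then have i: "i < d" using d by (simp del: upt_Suc)
    show "(tl (rev (map c [1..<Suc d])) @ [1]) ! i = map c [Suc d..<Suc (2 * d)] ! i"
    proof (cases "i = d - 1")
      case True
      have "c (2 * d) = 1" using q by (metis c_def q(2,3))
      then show ?thesis using True d by (simp add: nth_append mult_2 del: upt_Suc)
    next
      case False
      then have i: "i < d - 1" using i by simp
      have "c (Suc d + i) = c (d - 1 - i)"
      proof -
        have "2 * d - (d - 1 - i) = Suc d + i" using i by simp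
        then have "coeff (reflect_poly q) (d - 1 - i) = coeff q (Suc d + i)"
          using q(3) i by (simp add: coeff_reflect_poly)
        then show ?thesis by (simp add: c_def q(2))
      qed
      then show ?thesis using i by (simp add: nth_append nth_tl rev_nth Suc_diff_Suc del: upt_Suc)
    qed
  qed (use d in \<open>simp del: upt_Suc\<close>)
  moreover have "map c [1..<Suc d] @ map c [Suc d..<Suc (2 * d)] = map c [1..<Suc (2 * d)]"
    using upt_add_eq_append[of 1 "Suc d" d] by (simp add: mult_2 del: upt_Suc flip: map_append)
  ultimately have "extend_sums (map (\<lambda>k. (int k, B k)) [Suc d..<Suc 12]) test (map c [1..<Suc (2 * d)])
      (map c [Suc d..<Suc (2 * d)]) (rev (map s [1..<Suc d]))"
    by (simp only: search.simps complete_coeffs_def)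
  from extend_sums_sound[where c = c and s = s and D = "2 * d", OF newton c0 bd _ _ this]
  have "test (map c [1..<Suc (2 * d)])" using d by simp
  moreover have c00: "c 0 = 1" using q(1) by (simp add: c_def)
  have list: "1 # map c [1..<Suc (2 * d)] = map c [0..<Suc (2 * d)]"
    using c00 by (simp add: upt_conv_Cons del: upt_Suc)
  have poly: "Poly (map c [0..<Suc (2 * d)]) = q"
    using q(3) by (intro poly_eqI)
      (auto simp: coeff_Poly_eq nth_default_def c_def q(2) coeff_eq_0 simp del: upt_Suc)
  \<comment> \<open>The search lists coefficients from the top, the Graeffe test from the bottom;
    for a palindromic list both readings give \<open>q\<close>.\<close>
  have high: "high_poly (map c [0..<Suc (2 * d)]) = q"
  proof -
    have "rev (map c [0..<Suc (2 * d)]) = map c [0..<Suc (2 * d)]"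
    proof (rule nth_equalityI)
      fix i assume "i < length (rev (map c [0..<Suc (2 * d)]))"
      then have i: "i \<le> 2 * d" by (simp del: upt_Suc)
      have "c (2 * d - i) = c i" using i q(3) coeff_reflect_poly[of q i] by (simp add: c_def q(2))
      then show "rev (map c [0..<Suc (2 * d)]) ! i = map c [0..<Suc (2 * d)] ! i"
        using i by (simp add: rev_nth del: upt_Suc)
    qed (simp del: upt_Suc)
    then show ?thesis using poly by (simp only: high_poly_def)
  qed
  define \<Lambda> where "\<Lambda> = (11763/10000 :: real)"
  \<comment> \<open>Rounding up after every squaring keeps the numerals short on the way to the
    256th power.\<close>
  have sq: "\<Lambda> ^ (2 * n) \<le> v" if "\<Lambda> ^ n \<le> u" "u\<^sup>2 \<le> v" for n u v
  proof -
    have "\<Lambda> ^ (2 * n) = (\<Lambda> ^ n)\<^sup>2" by (simp add: power_mult[symmetric] mult.commute)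
    also have "\<dots> \<le> u\<^sup>2" using that(1) by (intro power_mono) (auto simp: \<Lambda>_def)
    finally show ?thesis using that(2) by simp
  qed
  have 2: "\<Lambda> ^ 2 \<le> 13836817/10000000" by (simp add: \<Lambda>_def power_divide)
  have 4: "\<Lambda> ^ 4 \<le> 119661/62500" using sq[OF 2, of "119661/62500"] by (simp add: power_divide)
  have 8: "\<Lambda> ^ 8 \<le> 366561/100000" using sq[OF 4, of "366561/100000"] by (simp add: power_divide)
  have 16: "\<Lambda> ^ 16 \<le> 134367/10000" using sq[OF 8, of "134367/10000"] by (simp add: power_divide)
  have 32: "\<Lambda> ^ 32 \<le> 36109/200" using sq[OF 16, of "36109/200"] by (simp add: power_divide)
  have 64: "\<Lambda> ^ 64 \<le> 32600" using sq[OF 32, of "32600"] by (simp add: power_divide)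
  have 128: "\<Lambda> ^ 128 \<le> 1062800000" using sq[OF 64, of "1062800000"] by simp
  have 256: "\<Lambda> ^ 256 \<le> 1129600000000000000" using sq[OF 128, of "1129600000000000000"] by simp
  note L = 2 4 8 16 32 64 128 256
  have M': "mahler_measure q \<le> \<Lambda>" using M by (simp add: \<Lambda>_def)
  have "\<not> graeffe_exceeds graeffe_bounds (binomials d) (map c [0..<Suc (2 * d)])"
  proof (rule graeffe_exceeds_sound[where f = q and m = 0, OF _ M'])
    show "binomials d ! j = int (degree q choose j)" if "j < length (binomials d)" for j
      using that by (simp add: binomials_def q(3) del: upt_Suc)
    show "\<Lambda> ^ 2 ^ (0 + Suc i) \<le> real_of_int (graeffe_bounds ! i)" if "i < length graeffe_bounds" for i
    proof -
      have "i \<in> {0,1,2,3,4,5,6,7}" using that by (auto simp: graeffe_bounds_def)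
      then show ?thesis using L by (elim insertE emptyE; hypsubst) (auto simp: graeffe_bounds_def)
    qed
    show "Poly (map c [0..<Suc (2 * d)]) = graeffe_poly_impl q 0" by (simp only: poly) (simp add: graeffe_poly_impl_def)
  qed (simp add: q(3))
  ultimately have "has_divisor (map snd cyclotomics) (map c [0..<Suc (2 * d)])
      \<or> has_divisor (map snd more_cyclotomics @ lehmer_lists) (map c [0..<Suc (2 * d)])"
    unfolding test_def reject_def list by (auto split: if_splits)
  then show ?thesis using has_divisor_sound[of _ "map c [0..<Suc (2 * d)]"] unfolding high by fastforce
qed

section \<open>Mahler measure and Lehmer's polynomial\<close>

lemma mahler_measure_mult: "mahler_measure (f * g) = mahler_measure f * mahler_measure g"
  by (simp add: mahler_measure_def of_int_poly_hom.hom_mult measure_eq_prod)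

lemma mahler_measure_power: "mahler_measure (f ^ n) = mahler_measure f ^ n"
proof (induction n)
  case 0
  show ?case by (simp add: mahler_measure_def mahler_measure_poly_def)
qed (simp add: mahler_measure_mult)

lemma mahler_measure_1: "mahler_measure 1 = 1"
  using mahler_measure_power[of 0 0] by simp

lemma mahler_measure_uminus: "mahler_measure (- f) = mahler_measure f"
proof -
  have "(mahler_measure (- 1))\<^sup>2 = 1"
    using mahler_measure_mult[of "-1" "-1"] mahler_measure_1 by (simp add: power2_eq_square)
  then have "mahler_measure (- 1) = 1"
    using mahler_measure_ge_0[of "-1"] by (simp add: power2_eq_1_iff)
  then show ?thesis using mahler_measure_mult[of "-1" f] by simp
qed

lemma of_int_poly_linear_product:
  "(of_int_poly f :: complex poly)
     = Polynomial.smult (of_int (lead_coeff f)) (\<Prod>\<alpha>\<leftarrow>complex_roots_int f. [:- \<alpha>, 1:])"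
  using complex_roots_int(1)[of f] by simp

lemma mahler_measure_roots:
  "mahler_measure f = \<bar>lead_coeff f\<bar> * (\<Prod>\<alpha>\<leftarrow>complex_roots_int f. max 1 (cmod \<alpha>))"
  unfolding mahler_measure_def of_int_poly_linear_product mahler_measure_poly_explicit by simp

lemma mahler_measure_pcompose_neg: "mahler_measure (pcompose f [:0, -1:]) = mahler_measure f"
proof -
  define as where "as = complex_roots_int f"
  have "(\<Prod>\<alpha>\<leftarrow>as. [:- \<alpha>, 1:]) \<circ>\<^sub>p [:0, -1:]
      = Polynomial.smult ((-1) ^ length as) (\<Prod>\<alpha>\<leftarrow>map uminus as. [:- \<alpha>, 1:])"
  proof (induction as)
    case Nil
    show ?case by simp
  next
    case (Cons \<alpha> as)
    have "[:- \<alpha>, 1:] \<circ>\<^sub>p [:0, -1:] = Polynomial.smult (-1) [:- (- \<alpha>), 1:]"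
      by (simp add: pcompose_pCons)
    then show ?case
      by (simp only: list.map prod_list.Cons pcompose_mult Cons mult_smult_left mult_smult_right
          smult_smult list.size power_Suc)  (simp add: mult.commute)
  qed
  then have "of_int_poly (pcompose f [:0, -1:])
      = Polynomial.smult (of_int (lead_coeff f) * (-1) ^ length as) (\<Prod>\<alpha>\<leftarrow>map uminus as. [:- \<alpha>, 1:])"
    using of_int_poly_linear_product[of f, folded as_def]
    by (simp add: of_int_hom.map_poly_pcompose pcompose_smult)
  then have "mahler_measure (pcompose f [:0, -1:])
      = cmod (of_int (lead_coeff f) * (-1) ^ length as) * (\<Prod>\<alpha>\<leftarrow>map uminus as. max 1 (cmod \<alpha>))"
    by (simp only: mahler_measure_def mahler_measure_poly_explicit)
  also have "\<dots> = mahler_measure f"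
    by (simp add: mahler_measure_roots as_def norm_mult norm_power o_def)
  finally show ?thesis .
qed

text \<open>Each zero is replaced by its two square roots, whose two equal factors multiply to the
  old one.\<close>

lemma mahler_measure_pcompose_square: "mahler_measure (pcompose f (monom 1 2)) = mahler_measure f"
proof -
  define as where "as = complex_roots_int f"
  define bs where "bs = concat (map (\<lambda>\<alpha>. [csqrt \<alpha>, - csqrt \<alpha>]) as)"
  have "(\<Prod>\<alpha>\<leftarrow>as. [:- \<alpha>, 1:]) \<circ>\<^sub>p monom 1 2 = (\<Prod>\<alpha>\<leftarrow>bs. [:- \<alpha>, 1:])"
    unfolding bs_def
  proof (induction as)
    case (Cons \<alpha> as)
    have "[:- \<alpha>, 1:] \<circ>\<^sub>p monom 1 2 = [:- csqrt \<alpha>, 1:] * [:- (- csqrt \<alpha>), 1:]"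
      using power2_csqrt[of \<alpha>] by (simp add: pcompose_pCons monom_altdef numeral_2_eq_2 power2_eq_square)
    then show ?case using Cons
      by (simp only: list.map prod_list.Cons pcompose_mult concat.simps append.simps mult.assoc)
  qed simp
  then have "of_int_poly (pcompose f (monom 1 2)) = Polynomial.smult (of_int (lead_coeff f)) (\<Prod>\<alpha>\<leftarrow>bs. [:- \<alpha>, 1:])"
    using of_int_poly_linear_product[of f, folded as_def]
    by (simp add: of_int_hom.map_poly_pcompose pcompose_smult of_int_hom.map_poly_hom_monom)
  moreover have "(\<Prod>\<alpha>\<leftarrow>bs. max 1 (cmod \<alpha>)) = (\<Prod>\<alpha>\<leftarrow>as. max 1 (cmod \<alpha>))"
    unfolding bs_def
  proof (induction as)
    case (Cons \<alpha> as)
    have "max 1 (sqrt (cmod \<alpha>)) * max 1 (sqrt (cmod \<alpha>)) = max 1 (cmod \<alpha>)"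
      by (cases "cmod \<alpha> \<le> 1") (auto simp: max_def)
    then show ?case using Cons by (simp add: norm_csqrt flip: mult.assoc)
  qed simp
  ultimately have "mahler_measure (pcompose f (monom 1 2))
      = cmod (of_int (lead_coeff f)) * (\<Prod>\<alpha>\<leftarrow>as. max 1 (cmod \<alpha>))"
    by (simp only: mahler_measure_def mahler_measure_poly_explicit)
  then show ?thesis by (simp add: mahler_measure_roots as_def)
qed

text \<open>The hypothesis says \<open>x = z + 1/z\<close> without a division. The quantities
  \<open>P n = z^5 (z^n + z^(-n))\<close> obey the Chebyshev recursion in \<open>x\<close>, which
  produces the trace polynomial.\<close>

lemma poly_lehmer_trace:
  fixes z x :: "'a :: {field_char_0}"
  assumes "z\<^sup>2 = x * z - 1"
  shows "z ^ 10 + z ^ 9 - z ^ 7 - z ^ 6 - z ^ 5 - z ^ 4 - z ^ 3 + z + 1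
    = z ^ 5 * (x ^ 5 + x ^ 4 - 5 * x ^ 3 - 5 * x\<^sup>2 + 4 * x + 3)"
proof -
  have s: "z ^ (n + 2) = x * z ^ (n + 1) - z ^ n" for n
  proof -
    have "z ^ (n + 2) = z ^ n * (x * z - 1)" by (simp only: power_add assms)
    then show ?thesis by (simp add: power_add algebra_simps)
  qed
  define P where "P n = z ^ (5 + n) + z ^ (5 - n)" for n
  have 1: "P 1 = x * z ^ 5" using s[of 4] by (simp add: P_def)
  have P: "P (n + 2) = x * P (n + 1) - P n" if "n \<le> 3" for n
  proof -
    have "5 - n = (3 - n) + 2" "5 - (n + 1) = (3 - n) + 1" "5 - (n + 2) = 3 - n" using that by auto
    moreover have "a2 + b0 = x * (a1 + b1) - (a0 + b2)" if "a2 = x * a1 - a0" "b2 = x * b1 - b0"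
      for a0 a1 a2 b0 b1 b2 :: 'a using that by (simp add: algebra_simps)
    from this[OF s[of "5 + n"] s[of "3 - n"]] calculation show ?thesis by (simp only: P_def add.assoc)
  qed
  have rec: "P 2 = x * P 1 - P 0" "P 3 = x * P 2 - P 1" "P 4 = x * P 3 - P 2" "P 5 = x * P 4 - P 3"
    using P[of 0] P[of 1] P[of 2] P[of 3] by (simp_all add: numeral_2_eq_2[symmetric] del: One_nat_def)
  define w where "w = z ^ 5"
  have 0: "P 0 = 2 * w" by (simp add: P_def w_def)
  note 1 = 1[folded w_def]
  have 2: "P 2 = w * (x\<^sup>2 - 2)" unfolding rec(1) 0 1 by (simp add: algebra_simps power2_eq_square)
  have 3: "P 3 = w * (x ^ 3 - 3 * x)" unfolding rec(2) 1 2 by (simp add: algebra_simps eval_nat_numeral)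
  have 4: "P 4 = w * (x ^ 4 - 4 * x\<^sup>2 + 2)" unfolding rec(3) 2 3 by (simp add: algebra_simps eval_nat_numeral)
  have 5: "P 5 = w * (x ^ 5 - 5 * x ^ 3 + 5 * x)" unfolding rec(4) 3 4 by (simp add: algebra_simps eval_nat_numeral)
  have "z ^ 10 + z ^ 9 - z ^ 7 - z ^ 6 - z ^ 5 - z ^ 4 - z ^ 3 + z + 1 = P 5 + P 4 - P 2 - P 1 - w"
    by (simp add: P_def w_def)
  also have "\<dots> = z ^ 5 * (x ^ 5 + x ^ 4 - 5 * x ^ 3 - 5 * x\<^sup>2 + 4 * x + 3)"
    unfolding 1 2 4 5 w_def[symmetric] by (simp add: algebra_simps)
  finally show ?thesis .
qed

lemma poly_of_int_lehmer:
  fixes t :: "'a :: {comm_ring_1, ring_char_0}"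
  shows "poly (of_int_poly lehmer_poly) t = t^10 + t^9 - t^7 - t^6 - t^5 - t^4 - t^3 + t + 1"
  by (simp add: lehmer_poly_def algebra_simps eval_nat_numeral)

lemma monic_lehmer_poly: "monic lehmer_poly" and degree_lehmer_poly: "degree lehmer_poly = 10"
  by (simp_all add: lehmer_poly_def)

text \<open>All zeros of \<open>lehmer_poly\<close> except one real zero and its inverse lie on the unit circle: they come
  from the four zeros of the trace polynomial in \<open>(-2, 2)\<close>.\<close>

lemma lehmer_number_bounds: "lehmer_number > 1" "lehmer_number \<le> 11763/10000"
proof -
  define g :: "real \<Rightarrow> real" where "g x = x ^ 5 + x ^ 4 - 5 * x ^ 3 - 5 * x\<^sup>2 + 4 * x + 3" for x
  define L :: "real \<Rightarrow> real" where "L t = t^10 + t^9 - t^7 - t^6 - t^5 - t^4 - t^3 + t + 1" for t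
  have cont: "continuous_on A g" "continuous_on A L" for A
    unfolding g_def L_def by (intro continuous_intros)+
  \<comment> \<open>The right end of the interval is the bound to be proved, so the sign change of
    \<open>L\<close> yields it directly.\<close>
  obtain l where l: "1 \<le> l" "l \<le> 11763/10000" "L l = 0"
    using IVT'[of L 1 0 "11763/10000"] cont by (auto simp: L_def power_divide)
  have "l \<noteq> 1" using l(3) by (auto simp: L_def)
  then have l1: "l > 1" using l by simp
  have Linv: "L (1 / l) = 0"
  proof -
    have "L (1 / l) = L l / l ^ 10" using l1 by (simp add: L_def field_simps eval_nat_numeral)
    then show ?thesis using l by simp
  qed
  obtain x1 where x1: "-19/10 \<le> x1" "x1 \<le> -18/10" "g x1 = 0"
    using IVT'[of g "-19/10" 0 "-18/10"] cont by (auto simp: g_def power_divide)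
  obtain x2 where x2: "-15/10 \<le> x2" "x2 \<le> -14/10" "g x2 = 0"
    using IVT2'[of g "-14/10" 0 "-15/10"] cont by (auto simp: g_def power_divide)
  obtain x3 where x3: "-6/10 \<le> x3" "x3 \<le> -5/10" "g x3 = 0"
    using IVT'[of g "-6/10" 0 "-5/10"] cont by (auto simp: g_def power_divide)
  obtain x4 where x4: "9/10 \<le> x4" "x4 \<le> 1" "g x4 = 0"
    using IVT2'[of g 1 0 "9/10"] cont by (auto simp: g_def power_divide)
  define X where "X = {x1, x2, x3, x4}"
  have X: "\<bar>x\<bar> < 2" "g x = 0" if "x \<in> X" for x
    using that x1 x2 x3 x4 by (auto simp: X_def abs_less_iff)
  have cardX: "finite X" "card X = 4" using x1 x2 x3 x4 by (auto simp: X_def)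
  \<comment> \<open>The points \<open>w (x, 1)\<close> and \<open>w (x, -1)\<close> solve
    \<open>w + 1/w = x\<close> and have modulus 1 because \<open>|x| < 2\<close>.\<close>
  define w :: "real \<times> real \<Rightarrow> complex" where "w = (\<lambda>(x, e). Complex (x / 2) (e * sqrt (1 - (x / 2)\<^sup>2)))"
  have pos: "1 - (x / 2)\<^sup>2 > 0" if "x \<in> X" for x
  proof -
    have "\<bar>x / 2\<bar> < 1" using X(1)[OF that] by simp
    then show ?thesis by (simp add: abs_square_less_1)
  qed
  have w: "cmod (w (x, e)) = 1" "poly (of_int_poly lehmer_poly) (w (x, e)) = 0"
    if "x \<in> X" "e \<in> {1, -1}" for x e
  proof -
    have e: "e\<^sup>2 = 1" using that(2) by auto
    have sq: "(e * sqrt (1 - (x / 2)\<^sup>2))\<^sup>2 = 1 - (x / 2)\<^sup>2"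
      using pos[OF that(1)] e by (simp add: power_mult_distrib)
    show "cmod (w (x, e)) = 1" unfolding w_def cmod_def by (simp add: sq)
    have "(w (x, e))\<^sup>2 = of_real x * w (x, e) - 1"
      unfolding w_def using sq by (simp add: complex_eq_iff power2_eq_square field_simps)
    from poly_lehmer_trace[OF this]
    have "poly (of_int_poly lehmer_poly) (w (x, e)) = w (x, e) ^ 5 * of_real (g x)"
      unfolding poly_of_int_lehmer by (simp add: g_def)
    then show "poly (of_int_poly lehmer_poly) (w (x, e)) = 0" using X(2)[OF that(1)] by simp
  qed
  have inj: "inj_on w (X \<times> {1, -1})"
    by (rule inj_onI) (use pos in \<open>fastforce simp: w_def\<close>)
  define U where "U = w ` (X \<times> {1, -1})"
  have cardU: "finite U" "card U = 8"
    unfolding U_def using cardX by (auto simp: card_image[OF inj] card_cartesian_product)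
  have U: "cmod z = 1" "poly (of_int_poly lehmer_poly) z = 0" if "z \<in> U" for z
    using that w by (auto simp: U_def)
  define R where "R = insert (of_real l) (insert (of_real (1 / l)) U)"
  have notU: "complex_of_real l \<notin> U" "complex_of_real (1 / l) \<notin> U"
    using U(1)[of "of_real l"] U(1)[of "of_real (1 / l)"] l1 by (auto simp: norm_divide)
  have "complex_of_real l \<noteq> of_real (1 / l)" 
  proof -
    have "1 / l < 1" using l1 by simp
    then have "l \<noteq> 1 / l" using l1 by linarith
    then show ?thesis by (simp only: of_real_eq_iff) simp
  qed
  then have cardR: "finite R" "card R = 10" using cardU notU by (auto simp: R_def)
  define as where "as = complex_roots_int lehmer_poly"
  have real_root: "poly (of_int_poly lehmer_poly) (complex_of_real t) = of_real (L t)" for t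
    unfolding poly_of_int_lehmer L_def by simp
  have "poly (of_int_poly lehmer_poly) z = 0" if "z \<in> R" for z
    using that U(2) real_root[of l] real_root[of "1 / l"] l(3) Linv by (auto simp: R_def)
  moreover have "poly (of_int_poly lehmer_poly) z = 0 \<longleftrightarrow> z \<in> set as" for z
    unfolding of_int_poly_monic_roots[OF monic_lehmer_poly] as_def
    by (auto simp: poly_prod_list prod_list_zero_iff o_def)
  ultimately have sub: "R \<subseteq> set as" by blast
  have len: "length as = 10" by (simp add: as_def complex_roots_int(2) degree_lehmer_poly)
  \<comment> \<open>Ten distinct known zeros exhaust the degree, so all zeros are simple and the
    product may run over the set \<open>R\<close>.\<close>
  have "card (set as) \<le> 10" using card_length[of as] len by simp
  then have set: "set as = R" using sub cardR by (metis card_seteq finite_set)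
  then have "distinct as" using len cardR by (simp add: card_distinct)
  have "lehmer_number = (\<Prod>\<alpha>\<leftarrow>as. max 1 (cmod \<alpha>))"
    unfolding lehmer_number_def mahler_measure_monic_eq[OF monic_lehmer_poly] as_def ..
  also have "\<dots> = (\<Prod>\<alpha>\<in>R. max 1 (cmod \<alpha>))"
    using prod.distinct_set_conv_list[OF \<open>distinct as\<close>, of "\<lambda>\<alpha>. max 1 (cmod \<alpha>)"] set by simp
  also have "\<dots> = max 1 (cmod (of_real l)) * (max 1 (cmod (of_real (1 / l))) * (\<Prod>\<alpha>\<in>U. max 1 (cmod \<alpha>)))"
    unfolding R_def using cardU notU \<open>complex_of_real l \<noteq> of_real (1 / l)\<close> by simp
  also have "(\<Prod>\<alpha>\<in>U. max 1 (cmod \<alpha>)) = 1" using U(1) by simp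
  also have "max 1 (cmod (of_real l)) * (max 1 (cmod (of_real (1 / l))) * 1) = l"
    using l1 by (simp add: max_def norm_divide)
  finally have "lehmer_number = l" .
  then show "lehmer_number > 1" "lehmer_number \<le> 11763/10000" using l1 l(2) by simp_all
qed

section \<open>Degree at most 16\<close>

lemma mahler_measure_eq_1I:
  assumes "monic f" "\<And>\<alpha>. poly (of_int_poly f) \<alpha> = 0 \<Longrightarrow> cmod \<alpha> \<le> 1"
  shows "mahler_measure f = 1"
proof -
  have root: "poly (of_int_poly f) \<alpha> = 0" if "\<alpha> \<in> set (complex_roots_int f)" for \<alpha>
    unfolding of_int_poly_monic_roots[OF assms(1)] using that
    by (auto simp: poly_prod_list prod_list_zero_iff o_def)
  have "(\<Prod>\<alpha>\<leftarrow>xs. max 1 (cmod \<alpha>)) = 1" if "\<forall>\<alpha>\<in>set xs. cmod \<alpha> \<le> 1" for xs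
    using that by (induction xs) auto
  then show ?thesis using root assms(2) by (simp add: mahler_measure_monic_eq[OF assms(1)])
qed

lemma monic_power_minus_1:
  assumes "n \<ge> 1"
  shows "monic (monom 1 n - 1 :: int poly)" "degree (monom 1 n - 1 :: int poly) = n"
proof -
  have "degree (1 :: int poly) < degree (monom 1 n :: int poly)" using assms by (simp add: degree_monom_eq)
  then have "degree (monom 1 n + (- 1) :: int poly) = degree (monom 1 n :: int poly)"
    by (intro degree_add_eq_left) simp
  then show "degree (monom 1 n - 1 :: int poly) = n" by (simp add: degree_monom_eq)
  then show "monic (monom 1 n - 1 :: int poly)" using assms by simp
qed

lemma mahler_measure_power_minus_1:
  assumes "n \<ge> 1"
  shows "mahler_measure (monom 1 n - 1) = 1"
proof (rule mahler_measure_eq_1I)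
  show "monic (monom 1 n - 1 :: int poly)" using monic_power_minus_1[OF assms] by simp
  fix \<alpha> :: complex assume "poly (of_int_poly (monom 1 n - 1)) \<alpha> = 0"
  then have "\<alpha> ^ n = 1"
    by (simp add: of_int_poly_hom.hom_minus of_int_hom.map_poly_hom_monom poly_monom)
  then have "cmod \<alpha> ^ n = 1" by (simp flip: norm_power)
  then show "cmod \<alpha> \<le> 1" using one_less_power[of "cmod \<alpha>" n] assms by force
qed

text \<open>A constant gcd would give a Bezout identity over the rationals, which fails at the
  common zero.\<close>

lemma common_root_imp_degree_gcd:
  fixes f g :: "int poly" and \<alpha> :: complex
  assumes "f \<noteq> 0" "poly (of_int_poly f) \<alpha> = 0" "poly (of_int_poly g) \<alpha> = 0"
  shows "degree (gcd f g) \<noteq> 0"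
proof
  interpret r: comm_ring_hom "of_rat :: rat \<Rightarrow> complex" by unfold_locales (auto simp: of_rat_add of_rat_mult)
  interpret mr: map_poly_comm_ring_hom "of_rat :: rat \<Rightarrow> complex" ..
  define F G where "F = (of_int_poly f :: rat poly)" and "G = (of_int_poly g :: rat poly)"
  assume d: "degree (gcd f g) = 0"
  have "gcd f g \<noteq> 0" using assms(1) by simp
  then obtain c where c: "gcd f g = [:c:]" "c \<noteq> 0" using d by (metis degree_0_id pCons_0_0 degree_eq_zeroE)
  have "gcd F G = 1" unfolding F_def G_def gcd_rat_to_gcd_int c(1) using c(2) by simp
  then obtain a b where "a * F + b * G = 1" using bezout_coefficients_fst_snd[of F G] by auto
  then have "poly (map_poly of_rat (a * F + b * G)) \<alpha> = 1" by simp
  moreover have "map_poly of_rat (of_int_poly h :: rat poly) = (of_int_poly h :: complex poly)" for h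
    by (intro poly_eqI) (simp add: coeff_map_poly)
  ultimately show False using assms(2,3) by (simp add: mr.hom_add mr.hom_mult F_def G_def)
qed

text \<open>\<open>gcd f (t^n - 1)\<close> stands in for the minimal polynomial of
  \<open>\<alpha>\<close>: it is not constant because of the common zero, and has measure 1 as a
  divisor of \<open>t^n - 1\<close>. Its sign is normalised at the end.\<close>

lemma root_of_unity_factor:
  fixes f :: "int poly"
  assumes "monic f" "poly (of_int_poly f) \<alpha> = 0" "n \<ge> 1" "(\<alpha> :: complex) ^ n = 1"
  obtains h where "monic h" "degree h \<ge> 1" "h dvd f" "mahler_measure h = 1"
proof -
  define g where "g = (monom 1 n - 1 :: int poly)"
  define h where "h = gcd f g"
  have g0: "g \<noteq> 0" using monic_power_minus_1[OF assms(3)] by (auto simp: g_def)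
  have "poly (of_int_poly g) \<alpha> = 0"
    using assms(4) by (simp add: g_def of_int_poly_hom.hom_minus of_int_hom.map_poly_hom_monom poly_monom)
  then have deg: "degree h \<noteq> 0"
    unfolding h_def using assms by (intro common_root_imp_degree_gcd) auto
  have dvd: "h dvd f" "h dvd g" by (auto simp: h_def)
  have "mahler_measure h \<le> 1"
    using mahler_measure_dvd[OF g0 dvd(2)] mahler_measure_power_minus_1[OF assms(3)] by (simp add: g_def)
  moreover have "h \<noteq> 0" using deg by auto
  ultimately have M: "mahler_measure h = 1" using mahler_measure_poly_ge_1[of h] by simp
  obtain k where "f = h * k" using dvd(1) by blast
  then have "lead_coeff h * lead_coeff k = 1" using assms(1) by (simp add: lead_coeff_mult)
  then have "lead_coeff h = 1 \<or> lead_coeff h = -1" by (simp add: zmult_eq_1_iff) blast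
  then show ?thesis
  proof
    assume "lead_coeff h = 1"
    then show ?thesis using that[of h] deg dvd M by simp
  next
    assume "lead_coeff h = -1"
    then show ?thesis using that[of "- h"] deg dvd M by (simp add: mahler_measure_uminus)
  qed
qed

text \<open>Dividing \<open>t^n - 1\<close> is what forces Mahler measure 1; the long list encodes
  \<open>t^n - 1\<close>.\<close>

lemma cyclotomics_ok:
  "list_all (\<lambda>(n, p). n \<ge> 1 \<and> p \<noteq> [] \<and> list_divides p (1 # replicate (n - 1) 0 @ [-1]) (1 # replicate (n - 1) 0 @ [-1]))
    (cyclotomics @ more_cyclotomics)"
  by code_simp

lemma high_poly_power_minus_1:
  assumes "n \<ge> 1"
  shows "high_poly (1 # replicate (n - 1) 0 @ [-1]) = monom 1 n - 1"
proof -
  have m1: "[:-1:] = (-1 :: int poly)" by (metis minus_pCons minus_zero one_pCons)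
  have "high_poly (replicate k 0 @ [-1]) = -1" for k
    by (induction k) (simp_all add: high_poly_Cons high_poly_Nil monom_0 m1)
  then show ?thesis using assms by (simp add: high_poly_Cons)
qed

lemma monic_high_poly: "monic (high_poly (1 # p))" "degree (high_poly (1 # p)) = length p"
proof -
  have c: "coeff (high_poly (1 # p)) i = nth_default 0 (rev p @ [1]) i" for i
    by (simp add: high_poly_def coeff_Poly_eq)
  have "degree (high_poly (1 # p)) \<le> length p"
    by (rule degree_le) (auto simp: c nth_default_def)
  moreover have top: "coeff (high_poly (1 # p)) (length p) = 1" by (simp add: c nth_default_def nth_append)
  ultimately show "degree (high_poly (1 # p)) = length p" using le_degree[of "high_poly (1 # p)" "length p"] by simp
  with top show "monic (high_poly (1 # p))" by simp
qed

lemma mahler_measure_cyclotomics: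
  assumes "p \<in> set (map snd cyclotomics @ map snd more_cyclotomics)"
  shows "mahler_measure (high_poly (1 # p)) = 1" "degree (high_poly (1 # p)) \<ge> 1"
proof -
  have "\<exists>n. (n, p) \<in> set (cyclotomics @ more_cyclotomics)" using assms by auto
  then obtain n where "(n, p) \<in> set (cyclotomics @ more_cyclotomics)" by blast
  from bspec[OF cyclotomics_ok[unfolded list_all_iff] this]
  have n: "n \<ge> 1" "p \<noteq> []"
      "list_divides p (1 # replicate (n - 1) 0 @ [-1]) (1 # replicate (n - 1) 0 @ [-1])"
    by auto
  have "high_poly (1 # p) dvd monom 1 n - 1"
    using list_divides_sound(1)[OF n(3)] high_poly_power_minus_1[OF n(1)] by simp
  moreover have "monom 1 n - 1 \<noteq> (0 :: int poly)" using monic_power_minus_1[OF n(1)] by auto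
  ultimately have "mahler_measure (high_poly (1 # p)) \<le> 1"
    using mahler_measure_dvd mahler_measure_power_minus_1[OF n(1)] by metis
  moreover have "high_poly (1 # p) \<noteq> 0" using monic_high_poly(1)[of p] by auto
  ultimately show "mahler_measure (high_poly (1 # p)) = 1"
    using mahler_measure_poly_ge_1[of "high_poly (1 # p)"] by (intro antisym)
  show "degree (high_poly (1 # p)) \<ge> 1" using n(2) by (simp add: monic_high_poly(2) Suc_le_eq)
qed

lemma mahler_measure_lehmer_lists:
  assumes "p \<in> set lehmer_lists"
  shows "mahler_measure (high_poly (1 # p)) = lehmer_number"
proof -
  have "high_poly (1 # p) = lehmer_poly \<or> high_poly (1 # p) = pcompose lehmer_poly [:0, -1:]"
  proof -
    have "high_poly [1, 1, 0, -1, -1, -1, -1, -1, 0, 1, 1] = lehmer_poly"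
      by (simp add: high_poly_def lehmer_poly_def)
    moreover have "high_poly [1, -1, 0, 1, -1, 1, -1, 1, 0, -1, 1] = pcompose lehmer_poly [:0, -1:]"
      by (intro poly_eq_poly_eq_iff[THEN iffD1] ext)
         (simp add: high_poly_def lehmer_poly_def poly_pcompose algebra_simps)
    ultimately show ?thesis using assms by (auto simp: lehmer_lists_def)
  qed
  then show ?thesis by (auto simp: lehmer_number_def mahler_measure_pcompose_neg)
qed

section \<open>Evaluation of the search in degrees 2 to 16\<close>

lemma search_degree_1: "search_degree 1"
  by code_simp

lemma search_degree_2: "search_degree 2"
  by code_simp

lemma search_degree_3: "search_degree 3"
  by code_simp

lemma search_degree_4: "search_degree 4"
  by code_simp

lemma search_degree_5: "search_degree 5"
  by code_simp

lemma search_degree_6: "search_degree 6"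
  by code_simp

lemma search_degree_7: "search_degree 7"
  by code_simp

lemma search_degree_8: "search_degree 8"
  by code_simp

lemma search_degree_1_to_8:
  assumes "1 \<le> d" "d \<le> 8"
  shows "search_degree d"
proof -
  have "d = 1 \<or> d = 2 \<or> d = 3 \<or> d = 4 \<or> d = 5 \<or> d = 6 \<or> d = 7 \<or> d = 8"
    using assms by presburger
  then show ?thesis
    using search_degree_1 search_degree_2 search_degree_3 search_degree_4
      search_degree_5 search_degree_6 search_degree_7 search_degree_8 by blast
qed

lemma monic_left_factor:
  fixes p h :: "int poly"
  assumes "monic (p * h)" "monic p"
  shows "monic h"
  using assms by (simp add: lead_coeff_mult)

lemma mahler_measure_degree_le_16:
  assumes f: "monic f" "degree f \<le> 16" "mahler_measure f > 1"
  shows "mahler_measure f \<ge> lehmer_number"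
proof (rule ccontr)
  assume "\<not> mahler_measure f \<ge> lehmer_number"
  define small where "small q \<longleftrightarrow> monic q \<and> 1 < mahler_measure q \<and> mahler_measure q < lehmer_number" for q
  have "small f" using f \<open>\<not> _\<close> by (simp add: small_def)
  define q where "q = arg_min degree small"
  have small: "small q" using arg_min_natI[of small f degree] \<open>small f\<close> by (simp add: q_def)
  have min: "degree q \<le> degree g" if "small g" for g
    using arg_min_nat_le[of small g degree] that by (simp add: q_def)
  have q: "monic q" "1 < mahler_measure q" "mahler_measure q < lehmer_number" using small by (auto simp: small_def)
  have deg: "degree q \<le> 16" using min[OF \<open>small f\<close>] f by simp
  have q0: "q \<noteq> 0" using q by auto
  \<comment> \<open>The cofactor would have the same measure and smaller degree, against
    minimality.\<close>
  have no_factor: False if p: "monic p" "degree p \<ge> 1" "p dvd q" "mahler_measure p = 1" for p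
  proof -
    obtain h where h: "q = p * h" using p(3) by blast
    have "monic h" using monic_left_factor[of p h] q(1) p(1) h by simp
    moreover have "mahler_measure h = mahler_measure q" using h p(4) by (simp add: mahler_measure_mult)
    ultimately have "small h" using small by (simp add: small_def)
    moreover have "degree q = degree p + degree h" using h q0 by (simp add: degree_mult_eq)
    ultimately show False using min[of h] p(2) by simp
  qed
  have nru: "\<alpha> ^ n \<noteq> 1" if "poly (of_int_poly q) \<alpha> = 0" "n \<ge> 1" for n and \<alpha> :: complex
    using root_of_unity_factor[OF q(1) that] no_factor by metis
  have root: "poly (of_int_poly q) \<alpha> = 0" if "\<alpha> \<in> set (complex_roots_int q)" for \<alpha>
    unfolding of_int_poly_monic_roots[OF q(1)] using that
    by (auto simp: poly_prod_list prod_list_zero_iff o_def)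
  have "coeff q 0 \<noteq> 0"
  proof
    assume "coeff q 0 = 0"
    then have "[:0, 1:] dvd q" using poly_eq_0_iff_dvd[of q 0] by (simp add: poly_0_coeff_0)
    moreover have "mahler_measure [:0, 1:] = 1"
      by (rule mahler_measure_eq_1I) auto
    ultimately show False using no_factor[of "[:0, 1:]"] by simp
  qed
  moreover have "real_of_int \<bar>coeff q 0\<bar> < 2"
    using Mignotte_bound[of q 0] q(3) lehmer_number_bounds(2) by simp
  ultimately have c0: "\<bar>coeff q 0\<bar> = 1" by linarith
  have "reflect_poly q = q \<or> reflect_poly q = - q"
    using nonreciprocal_mahler_measure_ge[OF q(1) c0] q(3) lehmer_number_bounds(2) by fastforce
  \<comment> \<open>The minus sign would force a zero at 1, and odd degree below a zero at -1; both
    are roots of unity.\<close>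
  moreover have "reflect_poly q \<noteq> - q"
  proof
    assume "reflect_poly q = - q"
    then have "reflect_poly (of_int_poly q :: complex poly) = - of_int_poly q"
      by (simp add: reflect_of_int_poly of_int_poly_hom.hom_uminus)
    then have "poly (of_int_poly q) (1 :: complex) = - poly (of_int_poly q) 1"
      using poly_reflect_poly_nz[of "1 :: complex" "of_int_poly q"] by simp
    then have "poly (of_int_poly q) (1 :: complex) = 0" by simp
    then show False using nru[of 1 1] by simp
  qed
  ultimately have rec: "reflect_poly q = q" by blast
  have "even (degree q)"
  proof (rule ccontr)
    assume "odd (degree q)"
    moreover have "poly (of_int_poly q) (-1 :: complex) = (-1) ^ degree q * poly (of_int_poly q) (-1)"
    proof -
      have "reciprocal_poly q" using rec by (simp add: reciprocal_poly_def)
      then have "\<forall>t::complex. t \<noteq> 0 \<longrightarrow>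
          poly (of_int_poly q) t = t ^ degree q * poly (of_int_poly q) (1 / t)"
        unfolding reciprocal_poly_functional_equation .
      from this[rule_format, of "-1"] show ?thesis by simp
    qed
    ultimately have "poly (of_int_poly q) (-1 :: complex) = 0" by simp
    then show False using nru[of "-1" 2] by simp
  qed
  then obtain d where d: "degree q = 2 * d" by blast
  have "d \<noteq> 0"
  proof
    assume "d = 0"
    then have "q = 1" using d q(1) by (metis degree_eq_zeroE lead_coeff_pCons(2) mult_0_right one_pCons)
    then show False using q(2) by (simp add: mahler_measure_1)
  qed
  then have d8: "1 \<le> d" "d \<le> 8" using d deg by auto
  have "\<exists>p\<in>set (map snd cyclotomics @ map snd more_cyclotomics @ lehmer_lists). high_poly (1 # p) dvd q"
    using q(3) lehmer_number_bounds(2) d8 nru root search_degree_1_to_8[OF d8]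
    by (intro search_degree_sound[OF q(1) rec d]) auto
  then obtain p where p: "p \<in> set (map snd cyclotomics @ map snd more_cyclotomics) \<or> p \<in> set lehmer_lists"
    "high_poly (1 # p) dvd q" by auto
  \<comment> \<open>A cyclotomic divisor contradicts \<open>no_factor\<close>, a Lehmer divisor
    forces the measure of \<open>q\<close> up to \<open>lehmer_number\<close>.\<close>
  then show False
    using no_factor[OF monic_high_poly(1)] mahler_measure_cyclotomics[of p]
      mahler_measure_lehmer_lists[of p] mahler_measure_dvd[OF q0 p(2)] q(3) by force
qed

section \<open>Reciprocal and skew-reciprocal minima\<close>

text \<open>Northcott's finiteness: Mignotte's bound confines every coefficient. It is why the
  minima are attained and the descriptions by \<open>THE\<close> denote something.\<close>

lemma finite_bounded_mahler_measure:
  "finite {f :: int poly. degree f = n \<and> mahler_measure f \<le> C}"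
proof -
  define K where "K = \<lceil>2 ^ n * \<bar>C\<bar>\<rceil>"
  have "coeffs f \<in> {xs. set xs \<subseteq> {-K..K} \<and> length xs \<le> Suc n}"
    if "degree f = n" "mahler_measure f \<le> C" for f :: "int poly"
  proof -
    have "\<bar>coeff f i\<bar> \<le> K" for i
    proof -
      have "real_of_int \<bar>coeff f i\<bar> \<le> real (degree f choose i) * mahler_measure f"
        by (rule Mignotte_bound)
      also have "\<dots> \<le> 2 ^ n * \<bar>C\<bar>"
      proof (rule mult_mono)
        have "real (degree f choose i) \<le> real (2 ^ n)"
          using binomial_le_pow2[of n i] that(1) by (simp only: of_nat_le_iff)
        then show "real (degree f choose i) \<le> 2 ^ n" by simp
      qed (use that(2) mahler_measure_ge_0[of f] in auto)
      also have "\<dots> \<le> of_int K" unfolding K_def by (rule le_of_int_ceiling)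
      finally show ?thesis by (simp only: of_int_le_iff)
    qed
    then have "set (coeffs f) \<subseteq> {-K..K}"
      by (auto simp: coeffs_def abs_le_iff) (metis minus_le_iff)+
    then show ?thesis using that(1) by (auto simp: length_coeffs_degree coeffs_def)
  qed
  then have "coeffs ` {f :: int poly. degree f = n \<and> mahler_measure f \<le> C}
      \<subseteq> {xs. set xs \<subseteq> {-K..K} \<and> length xs \<le> Suc n}" by auto
  moreover have "finite {xs. set xs \<subseteq> {-K..K} \<and> length xs \<le> Suc n}"
    by (rule finite_lists_length_le) simp
  ultimately have "finite (coeffs ` {f :: int poly. degree f = n \<and> mahler_measure f \<le> C})"
    by (rule finite_subset)
  then show ?thesis by (rule finite_imageD) (simp add: inj_on_def coeffs_eq_iff)
qed

lemma is_smallest_unique: "is_smallest x A \<Longrightarrow> is_smallest y A \<Longrightarrow> x = y"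
  unfolding is_smallest_def by (meson antisym)

lemma is_smallest_exists:
  fixes P :: "int poly \<Rightarrow> bool"
  assumes "a \<in> {mahler_measure f |f. P f \<and> degree f = n \<and> mahler_measure f > 1}" (is "a \<in> ?A")
  shows "\<exists>x. is_smallest x ?A"
proof -
  have sub: "?A \<inter> {..a} \<subseteq> mahler_measure ` {f. degree f = n \<and> mahler_measure f \<le> a}" by auto
  have fin: "finite (?A \<inter> {..a})"
    by (rule finite_subset[OF sub]) (intro finite_imageI finite_bounded_mahler_measure)
  have ne: "?A \<inter> {..a} \<noteq> {}" using assms by blast
  have in_: "Min (?A \<inter> {..a}) \<in> ?A \<inter> {..a}" using fin ne by (rule Min_in)
  have "Min (?A \<inter> {..a}) \<le> y" if "y \<in> ?A" for y
  proof (cases "y \<le> a")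
    case True
    then show ?thesis using that fin by (intro Min_le) auto
  next
    case False
    then show ?thesis using in_ by auto
  qed
  then show ?thesis using in_ unfolding is_smallest_def by blast
qed

definition reciprocal_measures :: "nat \<Rightarrow> real set" where
  "reciprocal_measures i =
     {mahler_measure f |f. monic f \<and> reciprocal_poly f \<and> degree f = 2 ^ i \<and> mahler_measure f > 1}"

definition skew_reciprocal_measures :: "nat \<Rightarrow> real set" where
  "skew_reciprocal_measures i =
     {mahler_measure f |f. monic f \<and> skew_reciprocal_poly f \<and> degree f = 2 ^ i \<and> mahler_measure f > 1}"

lemma mahler_measure_linear:
  assumes "\<bar>a\<bar> \<le> 1"
  shows "mahler_measure [:a, 1:] = 1"
proof (rule mahler_measure_eq_1I)
  fix \<alpha> :: complex assume "poly (of_int_poly [:a, 1:]) \<alpha> = 0"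
  then have "\<alpha> = - of_int a" by (simp add: add_eq_0_iff add.commute)
  then have "cmod \<alpha> = of_int \<bar>a\<bar>" by simp
  then show "cmod \<alpha> \<le> 1" using assms by simp
qed simp

lemma reflect_poly_linear: "reflect_poly [:a, 1:] = [:1, a :: int:]"
  using reflect_poly_prod_linear[of "[- a]"]
  by (simp only: list.map prod_list.Cons prod_list.Nil mult_1_right minus_minus)

text \<open>Padding uses powers of \<open>t + 1\<close>, which is reciprocal of degree 1 with
  measure 1; \<open>t - 1\<close> would change the sign under reflection.\<close>

lemma reciprocal_measures_pad:
  assumes "monic f" "reciprocal_poly f" "mahler_measure f > 1" "degree f \<le> 2 ^ i"
  shows "mahler_measure f \<in> reciprocal_measures i"
proof -
  define l :: "int poly" where "l = [:1, 1:]"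
  have l: "reflect_poly l = l" "monic l" "degree l = 1" "l \<noteq> 0" "mahler_measure l = 1"
    unfolding l_def using reflect_poly_linear[of 1] mahler_measure_linear[of 1] by simp_all
  define g where "g = f * l ^ (2 ^ i - degree f)"
  have f0: "f \<noteq> 0" using assms(1) by auto
  have "reciprocal_poly g"
    using assms(2) by (simp add: reciprocal_poly_def g_def reflect_poly_mult reflect_poly_power l)
  moreover have "monic g" using assms(1) using l by (simp add: g_def lead_coeff_mult lead_coeff_power)
  moreover have "degree g = 2 ^ i"
    using f0 assms(4) using l by (simp add: g_def degree_mult_eq degree_power_eq)
  moreover have "mahler_measure g = mahler_measure f"
    using l by (simp add: g_def mahler_measure_mult mahler_measure_power)
  ultimately show ?thesis using assms(3) unfolding reciprocal_measures_def
    by (intro CollectI exI[of _ g]) auto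
qed

lemma lehmer_number_reciprocal_measure:
  assumes "i \<ge> 4"
  shows "lehmer_number \<in> reciprocal_measures i"
proof -
  have "(2 :: nat) ^ 4 \<le> 2 ^ i" using assms by (intro power_increasing) auto
  moreover have "reciprocal_poly lehmer_poly"
    by (simp add: reciprocal_poly_def lehmer_poly_def reflect_poly_def)
  ultimately show ?thesis
    unfolding lehmer_number_def
    using monic_lehmer_poly degree_lehmer_poly lehmer_number_bounds(1)
    by (intro reciprocal_measures_pad) (auto simp: lehmer_number_def)
qed

lemma smallest_reciprocal_measure_is_smallest:
  assumes "i \<ge> 4"
  shows "is_smallest (smallest_reciprocal_measure i) (reciprocal_measures i)"
proof -
  have "\<exists>x. is_smallest x (reciprocal_measures i)"
    using is_smallest_exists[of lehmer_number "\<lambda>f. monic f \<and> reciprocal_poly f" "2 ^ i"]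
      lehmer_number_reciprocal_measure[OF assms] by (simp add: reciprocal_measures_def)
  then show ?thesis
    unfolding smallest_reciprocal_measure_def reciprocal_measures_def[symmetric]
    by (metis is_smallest_unique theI)
qed

lemma abs_coeff_0_eq_1:
  assumes "monic f" "mahler_measure f < 2" "coeff f 0 \<noteq> 0"
  shows "\<bar>coeff f 0\<bar> = 1"
proof -
  have "real_of_int \<bar>coeff f 0\<bar> < 2" using Mignotte_bound[of f 0] assms(2) by simp
  then show ?thesis using assms(3) by linarith
qed

text \<open>Powers of \<open>t\<close> are stripped first. What remains equals its reflection up to
  sign, and a factor \<open>t - 1\<close> repairs the minus sign without changing the
  measure.\<close>

lemma small_mahler_measure_reciprocal:
  assumes "monic f" "mahler_measure f < 5/4"
  shows "\<exists>g. monic g \<and> reciprocal_poly g \<and> mahler_measure g = mahler_measure f"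
  using assms
proof (induction "degree f" arbitrary: f rule: less_induct)
  case less
  show ?case
  proof (cases "coeff f 0 = 0")
    case True
    then have "[:0, 1:] dvd f" using poly_eq_0_iff_dvd[of f 0] by (simp add: poly_0_coeff_0)
    then obtain h where h: "f = [:0, 1:] * h" by blast
    then have "monic h" using monic_left_factor[of "[:0, 1:]" h] less.prems(1) by simp
    moreover have "mahler_measure h = mahler_measure f"
      unfolding h mahler_measure_mult using mahler_measure_linear[of 0] by simp
    moreover have "degree h < degree f" using h less.prems(1) by (auto simp: degree_mult_eq)
    ultimately show ?thesis using less.hyps[of h] less.prems(2) by simp
  next
    case False
    then have "\<bar>coeff f 0\<bar> = 1" using abs_coeff_0_eq_1[of f] less.prems by simp
    then consider "f = reflect_poly f" | "f = - reflect_poly f"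
      using nonreciprocal_mahler_measure_ge[of f] less.prems by fastforce
    then show ?thesis
    proof cases
      case 1
      then show ?thesis using less.prems by (auto simp: reciprocal_poly_def)
    next
      case 2
      define l :: "int poly" where "l = [:-1, 1:]"
      have l1: "reflect_poly l = - l"
        using reflect_poly_linear[of "-1"] by (simp only: l_def minus_pCons minus_minus minus_zero)
      have l2: "mahler_measure l = 1" unfolding l_def by (rule mahler_measure_linear) simp
      have l3: "monic l" by (simp add: l_def)
      note l = l1 l2 l3
      have "reflect_poly f = - f" using 2 by (metis minus_minus)
      then have "reflect_poly (f * l) = f * l" by (simp add: reflect_poly_mult l)
      then show ?thesis using less.prems(1) l
        by (intro exI[of _ "f * l"]) (simp add: reciprocal_poly_def mahler_measure_mult lead_coeff_mult)
    qed
  qed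
qed

lemma coeff_pcompose_square:
  fixes g :: "int poly"
  shows "coeff (pcompose g (monom 1 2)) j = (if even j then coeff g (j div 2) else 0)"
proof -
  have "coeff (pcompose p [:0, 0, 1:]) j = (if even j then coeff p (j div 2) else 0)" for p :: "int poly"
  proof (induction p arbitrary: j)
    case (pCons a p)
    show ?case
    proof (cases j)
      case 0
      then show ?thesis by (simp add: pcompose_pCons)
    next
      case (Suc m)
      then show ?thesis
        using pCons by (cases m) (auto simp: pcompose_pCons coeff_pCons split: nat.splits)
    qed
  qed simp
  moreover have "monom 1 2 = [:0, 0, 1 :: int:]"
    by (intro poly_eqI) (auto simp: coeff_pCons numeral_2_eq_2 split: nat.splits)
  ultimately show ?thesis by simp
qed

lemma degree_pcompose_square: "degree (pcompose (g :: int poly) (monom 1 2)) = 2 * degree g"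
  by (simp add: degree_pcompose degree_monom_eq)

text \<open>For \<open>i \<ge> 2\<close> half the degree is even, so the sign in the skew condition
  is 1 and the condition says that \<open>f(t)\<close> is the reflection of \<open>f(-t)\<close>.
  Below 5/4 reflection changes \<open>f\<close> at most by a sign, and the sign is plus because
  \<open>f(-t)\<close> is monic too.\<close>

lemma skew_measures_eq:
  assumes "i \<ge> 2"
  shows "reciprocal_measures (i - 1) \<subseteq> skew_reciprocal_measures i"
    and "x \<in> skew_reciprocal_measures i \<Longrightarrow> x < 5/4 \<Longrightarrow> x \<in> reciprocal_measures (i - 1)"
proof -
  define d where "d = (2 :: nat) ^ (i - 1)"
  have "i = Suc (i - 1)" using assms by simp
  then have d: "2 ^ i = 2 * d" unfolding d_def by (metis power_Suc)
  have evd: "even d" using assms by (simp add: d_def)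
  show "reciprocal_measures (i - 1) \<subseteq> skew_reciprocal_measures i"
  proof
    fix x assume "x \<in> reciprocal_measures (i - 1)"
    then obtain g where g: "x = mahler_measure g" "monic g" "reciprocal_poly g" "degree g = d" "x > 1"
      by (auto simp: reciprocal_measures_def d_def)
    define f where "f = pcompose g (monom 1 2)"
    have deg: "degree f = 2 * d" unfolding f_def degree_pcompose_square g(4) ..
    have "pcompose f [:0, -1:] = f"
      by (intro poly_eqI) (simp add: coeff_pcompose_linear f_def coeff_pcompose_square)
    moreover have "reflect_poly f = f"
    proof (rule poly_eqI)
      fix j
      have "coeff g (d - k) = coeff g k" if "k \<le> d" for k
        using that g(3,4) coeff_reflect_poly[of g k] by (simp add: reciprocal_poly_def)
      moreover have "(2 * d - j) div 2 = d - j div 2" if "even j" using that by auto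
      moreover have "coeff g (j div 2) = 0" if "j > 2 * d" "even j"
        using that g(4) by (intro coeff_eq_0) auto
      ultimately show "coeff (reflect_poly f) j = coeff f j"
        unfolding coeff_reflect_poly deg by (auto simp: f_def coeff_pcompose_square)
    qed
    ultimately have "skew_reciprocal_poly f" using evd by (simp add: skew_reciprocal_poly_def deg)
    moreover have "monic f" unfolding deg using g(2,4) by (simp add: f_def coeff_pcompose_square)
    moreover have "mahler_measure f = x" by (simp add: f_def mahler_measure_pcompose_square g(1))
    ultimately show "x \<in> skew_reciprocal_measures i"
      using deg d g(5) unfolding skew_reciprocal_measures_def by (intro CollectI exI[of _ f]) auto
  qed
  assume "x \<in> skew_reciprocal_measures i" "x < 5/4"
  then obtain f where f: "x = mahler_measure f" "monic f" "skew_reciprocal_poly f" "degree f = 2 * d" "x > 1" "x < 5/4"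
    by (auto simp: skew_reciprocal_measures_def d)
  define h where "h = pcompose f [:0, -1:]"
  have fh: "f = reflect_poly h" using f(3,4) evd by (simp add: skew_reciprocal_poly_def h_def)
  have degh: "degree h = 2 * d" by (simp add: h_def degree_pcompose f(4))
  have lh: "lead_coeff h = 1" using f(2,4) by (simp add: degh h_def coeff_pcompose_linear)
  have h0: "coeff h 0 = coeff f 0" by (simp only: h_def coeff_pcompose_linear power_0 mult_1)
  \<comment> \<open>A nonzero constant term makes reflection an involution on \<open>f\<close> and
    \<open>h\<close>.\<close>
  have f0: "coeff f 0 = 1" using fh lh by simp
  then have rf: "reflect_poly f = h" using h0 by (simp add: fh)
  have "f = h \<or> f = - h"
    using nonreciprocal_mahler_measure_ge[OF f(2)] f0 f(1,6) rf by fastforce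
  moreover have "f \<noteq> - h" using lh f(2,4) degh by auto
  ultimately have hf: "h = f" by simp
  have odd0: "coeff f j = 0" if "odd j" for j
  proof -
    have "coeff f j = (-1) ^ j * coeff f j"
      using arg_cong[OF hf, of "\<lambda>p. coeff p j"] by (simp add: h_def coeff_pcompose_linear)
    then show ?thesis using that by simp
  qed
  define g where "g = poly_square_subst f"
  have cg: "coeff g j = coeff f (2 * j)" for j by (simp add: g_def poly_square_subst_coeff)
  have fg: "f = pcompose g (monom 1 2)"
    by (intro poly_eqI) (auto simp: coeff_pcompose_square cg odd0)
  have degg: "degree g = d" using degree_pcompose_square[of g] f(4) unfolding fg[symmetric] by simp
  have "monic g" using f(2,4) by (simp add: degg cg)
  moreover have "reciprocal_poly g"
    unfolding reciprocal_poly_def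
  proof (rule poly_eqI)
    fix j
    have "coeff f (2 * d - 2 * j) = coeff f (2 * j)" if "j \<le> d"
      using coeff_reflect_poly[of f "2 * j"] rf hf f(4) that by simp
    moreover have "2 * (d - j) = 2 * d - 2 * j" by simp
    ultimately show "coeff g j = coeff (reflect_poly g) j"
      using f(4) by (simp add: coeff_reflect_poly degg cg coeff_eq_0)
  qed
  moreover have "mahler_measure g = x" using mahler_measure_pcompose_square[of g] fg f(1) by simp
  ultimately show "x \<in> reciprocal_measures (i - 1)"
    using f(5) degg unfolding reciprocal_measures_def d_def by (intro CollectI exI[of _ g]) auto
qed

text \<open>From \<open>i \<ge> 5\<close> on, Lehmer's polynomial fits into degree
  \<open>2^(i-1)\<close>, so the reciprocal minimum is below 5/4, and skew-reciprocal measures from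
  5/4 upwards cannot compete with it.\<close>

lemma smallest_skew_reciprocal_measure_eq:
  assumes "i \<ge> 5"
  shows "smallest_skew_reciprocal_measure i = smallest_reciprocal_measure (i - 1)"
proof -
  define x where "x = smallest_reciprocal_measure (i - 1)"
  have i: "i - 1 \<ge> 4" "i \<ge> 2" using assms by auto
  have x: "x \<in> reciprocal_measures (i - 1)" "\<And>y. y \<in> reciprocal_measures (i - 1) \<Longrightarrow> x \<le> y"
    using smallest_reciprocal_measure_is_smallest[OF i(1)] by (auto simp: is_smallest_def x_def)
  have "x < 5/4" using x(2)[OF lehmer_number_reciprocal_measure[OF i(1)]] lehmer_number_bounds(2) by simp
  have "is_smallest x (skew_reciprocal_measures i)"
    unfolding is_smallest_def
  proof (intro conjI ballI)
    show "x \<in> skew_reciprocal_measures i" using skew_measures_eq(1)[OF i(2)] x(1) by blast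
    fix y assume y: "y \<in> skew_reciprocal_measures i"
    show "x \<le> y"
      using skew_measures_eq(2)[OF i(2) y] x(2) \<open>x < 5/4\<close> by (cases "y < 5/4") auto
  qed
  then show ?thesis
    unfolding smallest_skew_reciprocal_measure_def skew_reciprocal_measures_def[symmetric] x_def
    by (rule the_equality) (metis is_smallest_unique \<open>is_smallest x _\<close> x_def)
qed

theorem theorem1:
  shows "(is_smallest lehmer_number {mahler_measure f |f. monic f \<and> mahler_measure f > 1}
            \<longleftrightarrow> (\<forall>i\<ge>5. smallest_reciprocal_measure i = smallest_skew_reciprocal_measure i))
       \<and> (1 islimpt {mahler_measure f |f. monic f}
            \<longleftrightarrow> (\<lambda>N. \<Prod>i=5..N. smallest_reciprocal_measure i / smallest_skew_reciprocal_measure i)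
                  \<longlonglongrightarrow> inverse lehmer_number)"
proof -
  define R where "R = smallest_reciprocal_measure"
  note lb = lehmer_number_bounds
  have R: "R i \<in> reciprocal_measures i" "\<And>y. y \<in> reciprocal_measures i \<Longrightarrow> R i \<le> y" if "i \<ge> 4" for i
    using smallest_reciprocal_measure_is_smallest[OF that] by (auto simp: is_smallest_def R_def)
  have Rf: "\<exists>f. monic f \<and> mahler_measure f = R i \<and> R i > 1" if "i \<ge> 4" for i
    using R(1)[OF that] by (auto simp: reciprocal_measures_def)
  have Rle: "R i \<le> lehmer_number" if "i \<ge> 4" for i
    using R(2)[OF that] lehmer_number_reciprocal_measure[OF that] by blast
  have R4: "R 4 = lehmer_number"
  proof (rule antisym)
    obtain f where "monic f" "degree f = 2 ^ 4" "mahler_measure f > 1" "mahler_measure f = R 4"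
      using R(1)[of 4] by (auto simp: reciprocal_measures_def)
    then show "lehmer_number \<le> R 4" using mahler_measure_degree_le_16[of f] by simp
  qed (simp add: Rle)
  have S: "smallest_skew_reciprocal_measure i = R (i - 1)" if "i \<ge> 5" for i
    using smallest_skew_reciprocal_measure_eq[OF that] by (simp add: R_def)
  \<comment> \<open>Every measure between 1 and \<open>lehmer_number\<close> is eventually an upper
    bound for \<open>R\<close>; both equivalences rest on this.\<close>
  have small: "\<exists>i\<ge>4. \<forall>j\<ge>i. R j \<le> mahler_measure f"
    if f: "monic f" "1 < mahler_measure f" "mahler_measure f < lehmer_number" for f
  proof -
    obtain g where g: "monic g" "reciprocal_poly g" "mahler_measure g = mahler_measure f"
      using small_mahler_measure_reciprocal[of f] f lb(2) by auto
    have "R j \<le> mahler_measure f" if "j \<ge> max 4 (degree g)" for j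
    proof -
      have "degree g \<le> j" using that by simp
      also have "j \<le> 2 ^ j" by (rule less_imp_le) (rule less_exp)
      finally have "mahler_measure g \<in> reciprocal_measures j"
        using g f by (intro reciprocal_measures_pad) auto
      then show ?thesis using R(2)[of j] that g(3) by simp
    qed
    then show ?thesis by (intro exI[of _ "max 4 (degree g)"]) auto
  qed
  have 1: "is_smallest lehmer_number {mahler_measure f |f. monic f \<and> mahler_measure f > 1}
      \<longleftrightarrow> (\<forall>i\<ge>5. R i = R (i - 1))"
  proof
    assume min: "is_smallest lehmer_number {mahler_measure f |f. monic f \<and> mahler_measure f > 1}"
    have "R i = lehmer_number" if i: "i \<ge> 4" for i
    proof (rule antisym[OF Rle[OF i]])
      obtain f where "monic f" "mahler_measure f = R i" "R i > 1" using Rf[OF i] by blast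
      then show "lehmer_number \<le> R i" using min by (force simp: is_smallest_def)
    qed
    then show "\<forall>i\<ge>5. R i = R (i - 1)" by auto
  next
    assume const: "\<forall>i\<ge>5. R i = R (i - 1)"
    have Rconst: "R i = lehmer_number" if "i \<ge> 4" for i
      using that
    proof (induction i rule: dec_induct)
      case (step n)
      then show ?case using const[rule_format, of "Suc n"] by simp
    qed (rule R4)
    show "is_smallest lehmer_number {mahler_measure f |f. monic f \<and> mahler_measure f > 1}"
      unfolding is_smallest_def
    proof (intro conjI ballI)
      show "lehmer_number \<in> {mahler_measure f |f. monic f \<and> mahler_measure f > 1}"
        using monic_lehmer_poly lb(1) unfolding lehmer_number_def by blast
      fix y assume "y \<in> {mahler_measure f |f. monic f \<and> mahler_measure f > 1}"
      then obtain f where f: "y = mahler_measure f" "monic f" "mahler_measure f > 1" by blast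
      show "lehmer_number \<le> y"
      proof (rule ccontr)
        assume "\<not> lehmer_number \<le> y"
        then obtain i where "i \<ge> 4" "R i \<le> y" using small[of f] f by auto
        then show False using Rconst[of i] \<open>\<not> lehmer_number \<le> y\<close> by simp
      qed
    qed
  qed
  \<comment> \<open>At \<open>N = 4\<close> the product is empty and the formula is
    \<open>R 4 = lehmer_number\<close>.\<close>
  have prod: "(\<Prod>i=5..N. R i / R (i - 1)) = R N / lehmer_number" if "N \<ge> 4" for N
    using that
  proof (induction N rule: dec_induct)
    case base
    then show ?case using R4 lb(1) by simp
  next
    case (step n)
    have "R n > 1" using Rf[of n] step(1) by auto
    then show ?case using step by simp
  qed
  have 2: "1 islimpt {mahler_measure f |f. monic f}
      \<longleftrightarrow> (\<lambda>N. \<Prod>i=5..N. R i / R (i - 1)) \<longlonglongrightarrow> inverse lehmer_number"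
  proof -
    have "(\<lambda>N. \<Prod>i=5..N. R i / R (i - 1)) \<longlonglongrightarrow> inverse lehmer_number
        \<longleftrightarrow> (\<lambda>N. R N / lehmer_number) \<longlonglongrightarrow> inverse lehmer_number"
      by (intro filterlim_cong refl eventually_sequentiallyI[of 4]) (simp only: prod)
    also have "\<dots> \<longleftrightarrow> R \<longlonglongrightarrow> 1"
    proof
      assume "(\<lambda>N. R N / lehmer_number) \<longlonglongrightarrow> inverse lehmer_number"
      from tendsto_mult[OF this tendsto_const[of lehmer_number]] show "R \<longlonglongrightarrow> 1" using lb(1) by simp
    next
      assume "R \<longlonglongrightarrow> 1"
      from tendsto_divide[OF this tendsto_const[of lehmer_number]]
      show "(\<lambda>N. R N / lehmer_number) \<longlonglongrightarrow> inverse lehmer_number"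
        using lb(1) by (simp add: inverse_eq_divide)
    qed
    also have "\<dots> \<longleftrightarrow> 1 islimpt {mahler_measure f |f. monic f}"
    proof
      assume lim: "R \<longlonglongrightarrow> 1"
      show "1 islimpt {mahler_measure f |f. monic f}"
        unfolding islimpt_approachable
      proof (intro allI impI)
        fix e :: real assume "e > 0"
        then obtain N where N: "\<forall>n\<ge>N. dist (R n) 1 < e"
          using lim by (auto simp: lim_sequentially)
        obtain f where "monic f" "mahler_measure f = R (max 4 N)" "R (max 4 N) > 1" using Rf[of "max 4 N"] by auto
        then have "R (max 4 N) \<in> {mahler_measure f |f. monic f}" "R (max 4 N) \<noteq> 1"
          by (auto intro!: exI[of _ f])
        moreover have "dist (R (max 4 N)) 1 < e" using N by simp
        ultimately show "\<exists>x'\<in>{mahler_measure f |f. monic f}. x' \<noteq> 1 \<and> dist x' 1 < e" by blast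
      qed
    next
      assume lim: "1 islimpt {mahler_measure f |f. monic f}"
      show "R \<longlonglongrightarrow> 1"
        unfolding lim_sequentially
      proof (intro allI impI)
        fix e :: real assume "e > 0"
        \<comment> \<open>Staying within \<open>lehmer_number - 1\<close> of 1 as well brings the
          measure into the range of \<open>small\<close>.\<close>
        then have "min e (lehmer_number - 1) > 0" using lb(1) by simp
        then obtain f where f: "monic f" "mahler_measure f \<noteq> 1"
            "dist (mahler_measure f) 1 < min e (lehmer_number - 1)"
          using lim unfolding islimpt_approachable by blast
        have "f \<noteq> 0" using f(1) by auto
        then have "mahler_measure f > 1" using mahler_measure_poly_ge_1[of f] f(2) by simp
        moreover from this have "mahler_measure f < lehmer_number" using f(3) by (simp add: dist_real_def)
        ultimately obtain i where i: "i \<ge> 4" "\<forall>j\<ge>i. R j \<le> mahler_measure f" using small[OF f(1)] by blast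
        have "dist (R n) 1 < e" if "n \<ge> i" for n
        proof -
          have "R n \<le> mahler_measure f" "R n > 1" using i that Rf[of n] by auto
          then show ?thesis using f(3) by (simp add: dist_real_def)
        qed
        then show "\<exists>no. \<forall>n\<ge>no. dist (R n) 1 < e" by blast
      qed
    qed
    finally show ?thesis by simp
  qed
  have "(\<forall>i\<ge>5. smallest_reciprocal_measure i = smallest_skew_reciprocal_measure i) \<longleftrightarrow> (\<forall>i\<ge>5. R i = R (i - 1))"
    using S by (auto simp: R_def)
  moreover have "(\<lambda>N. \<Prod>i=5..N. smallest_reciprocal_measure i / smallest_skew_reciprocal_measure i)
      = (\<lambda>N. \<Prod>i=5..N. R i / R (i - 1))"
    by (intro ext prod.cong) (auto simp: S R_def)
  ultimately show ?thesis using 1 2 by simp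
qed

end
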